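(* Let $p$ be a prime and let $0<t\le s\le 1$. If $E\subset\mathbb{Q}_p^2$ is an $(s,t)$-Furstenberg set, then $$\dim_H E\ge s+t .$$ Moreover this bound is sharp: for every such $s,t$ there exists an $(s,t)$-Furstenberg set $E\subset\mathbb{Q}_p^2$ with $\dim_H E=s+t$.
   Context: $\mathbb{Q}_p$ carries the $p$-adic norm $\|x\|=p^{-\mathrm{val}_p(x)}$, and $\mathbb{Q}_p^2$ carries the metric induced by $\|(a,b)\|=\max\{\|a\|,\|b\|\}$; $\dim_H$ denotes Hausdorff dimension with respect to this metric. For $s\in(0,1]$ and $t\in(0,2]$, an $(s,t)$-Furstenberg set is a set $E\subset\mathbb{Q}_p^2$ for which there exists a family $\mathcal{L}$ of (affine) lines in $\mathbb{Q}_p^2$ with $\dim_H\mathcal{L}\ge t$ such that $\dim_H(E\cap l)\ge s$ for all $l\in\mathcal{L}$. The Hausdorff dimension of a family of lines is taken with respect to the natural two-parameter coordinates on the set of lines: $\dim_H\mathcal{L}$ is the maximum of $\dim_H\{(a,b)\in\mathbb{Q}_p^2:\{(x,y): y=ax+b\}\in\mathcal{L}\}$ and $\dim_H\{(a,b)\in\mathbb{Q}_p^2:\{(x,y): x=ay+b\}\in\mathcal{L}\}$. *)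

theory Defs
  imports "HOL-Analysis.Analysis" "Berlekamp_Zassenhaus.Finite_Field"
begin

section \<open>The $p$-adic absolute value on the rationals\<close>

definition rat_pval :: "nat \<Rightarrow> rat \<Rightarrow> int" where
  "rat_pval p x = int (multiplicity (int p) (fst (quotient_of x)))
                - int (multiplicity (int p) (snd (quotient_of x)))"

definition rat_pnorm :: "nat \<Rightarrow> rat \<Rightarrow> real" where
  "rat_pnorm p x = (if x = 0 then 0 else real p powi (- rat_pval p x))"

definition pcauchy :: "nat \<Rightarrow> (nat \<Rightarrow> rat) \<Rightarrow> bool" where
  "pcauchy p X \<longleftrightarrow> (\<forall>e>0. \<exists>k. \<forall>m\<ge>k. \<forall>n\<ge>k. rat_pnorm p (X m - X n) < e)"

definition pnull :: "nat \<Rightarrow> (nat \<Rightarrow> rat) \<Rightarrow> bool" where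
  "pnull p X \<longleftrightarrow> (\<lambda>n. rat_pnorm p (X n)) \<longlonglongrightarrow> 0"

definition padicrel :: "nat \<Rightarrow> (nat \<Rightarrow> rat) \<Rightarrow> (nat \<Rightarrow> rat) \<Rightarrow> bool" where
  "padicrel p X Y \<longleftrightarrow> pcauchy p X \<and> pcauchy p Y \<and> pnull p (\<lambda>n. X n - Y n)"

lemma pcauchyD:
  "pcauchy p X \<Longrightarrow> 0 < e \<Longrightarrow> \<exists>k. \<forall>m\<ge>k. \<forall>n\<ge>k. rat_pnorm p (X m - X n) < e"
  by (auto simp: pcauchy_def)

lemma rat_pnorm_0 [simp]: "rat_pnorm p 0 = 0"
  by (simp add: rat_pnorm_def)

lemma rat_pval_of_int_divide:
  assumes p: "prime p" and "a \<noteq> 0" "b \<noteq> 0"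
  shows "rat_pval p (of_int a / of_int b)
       = int (multiplicity (int p) a) - int (multiplicity (int p) b)"
proof -
  obtain c d where cd: "quotient_of (of_int a / of_int b) = (c, d)"
    by (cases "quotient_of (of_int a / of_int b)")
  have d: "d > 0" using quotient_of_denom_pos[OF cd] .
  have eq: "(of_int a / of_int b :: rat) = of_int c / of_int d"
    using quotient_of_div[OF cd] .
  hence "(of_int (a * d) :: rat) = of_int (c * b)"
    using assms d by (simp add: field_simps)
  hence ad: "a * d = c * b" by (simp only: of_int_eq_iff)
  hence c: "c \<noteq> 0" using assms d by auto
  have pe: "prime_elem (int p)" using p by simp
  have "multiplicity (int p) (a * d) = multiplicity (int p) (c * b)" using ad by simp
  hence "multiplicity (int p) a + multiplicity (int p) d
       = multiplicity (int p) c + multiplicity (int p) b"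
    using pe assms c d by (simp add: prime_elem_multiplicity_mult_distrib)
  thus ?thesis by (simp add: rat_pval_def cd)
qed

lemma rat_as_quotient:
  assumes "(x::rat) \<noteq> 0"
  obtains a b :: int where "a \<noteq> 0" "b \<noteq> 0" "x = of_int a / of_int b"
proof -
  obtain a b where ab: "quotient_of x = (a, b)" by (cases "quotient_of x")
  have "b > 0" "x = of_int a / of_int b"
    using quotient_of_denom_pos[OF ab] quotient_of_div[OF ab] by auto
  thus ?thesis using that[of a b] assms by auto
qed

context
  fixes p :: nat
  assumes p: "prime p"
begin

lemma p_gt_1: "real p > 1"
  using prime_gt_1_nat[OF p] by simp

lemma rat_pval_mult:
  assumes "x \<noteq> 0" "y \<noteq> 0"
  shows "rat_pval p (x * y) = rat_pval p x + rat_pval p y"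
proof -
  obtain a b where ab: "a \<noteq> 0" "b \<noteq> 0" "x = of_int a / of_int b"
    using rat_as_quotient assms by blast
  obtain c d where cd: "c \<noteq> 0" "d \<noteq> 0" "y = of_int c / of_int d"
    using rat_as_quotient assms by blast
  have xy: "x * y = of_int (a * c) / of_int (b * d)" using ab cd by simp
  have pe: "prime_elem (int p)" using p by simp
  show ?thesis unfolding xy
    using ab cd pe p by (simp add: rat_pval_of_int_divide prime_elem_multiplicity_mult_distrib
        del: of_int_mult)
qed

lemma rat_pval_add:
  assumes "x \<noteq> 0" "y \<noteq> 0" "x + y \<noteq> 0"
  shows "rat_pval p (x + y) \<ge> min (rat_pval p x) (rat_pval p y)"
proof -
  obtain a b where ab: "a \<noteq> 0" "b \<noteq> 0" "x = of_int a / of_int b"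
    using rat_as_quotient assms by blast
  obtain c d where cd: "c \<noteq> 0" "d \<noteq> 0" "y = of_int c / of_int d"
    using rat_as_quotient assms by blast
  have x: "x = of_int (a * d) / of_int (b * d)" and y: "y = of_int (b * c) / of_int (b * d)"
    and xy: "x + y = of_int (a * d + b * c) / of_int (b * d)"
    using ab cd by (simp_all add: field_simps)
  let ?m = "multiplicity (int p)"
  have nz: "a * d + b * c \<noteq> 0" using xy assms(3) by (metis of_int_0 div_0)
  have "\<not> is_unit (int p)" using p_gt_1 by simp
  moreover have "int p ^ min (?m (a * d)) (?m (b * c)) dvd a * d + b * c"
    by (intro dvd_add multiplicity_dvd') auto
  ultimately have "min (?m (a * d)) (?m (b * c)) \<le> ?m (a * d + b * c)"
    using nz by (intro multiplicity_geI) auto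
  moreover have "rat_pval p x = int (?m (a * d)) - int (?m (b * d))"
    unfolding x by (rule rat_pval_of_int_divide) (use p ab cd in auto)
  moreover have "rat_pval p y = int (?m (b * c)) - int (?m (b * d))"
    unfolding y by (rule rat_pval_of_int_divide) (use p ab cd in auto)
  moreover have "rat_pval p (x + y) = int (?m (a * d + b * c)) - int (?m (b * d))"
    unfolding xy by (rule rat_pval_of_int_divide) (use p ab cd nz in auto)
  ultimately show ?thesis by linarith
qed

lemma rat_pnorm_nonneg [simp]: "0 \<le> rat_pnorm p x"
  by (simp add: rat_pnorm_def)

lemma rat_pnorm_eq_0 [simp]: "rat_pnorm p x = 0 \<longleftrightarrow> x = 0"
  using p_gt_1 by (simp add: rat_pnorm_def)

lemma rat_pnorm_mult: "rat_pnorm p (x * y) = rat_pnorm p x * rat_pnorm p y"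
  using p_gt_1 by (auto simp: rat_pnorm_def rat_pval_mult simp flip: power_int_add)

lemma rat_pnorm_1 [simp]: "rat_pnorm p 1 = 1"
  by (simp add: rat_pnorm_def rat_pval_def)

lemma rat_pnorm_minus [simp]: "rat_pnorm p (- x) = rat_pnorm p x"
proof -
  have "rat_pnorm p (-1) * rat_pnorm p (-1) = 1"
    by (simp flip: rat_pnorm_mult)
  hence "rat_pnorm p (-1) = 1"
    using rat_pnorm_nonneg[of "-1"] by (metis abs_of_nonneg power2_eq_square power2_eq_1_iff abs_1 abs_minus_cancel)
  thus ?thesis using rat_pnorm_mult[of "-1" x] by simp
qed

lemma rat_pnorm_add: "rat_pnorm p (x + y) \<le> max (rat_pnorm p x) (rat_pnorm p y)"
proof (cases "x = 0 \<or> y = 0 \<or> x + y = 0")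
  case True
  thus ?thesis
    by (metis add.left_neutral add.right_neutral max.cobounded1 max.cobounded2 rat_pnorm_0
        rat_pnorm_nonneg max.coboundedI1)
next
  case False
  hence v: "min (rat_pval p x) (rat_pval p y) \<le> rat_pval p (x + y)"
    using rat_pval_add by blast
  have "real p powi (- rat_pval p (x + y)) \<le> real p powi (- min (rat_pval p x) (rat_pval p y))"
    using p_gt_1 v by (intro power_int_increasing) auto
  thus ?thesis using False by (auto simp: rat_pnorm_def min_def split: if_splits)
qed

lemma rat_pnorm_triangle: "rat_pnorm p (x + y) \<le> rat_pnorm p x + rat_pnorm p y"
  using rat_pnorm_add[of x y] rat_pnorm_nonneg[of x] rat_pnorm_nonneg[of y] by linarith

lemma rat_pnorm_diff: "rat_pnorm p (x - y) \<le> max (rat_pnorm p x) (rat_pnorm p y)"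
  using rat_pnorm_add[of x "-y"] by simp

lemma rat_pnorm_commute: "rat_pnorm p (x - y) = rat_pnorm p (y - x)"
  using rat_pnorm_minus[of "x - y"] by simp

lemma rat_pnorm_reverse: "\<bar>rat_pnorm p x - rat_pnorm p y\<bar> \<le> rat_pnorm p (x - y)"
  using rat_pnorm_triangle[of "x - y" y] rat_pnorm_triangle[of "y - x" x]
  by (simp add: rat_pnorm_commute[of y x] abs_le_iff)

lemma rat_pnorm_inverse: "rat_pnorm p (inverse x) = inverse (rat_pnorm p x)"
proof (cases "x = 0")
  case False
  hence "rat_pnorm p x * rat_pnorm p (inverse x) = 1"
    by (simp flip: rat_pnorm_mult)
  thus ?thesis by (simp add: inverse_unique)
qed simp

lemma pcauchy_const [simp]: "pcauchy p (\<lambda>n. c)"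
  by (simp add: pcauchy_def)

lemma pcauchy_add:
  assumes X: "pcauchy p X" and Y: "pcauchy p Y"
  shows "pcauchy p (\<lambda>n. X n + Y n)"
  unfolding pcauchy_def
proof (intro allI impI)
  fix e :: real assume e: "e > 0"
  obtain i where i: "\<forall>m\<ge>i. \<forall>n\<ge>i. rat_pnorm p (X m - X n) < e" using pcauchyD[OF X e] ..
  obtain j where j: "\<forall>m\<ge>j. \<forall>n\<ge>j. rat_pnorm p (Y m - Y n) < e" using pcauchyD[OF Y e] ..
  have "rat_pnorm p (X m + Y m - (X n + Y n)) < e" if "m \<ge> max i j" "n \<ge> max i j" for m n
  proof -
    have "rat_pnorm p (X m + Y m - (X n + Y n))
        \<le> max (rat_pnorm p (X m - X n)) (rat_pnorm p (Y m - Y n))"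
      unfolding add_diff_add by (rule rat_pnorm_add)
    also have "\<dots> < e" using i j that by simp
    finally show ?thesis .
  qed
  thus "\<exists>k. \<forall>m\<ge>k. \<forall>n\<ge>k. rat_pnorm p (X m + Y m - (X n + Y n)) < e" by blast
qed

lemma pcauchy_minus: "pcauchy p X \<Longrightarrow> pcauchy p (\<lambda>n. - X n)"
  unfolding pcauchy_def minus_diff_minus rat_pnorm_minus .

lemma pcauchy_diff: "pcauchy p X \<Longrightarrow> pcauchy p Y \<Longrightarrow> pcauchy p (\<lambda>n. X n - Y n)"
  using pcauchy_add[OF _ pcauchy_minus, of X Y] by simp

lemma pcauchy_norm_convergent:
  assumes "pcauchy p X"
  shows "convergent (\<lambda>n. rat_pnorm p (X n))"
proof -
  have "Cauchy (\<lambda>n. rat_pnorm p (X n))"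
    unfolding Cauchy_def dist_real_def
  proof (intro allI impI)
    fix e :: real assume "e > 0"
    then obtain k where "\<forall>m\<ge>k. \<forall>n\<ge>k. rat_pnorm p (X m - X n) < e"
      using pcauchyD[OF assms] by blast
    thus "\<exists>k. \<forall>m\<ge>k. \<forall>n\<ge>k. \<bar>rat_pnorm p (X m) - rat_pnorm p (X n)\<bar> < e"
      by (intro exI[of _ k] allI impI order.strict_trans1[OF rat_pnorm_reverse]) auto
  qed
  thus ?thesis by (simp add: Cauchy_convergent_iff)
qed

lemma pcauchy_bounded:
  assumes "pcauchy p X"
  shows "\<exists>b>0. \<forall>n. rat_pnorm p (X n) \<le> b"
proof -
  have "Bseq (\<lambda>n. rat_pnorm p (X n))"
    using pcauchy_norm_convergent[OF assms] by (rule convergent_imp_Bseq)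
  thus ?thesis by (auto simp: Bseq_def)
qed

lemma pcauchy_mult:
  assumes X: "pcauchy p X" and Y: "pcauchy p Y"
  shows "pcauchy p (\<lambda>n. X n * Y n)"
  unfolding pcauchy_def
proof (intro allI impI)
  fix e :: real assume e: "e > 0"
  obtain a where a: "a > 0" "\<forall>n. rat_pnorm p (X n) \<le> a" using pcauchy_bounded[OF X] by blast
  obtain b where b: "b > 0" "\<forall>n. rat_pnorm p (Y n) \<le> b" using pcauchy_bounded[OF Y] by blast
  obtain i where i: "\<forall>m\<ge>i. \<forall>n\<ge>i. rat_pnorm p (X m - X n) < e / b"
    using pcauchyD[OF X, of "e / b"] e b by auto
  obtain j where j: "\<forall>m\<ge>j. \<forall>n\<ge>j. rat_pnorm p (Y m - Y n) < e / a"
    using pcauchyD[OF Y, of "e / a"] e a by auto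
  have "rat_pnorm p (X m * Y m - X n * Y n) < e" if mn: "m \<ge> max i j" "n \<ge> max i j" for m n
  proof -
    have "rat_pnorm p (X m * Y m - X n * Y n)
        \<le> max (rat_pnorm p (X m * (Y m - Y n))) (rat_pnorm p ((X m - X n) * Y n))"
      unfolding mult_diff_mult by (rule rat_pnorm_add)
    also have "\<dots> = max (rat_pnorm p (X m) * rat_pnorm p (Y m - Y n))
                       (rat_pnorm p (X m - X n) * rat_pnorm p (Y n))"
      by (simp add: rat_pnorm_mult)
    also have "\<dots> < e"
    proof -
      have "rat_pnorm p (X m) * rat_pnorm p (Y m - Y n) \<le> a * rat_pnorm p (Y m - Y n)"
        using a by (intro mult_right_mono) auto
      also have "\<dots> < a * (e / a)" using a j mn by (intro mult_strict_left_mono) auto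
      finally have 1: "rat_pnorm p (X m) * rat_pnorm p (Y m - Y n) < e" using a by simp
      have "rat_pnorm p (X m - X n) * rat_pnorm p (Y n) \<le> rat_pnorm p (X m - X n) * b"
        using b by (intro mult_left_mono) auto
      also have "\<dots> < (e / b) * b" using b i mn by (intro mult_strict_right_mono) auto
      finally have 2: "rat_pnorm p (X m - X n) * rat_pnorm p (Y n) < e" using b by simp
      from 1 2 show ?thesis by simp
    qed
    finally show ?thesis .
  qed
  thus "\<exists>k. \<forall>m\<ge>k. \<forall>n\<ge>k. rat_pnorm p (X m * Y m - X n * Y n) < e" by blast
qed

lemma pcauchy_not_pnull:
  assumes X: "pcauchy p X" and nz: "\<not> pnull p X"
  shows "\<exists>b>0. \<exists>k. \<forall>n\<ge>k. b < rat_pnorm p (X n)"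
proof -
  obtain L where L: "(\<lambda>n. rat_pnorm p (X n)) \<longlonglongrightarrow> L"
    using pcauchy_norm_convergent[OF X] by (auto simp: convergent_def)
  have "L \<ge> 0" by (rule LIMSEQ_le_const[OF L]) auto
  moreover have "L \<noteq> 0" using L nz by (auto simp: pnull_def)
  ultimately have Lp: "L > 0" by simp
  hence "eventually (\<lambda>n. L / 2 < rat_pnorm p (X n)) sequentially"
    using L by (intro order_tendstoD(1)) auto
  thus ?thesis using Lp unfolding eventually_sequentially by (intro exI[of _ "L / 2"]) auto
qed

lemma pcauchy_inverse:
  assumes X: "pcauchy p X" and nz: "\<not> pnull p X"
  shows "pcauchy p (\<lambda>n. inverse (X n))"
  unfolding pcauchy_def
proof (intro allI impI)
  fix e :: real assume e: "e > 0"
  obtain b i where b: "b > 0" and i: "\<forall>n\<ge>i. b < rat_pnorm p (X n)"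
    using pcauchy_not_pnull[OF X nz] by blast
  obtain j where j: "\<forall>m\<ge>j. \<forall>n\<ge>j. rat_pnorm p (X m - X n) < e * (b * b)"
    using pcauchyD[OF X, of "e * (b * b)"] e b by auto
  have "rat_pnorm p (inverse (X m) - inverse (X n)) < e"
    if mn: "m \<ge> max i j" "n \<ge> max i j" for m n
  proof -
    have bm: "b < rat_pnorm p (X m)" and bn: "b < rat_pnorm p (X n)" using i mn by auto
    hence nz: "X m \<noteq> 0" "X n \<noteq> 0" using b by auto
    have "rat_pnorm p (inverse (X m) - inverse (X n))
        = rat_pnorm p (X m - X n) / (rat_pnorm p (X m) * rat_pnorm p (X n))"
      using nz by (simp add: inverse_diff_inverse rat_pnorm_mult rat_pnorm_inverse divide_inverse)
    also have "\<dots> \<le> rat_pnorm p (X m - X n) / (b * b)"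
      using b bm bn by (intro divide_left_mono mult_mono mult_pos_pos) auto
    also have "\<dots> < e" using j mn b by (simp add: divide_less_eq)
    finally show ?thesis .
  qed
  thus "\<exists>k. \<forall>m\<ge>k. \<forall>n\<ge>k. rat_pnorm p (inverse (X m) - inverse (X n)) < e" by blast
qed

lemma pnull_const [simp]: "pnull p (\<lambda>n. c) \<longleftrightarrow> c = 0"
  by (simp add: pnull_def LIMSEQ_const_iff)

lemma pnull_minus: "pnull p X \<Longrightarrow> pnull p (\<lambda>n. - X n)"
  by (simp add: pnull_def)

lemma pnull_sym: "pnull p (\<lambda>n. X n - Y n) \<Longrightarrow> pnull p (\<lambda>n. Y n - X n)"
  by (simp add: pnull_def rat_pnorm_commute[of "Y _"])

lemma pnull_add:
  assumes "pnull p X" "pnull p Y"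
  shows "pnull p (\<lambda>n. X n + Y n)"
proof -
  have "(\<lambda>n. rat_pnorm p (X n) + rat_pnorm p (Y n)) \<longlonglongrightarrow> 0 + 0"
    using assms unfolding pnull_def by (rule tendsto_add)
  hence lim: "(\<lambda>n. rat_pnorm p (X n) + rat_pnorm p (Y n)) \<longlonglongrightarrow> 0" by simp
  show ?thesis unfolding pnull_def
    by (rule tendsto_sandwich[OF _ _ tendsto_const lim])
       (auto intro!: always_eventually simp: rat_pnorm_triangle)
qed

lemma pnull_mult_bounded:
  assumes "pcauchy p X" "pnull p Y"
  shows "pnull p (\<lambda>n. X n * Y n)"
proof -
  obtain a where a: "\<forall>n. rat_pnorm p (X n) \<le> a" using pcauchy_bounded[OF assms(1)] by blast
  have "(\<lambda>n. a * rat_pnorm p (Y n)) \<longlonglongrightarrow> a * 0"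
    using assms unfolding pnull_def by (intro tendsto_intros)
  hence lim: "(\<lambda>n. a * rat_pnorm p (Y n)) \<longlonglongrightarrow> 0" by simp
  show ?thesis unfolding pnull_def
    by (rule tendsto_sandwich[OF _ _ tendsto_const lim])
       (auto intro!: always_eventually mult_right_mono simp: rat_pnorm_mult a)
qed

lemma pnull_diff_inverse:
  assumes X: "pcauchy p X" "\<not> pnull p X" and Y: "pcauchy p Y" "\<not> pnull p Y"
    and XY: "pnull p (\<lambda>n. X n - Y n)"
  shows "pnull p (\<lambda>n. inverse (X n) - inverse (Y n))"
proof -
  have "pcauchy p (\<lambda>n. inverse (X n) * inverse (Y n))"
    by (intro pcauchy_mult pcauchy_inverse X Y)
  hence *: "pnull p (\<lambda>n. inverse (X n) * inverse (Y n) * (Y n - X n))"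
    using pnull_sym[OF XY] by (rule pnull_mult_bounded)
  obtain b i where b: "b > 0" and i: "\<forall>n\<ge>i. b < rat_pnorm p (X n)"
    using pcauchy_not_pnull[OF X] by blast
  obtain c j where c: "c > 0" and j: "\<forall>n\<ge>j. c < rat_pnorm p (Y n)"
    using pcauchy_not_pnull[OF Y] by blast
  have "eventually (\<lambda>n. rat_pnorm p (inverse (X n) * inverse (Y n) * (Y n - X n))
      = rat_pnorm p (inverse (X n) - inverse (Y n))) sequentially"
    unfolding eventually_sequentially
  proof (intro exI[of _ "max i j"] allI impI)
    fix n assume n: "n \<ge> max i j"
    hence "b < rat_pnorm p (X n)" "c < rat_pnorm p (Y n)" using i j by auto
    hence "X n \<noteq> 0" "Y n \<noteq> 0" using b c by auto
    hence "inverse (X n) * inverse (Y n) * (Y n - X n) = inverse (X n) - inverse (Y n)"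
      by (simp add: field_simps)
    thus "rat_pnorm p (inverse (X n) * inverse (Y n) * (Y n - X n))
      = rat_pnorm p (inverse (X n) - inverse (Y n))" by simp
  qed
  with * show ?thesis unfolding pnull_def by (rule Lim_transform_eventually)
qed

lemma padicrel_refl: "pcauchy p X \<Longrightarrow> padicrel p X X"
  by (simp add: padicrel_def)

lemma part_equivp_padicrel: "part_equivp (padicrel p)"
proof (rule part_equivpI)
  show "\<exists>X. padicrel p X X" by (intro exI[of _ "\<lambda>_. 0"] padicrel_refl pcauchy_const)
  show "symp (padicrel p)" by (auto simp: symp_def padicrel_def intro: pnull_sym)
  show "transp (padicrel p)"
    unfolding padicrel_def by (rule transpI) (force dest: pnull_add)
qed

end

section \<open>The field of $p$-adic numbers\<close>

text \<open>
  The completion of the rationals: equivalence classes of $p$-adic Cauchy sequences modulo null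
  sequences. The prime is the cardinality of the type argument; every prime is the cardinality of
  some type, so a statement about \<open>'p padic\<close> for all \<open>'p :: prime_card\<close> covers every prime.
\<close>

typedef 'p padic = "{{Y. padicrel CARD('p :: prime_card) X Y} |X. pcauchy CARD('p) X}"
  by (auto intro: pcauchy_const[OF prime_card])

definition Padic :: "(nat \<Rightarrow> rat) \<Rightarrow> 'p::prime_card padic" where
  "Padic X = Abs_padic {Y. padicrel CARD('p) X Y}"

definition rep_padic :: "'p::prime_card padic \<Rightarrow> nat \<Rightarrow> rat" where
  "rep_padic x = (SOME X. X \<in> Rep_padic x)"

definition cr_padic :: "(nat \<Rightarrow> rat) \<Rightarrow> 'p::prime_card padic \<Rightarrow> bool" where
  "cr_padic X x \<longleftrightarrow> pcauchy CARD('p) X \<and> Padic X = x"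

lemma padic_cases:
  obtains X where "pcauchy CARD('p) X" "(x :: 'p::prime_card padic) = Padic X"
  using Rep_padic[of x] that by (auto simp: Padic_def) (metis Rep_padic_inverse)

lemma eq_Padic_iff_padicrel:
  assumes "pcauchy CARD('p) X" "pcauchy CARD('p) Y"
  shows "(Padic X :: 'p::prime_card padic) = Padic Y \<longleftrightarrow> padicrel CARD('p) X Y"
proof -
  let ?R = "padicrel CARD('p)"
  have "?R Y Y" using assms by (auto intro: padicrel_refl[OF prime_card])
  moreover have "symp ?R" "transp ?R"
    using part_equivp_padicrel[OF prime_card[where 'a = 'p]]
    by (auto elim: part_equivpE)
  ultimately have "{Z. ?R X Z} = {Z. ?R Y Z} \<longleftrightarrow> ?R X Y"
    by (auto dest: sympD transpD)
  moreover have "(Padic X :: 'p padic) = Padic Y \<longleftrightarrow> {Z. ?R X Z} = {Z. ?R Y Z}"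
    unfolding Padic_def by (rule Abs_padic_inject) (use assms in auto)
  ultimately show ?thesis by simp
qed

lemma eq_Padic:
  assumes "pcauchy CARD('p) X" "pcauchy CARD('p) Y"
  shows "(Padic X :: 'p::prime_card padic) = Padic Y \<longleftrightarrow> pnull CARD('p) (\<lambda>n. X n - Y n)"
  using eq_Padic_iff_padicrel[OF assms] assms by (simp add: padicrel_def)

lemma rep_padic:
  "pcauchy CARD('p) (rep_padic x)" "Padic (rep_padic x) = (x :: 'p::prime_card padic)"
proof -
  obtain X where X: "pcauchy CARD('p) X" "x = Padic X" by (rule padic_cases)
  have Rep: "Rep_padic x = {Y. padicrel CARD('p) X Y}"
    unfolding X(2) Padic_def by (rule Abs_padic_inverse) (use X in auto)
  have "X \<in> Rep_padic x" using X(1) by (simp add: Rep padicrel_refl[OF prime_card])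
  hence "rep_padic x \<in> Rep_padic x" unfolding rep_padic_def by (rule someI[where P = "\<lambda>X. X \<in> Rep_padic x"])
  hence r: "padicrel CARD('p) X (rep_padic x)" by (simp add: Rep)
  thus c: "pcauchy CARD('p) (rep_padic x)" by (simp add: padicrel_def)
  show "Padic (rep_padic x) = x" using r c X eq_Padic_iff_padicrel by metis
qed

lemma Quotient_padic:
  "Quotient (padicrel CARD('p)) Padic rep_padic (cr_padic :: _ \<Rightarrow> 'p::prime_card padic \<Rightarrow> bool)"
proof (rule QuotientI)
  let ?R = "padicrel CARD('p)"
  show "Padic (rep_padic a) = a" for a :: "'p padic" by (rule rep_padic)
  show "?R (rep_padic a) (rep_padic a)" for a :: "'p padic"
    by (intro padicrel_refl[OF prime_card] rep_padic)
  show "?R r s \<longleftrightarrow> ?R r r \<and> ?R s s \<and> (Padic r :: 'p padic) = Padic s" for r s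
    using eq_Padic_iff_padicrel[where 'p = 'p] padicrel_refl[OF prime_card[where 'a = 'p]]
    by (auto simp: padicrel_def)
  show "(cr_padic :: _ \<Rightarrow> 'p padic \<Rightarrow> bool) = (\<lambda>x y. ?R x x \<and> Padic x = y)"
    by (auto simp: fun_eq_iff cr_padic_def padicrel_def prime_card)
qed

setup_lifting Quotient_padic

instantiation padic :: (prime_card) field
begin

lift_definition zero_padic :: "'a padic" is "\<lambda>n. 0"
  by (simp add: padicrel_refl prime_card)

lift_definition one_padic :: "'a padic" is "\<lambda>n. 1"
  by (simp add: padicrel_refl prime_card)

lift_definition plus_padic :: "'a padic \<Rightarrow> 'a padic \<Rightarrow> 'a padic" is "\<lambda>X Y n. X n + Y n"
  unfolding padicrel_def add_diff_add
  by (auto intro!: pcauchy_add pnull_add simp: prime_card)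

lift_definition uminus_padic :: "'a padic \<Rightarrow> 'a padic" is "\<lambda>X n. - X n"
  unfolding padicrel_def minus_diff_minus
  by (auto intro!: pcauchy_minus intro: pnull_sym simp: prime_card)

lift_definition times_padic :: "'a padic \<Rightarrow> 'a padic \<Rightarrow> 'a padic" is "\<lambda>X Y n. X n * Y n"
proof -
  fix X X' Y Y' :: "nat \<Rightarrow> rat"
  let ?p = "CARD('a)"
  assume "padicrel ?p X X'" "padicrel ?p Y Y'"
  hence h: "pcauchy ?p X" "pcauchy ?p X'" "pcauchy ?p Y" "pcauchy ?p Y'"
    "pnull ?p (\<lambda>n. X n - X' n)" "pnull ?p (\<lambda>n. Y n - Y' n)"
    by (simp_all add: padicrel_def)
  have "pnull ?p (\<lambda>n. X n * (Y n - Y' n) + Y' n * (X n - X' n))"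
    by (intro pnull_add pnull_mult_bounded h prime_card)
  moreover have "(\<lambda>n. X n * (Y n - Y' n) + Y' n * (X n - X' n)) = (\<lambda>n. X n * Y n - X' n * Y' n)"
    by (simp add: algebra_simps)
  ultimately show "padicrel ?p (\<lambda>n. X n * Y n) (\<lambda>n. X' n * Y' n)"
    unfolding padicrel_def by (auto intro!: pcauchy_mult h prime_card)
qed

lift_definition inverse_padic :: "'a padic \<Rightarrow> 'a padic"
  is "\<lambda>X. if pnull CARD('a) X then (\<lambda>n. 0) else (\<lambda>n. inverse (X n))"
proof -
  fix X Y :: "nat \<Rightarrow> rat"
  let ?p = "CARD('a)"
  assume "padicrel ?p X Y"
  hence h: "pcauchy ?p X" "pcauchy ?p Y" "pnull ?p (\<lambda>n. X n - Y n)"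
    by (simp_all add: padicrel_def)
  hence h': "pnull ?p (\<lambda>n. Y n - X n)" using pnull_sym[OF prime_card] by blast
  have iff: "pnull ?p X \<longleftrightarrow> pnull ?p Y"
    using pnull_add[OF prime_card h(3), of Y] pnull_add[OF prime_card h', of X] by auto
  show "?thesis X Y"
    using iff h by (auto simp: padicrel_def prime_card
        intro!: pcauchy_inverse pnull_diff_inverse)
qed

definition "x - y = x + - y" for x y :: "'a padic"

definition "x div y = x * inverse y" for x y :: "'a padic"

instance
proof
  fix a b c :: "'a padic"
  note pad = padicrel_def prime_card pcauchy_add pcauchy_mult pcauchy_minus
  show "a + b + c = a + (b + c)"
    by transfer (auto simp: pad algebra_simps)
  show "a + b = b + a"
    by transfer (auto simp: pad algebra_simps)
  show "0 + a = a"
    by transfer (auto simp: pad)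
  show "- a + a = 0"
    by transfer (auto simp: pad)
  show "a - b = a + - b"
    by (rule minus_padic_def)
  show "a * b * c = a * (b * c)"
    by transfer (auto simp: pad algebra_simps)
  show "a * b = b * a"
    by transfer (auto simp: pad algebra_simps)
  show "1 * a = a"
    by transfer (auto simp: pad)
  show "(a + b) * c = a * c + b * c"
    by transfer (auto simp: pad algebra_simps)
  show "(0 :: 'a padic) \<noteq> 1"
    by transfer (simp add: pad)
  show "a div b = a * inverse b"
    by (rule divide_padic_def)
  show "inverse (0 :: 'a padic) = 0"
    by transfer (simp add: padicrel_refl prime_card)
  assume "a \<noteq> 0"
  then show "inverse a * a = 1"
  proof transfer
    fix X assume "padicrel CARD('a) X X" "\<not> padicrel CARD('a) X (\<lambda>n. 0)"
    hence X: "pcauchy CARD('a) X" "\<not> pnull CARD('a) X"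
      by (auto simp: padicrel_def prime_card)
    have "\<exists>b>0. \<exists>k. \<forall>n\<ge>k. b < rat_pnorm CARD('a) (X n)"
      by (rule pcauchy_not_pnull[OF prime_card X])
    then obtain b k where b: "b > 0" "\<forall>n\<ge>k. b < rat_pnorm CARD('a) (X n)" by blast
    have nz: "X n \<noteq> 0" if "n \<ge> k" for n
    proof
      assume "X n = 0"
      moreover have "b < rat_pnorm CARD('a) (X n)" using b that by blast
      ultimately show False using b(1) by simp
    qed
    have "eventually (\<lambda>n. 0 = rat_pnorm CARD('a) (inverse (X n) * X n - 1)) sequentially"
      unfolding eventually_sequentially using nz by (intro exI[of _ k]) auto
    hence "pnull CARD('a) (\<lambda>n. inverse (X n) * X n - 1)"
      unfolding pnull_def by (rule Lim_transform_eventually[OF tendsto_const])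
    thus "padicrel CARD('a)
        (\<lambda>n. (if pnull CARD('a) X then \<lambda>n. 0 else (\<lambda>n. inverse (X n))) n * X n) (\<lambda>n. 1)"
      using X by (auto simp: padicrel_def prime_card intro!: pcauchy_mult pcauchy_inverse)
  qed
qed

end

lemma minus_Padic:
  assumes "pcauchy CARD('p) X" "pcauchy CARD('p) Y"
  shows "(Padic X :: 'p::prime_card padic) - Padic Y = Padic (\<lambda>n. X n - Y n)"
proof -
  have "padicrel CARD('p) X X" "padicrel CARD('p) Y Y"
    using assms by (auto intro: padicrel_refl[OF prime_card])
  moreover have "padicrel CARD('p) (\<lambda>n. - Y n) (\<lambda>n. - Y n)"
    using assms by (auto intro: padicrel_refl[OF prime_card] pcauchy_minus[OF prime_card])
  ultimately show ?thesis
    unfolding minus_padic_def by (simp add: plus_padic.abs_eq uminus_padic.abs_eq)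
qed

instance padic :: (prime_card) field_char_0
proof
  have of_nat: "(of_nat n :: 'a padic) = Padic (\<lambda>_. of_nat n)" for n
  proof (induction n)
    case 0
    show ?case by (simp add: zero_padic.abs_eq zero_padic_def)
  next
    case (Suc n)
    thus ?case
      by (simp add: one_padic_def plus_padic.abs_eq padicrel_refl[OF prime_card] prime_card)
  qed
  show "inj (of_nat :: nat \<Rightarrow> 'a padic)"
    by (rule injI) (simp add: of_nat eq_Padic prime_card)
qed

lift_definition pnorm :: "'a::prime_card padic \<Rightarrow> real" is "\<lambda>X. lim (\<lambda>n. rat_pnorm CARD('a) (X n))"
proof -
  fix X Y :: "nat \<Rightarrow> rat"
  let ?N = "rat_pnorm CARD('a)"
  assume "padicrel CARD('a) X Y"
  hence X: "pcauchy CARD('a) X" and Y: "pcauchy CARD('a) Y"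
    and XY: "(\<lambda>n. ?N (X n - Y n)) \<longlonglongrightarrow> 0"
    by (auto simp: padicrel_def pnull_def)
  obtain L where L: "(\<lambda>n. ?N (X n)) \<longlonglongrightarrow> L"
    using pcauchy_norm_convergent[OF prime_card X] by (auto simp: convergent_def)
  have "(\<lambda>n. \<bar>?N (X n) - ?N (Y n)\<bar>) \<longlonglongrightarrow> 0"
    by (rule tendsto_sandwich[OF _ _ tendsto_const XY])
       (auto intro!: always_eventually rat_pnorm_reverse prime_card)
  hence "(\<lambda>n. ?N (X n) - ?N (Y n)) \<longlonglongrightarrow> 0" by (simp add: tendsto_rabs_zero_iff)
  from tendsto_diff[OF L this] have "(\<lambda>n. ?N (Y n)) \<longlonglongrightarrow> L" by simp
  thus "lim (\<lambda>n. ?N (X n)) = lim (\<lambda>n. ?N (Y n))" using L by (simp add: limI)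
qed

lemma pnorm_tendsto:
  assumes "pcauchy CARD('a) X"
  shows "(\<lambda>n. rat_pnorm CARD('a) (X n)) \<longlonglongrightarrow> pnorm (Padic X :: 'a::prime_card padic)"
  using pcauchy_norm_convergent[OF prime_card assms] padicrel_refl[OF prime_card assms]
  by (simp add: pnorm.abs_eq convergent_LIMSEQ_iff)

lemma pnorm_add: "pnorm (x + y :: 'a::prime_card padic) \<le> max (pnorm x) (pnorm y)"
proof -
  obtain X where X: "pcauchy CARD('a) X" "x = Padic X" by (rule padic_cases)
  obtain Y where Y: "pcauchy CARD('a) Y" "y = Padic Y" by (rule padic_cases)
  have xy: "x + y = Padic (\<lambda>n. X n + Y n)"
    using X Y by (simp add: plus_padic.abs_eq padicrel_refl[OF prime_card])
  have c: "pcauchy CARD('a) (\<lambda>n. X n + Y n)" by (rule pcauchy_add[OF prime_card X(1) Y(1)])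
  have lim: "(\<lambda>n. max (rat_pnorm CARD('a) (X n)) (rat_pnorm CARD('a) (Y n)))
      \<longlonglongrightarrow> max (pnorm x) (pnorm y)"
    unfolding X(2) Y(2) by (intro tendsto_max pnorm_tendsto X Y)
  show ?thesis unfolding xy
    by (rule tendsto_le[OF trivial_limit_sequentially lim pnorm_tendsto[OF c]])
       (auto intro!: always_eventually rat_pnorm_add prime_card)
qed

lemma pnorm_minus [simp]: "pnorm (- x :: 'a::prime_card padic) = pnorm x"
  by transfer (simp add: prime_card)

lemma pnorm_nonneg [simp]: "0 \<le> pnorm (x :: 'a::prime_card padic)"
proof -
  obtain X where X: "pcauchy CARD('a) X" "x = Padic X" by (rule padic_cases)
  show ?thesis unfolding X(2)
    by (rule LIMSEQ_le_const[OF pnorm_tendsto[OF X(1)]]) (auto simp: prime_card)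
qed

lemma pnorm_eq_0 [simp]: "pnorm (x :: 'a::prime_card padic) = 0 \<longleftrightarrow> x = 0"
proof -
  obtain X where X: "pcauchy CARD('a) X" "x = Padic X" by (rule padic_cases)
  have "pnorm x = 0 \<longleftrightarrow> pnull CARD('a) X"
    unfolding pnull_def using pnorm_tendsto[OF X(1)] LIMSEQ_unique X(2) by metis
  also have "\<dots> \<longleftrightarrow> x = 0"
    using X by (simp add: zero_padic_def eq_Padic prime_card)
  finally show ?thesis .
qed

lemma pnorm_mult: "pnorm (x * y :: 'a::prime_card padic) = pnorm x * pnorm y"
proof -
  obtain X where X: "pcauchy CARD('a) X" "x = Padic X" by (rule padic_cases)
  obtain Y where Y: "pcauchy CARD('a) Y" "y = Padic Y" by (rule padic_cases)
  have xy: "x * y = Padic (\<lambda>n. X n * Y n)"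
    using X Y by (simp add: times_padic.abs_eq padicrel_refl[OF prime_card])
  have c: "pcauchy CARD('a) (\<lambda>n. X n * Y n)" by (rule pcauchy_mult[OF prime_card X(1) Y(1)])
  have "(\<lambda>n. rat_pnorm CARD('a) (X n * Y n)) \<longlonglongrightarrow> pnorm x * pnorm y"
    unfolding X Y rat_pnorm_mult[OF prime_card]
    by (intro tendsto_mult pnorm_tendsto X Y)
  thus ?thesis using pnorm_tendsto[OF c] LIMSEQ_unique unfolding xy by blast
qed

instantiation padic :: (prime_card) metric_space
begin

definition dist_padic :: "'a padic \<Rightarrow> 'a padic \<Rightarrow> real" where
  "dist_padic x y = pnorm (x - y)"

definition uniformity_padic :: "('a padic \<times> 'a padic) filter" where
  "uniformity_padic = (INF e\<in>{0<..}. principal {(x, y). dist x y < e})"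

definition open_padic :: "'a padic set \<Rightarrow> bool" where
  "open_padic U \<longleftrightarrow> (\<forall>x\<in>U. eventually (\<lambda>(x', y). x' = x \<longrightarrow> y \<in> U) uniformity)"

instance
proof
  fix x y z :: "'a padic"
  show "dist x y = 0 \<longleftrightarrow> x = y" by (simp add: dist_padic_def)
  show "dist x y \<le> dist x z + dist y z"
  proof -
    have "pnorm (x - y) \<le> max (pnorm (x - z)) (pnorm (z - y))"
      using pnorm_add[of "x - z" "z - y"] by simp
    also have "pnorm (z - y) = pnorm (y - z)"
      using pnorm_minus[of "y - z"] by simp
    also have "max (pnorm (x - z)) (pnorm (y - z)) \<le> pnorm (x - z) + pnorm (y - z)"
      by (simp add: max_def)
    finally show ?thesis by (simp add: dist_padic_def)
  qed
qed (simp_all add: uniformity_padic_def open_padic_def)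

end

text \<open>
  The next three facts pin the type down as the $p$-adic field: its norm extends the $p$-adic
  absolute value of the rationals, the rationals are dense, and it is complete.
\<close>

lemma of_rat_padic: "(of_rat q :: 'p::prime_card padic) = Padic (\<lambda>_. q)"
proof -
  let ?f = "\<lambda>q. Padic (\<lambda>_. q) :: 'p padic"
  have r: "padicrel CARD('p) (\<lambda>_. q) (\<lambda>_. q)" for q
    by (simp add: padicrel_refl prime_card)
  have add: "?f (a + b) = ?f a + ?f b" and mult: "?f (a * b) = ?f a * ?f b" for a b
    by (simp_all add: plus_padic.abs_eq times_padic.abs_eq r)
  have minus: "?f (- a) = - ?f a" for a by (simp add: uminus_padic.abs_eq r)
  have n: "?f (of_nat n) = of_nat n" for n
    by (induction n) (simp_all add: add, simp_all add: zero_padic_def one_padic_def)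
  have i: "?f (of_int n) = of_int n" for n
    by (cases n rule: int_cases2) (simp_all add: n minus)
  obtain a b where ab: "quotient_of q = (a, b)" by (cases "quotient_of q")
  have b: "b > 0" and q: "q = of_int a / of_int b"
    using quotient_of_denom_pos[OF ab] quotient_of_div[OF ab] by auto
  have "?f q * ?f (of_int b) = ?f (of_int a)" using b q by (simp flip: mult)
  hence "?f q = of_int a / of_int b" using b by (simp add: i field_simps)
  thus ?thesis by (simp add: q of_rat_divide)
qed

lemma pnorm_of_rat: "pnorm (of_rat q :: 'p::prime_card padic) = rat_pnorm CARD('p) q"
  using pnorm_tendsto[OF pcauchy_const[OF prime_card[where 'a = 'p]], of q]
  by (simp add: of_rat_padic LIMSEQ_const_iff)

lemma Padic_tendsto:
  assumes X: "pcauchy CARD('p) X"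
  shows "(\<lambda>n. of_rat (X n)) \<longlonglongrightarrow> (Padic X :: 'p::prime_card padic)"
proof (rule metric_LIMSEQ_I)
  fix e :: real assume e: "e > 0"
  obtain k where k: "\<forall>m\<ge>k. \<forall>n\<ge>k. rat_pnorm CARD('p) (X m - X n) < e / 2"
    using pcauchyD[OF X, of "e / 2"] e by auto
  have "dist (of_rat (X n)) (Padic X :: 'p padic) < e" if n: "n \<ge> k" for n
  proof -
    have "(of_rat (X n) :: 'p padic) - Padic X = Padic (\<lambda>m. X n - X m)"
      unfolding of_rat_padic by (rule minus_Padic) (use X in \<open>simp_all add: prime_card\<close>)
    moreover have "pnorm (Padic (\<lambda>m. X n - X m) :: 'p padic) \<le> e / 2"
      by (rule LIMSEQ_le_const2[OF pnorm_tendsto])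
         (use k n in \<open>auto intro!: pcauchy_diff X less_imp_le simp: prime_card\<close>)
    ultimately show ?thesis using e by (simp add: dist_padic_def)
  qed
  thus "\<exists>k. \<forall>n\<ge>k. dist (of_rat (X n)) (Padic X :: 'p padic) < e" by blast
qed

lemma of_rat_padic_dense: "closure (range of_rat) = (UNIV :: 'p::prime_card padic set)"
proof -
  have "x \<in> closure (range of_rat)" for x :: "'p padic"
  proof -
    obtain X where X: "pcauchy CARD('p) X" "x = Padic X" by (rule padic_cases)
    show ?thesis
      unfolding closure_sequential
      by (rule exI[of _ "\<lambda>n. of_rat (X n)"]) (use X Padic_tendsto in auto)
  qed
  thus ?thesis by blast
qed

instance padic :: (prime_card) complete_space
proof
  fix x :: "nat \<Rightarrow> 'a padic" assume x: "Cauchy x"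
  have "\<exists>q. dist (of_rat q) (x n) < 1 / real (Suc n)" for n
  proof -
    have "x n \<in> closure (range of_rat)" using of_rat_padic_dense[where 'p = 'a] by simp
    thus ?thesis unfolding closure_approachable by (auto dest: spec[of _ "1 / real (Suc n)"])
  qed
  then obtain q where q: "\<And>n. dist (of_rat (q n)) (x n) < 1 / real (Suc n)" by metis
  have q0: "(\<lambda>n. dist (of_rat (q n)) (x n)) \<longlonglongrightarrow> 0"
    by (rule tendsto_sandwich[OF _ _ tendsto_const LIMSEQ_inverse_real_of_nat])
       (use q in \<open>auto intro!: always_eventually less_imp_le simp: inverse_eq_divide\<close>)
  have "pcauchy CARD('a) q"
    unfolding pcauchy_def
  proof (intro allI impI)
    fix e :: real assume e: "e > 0"
    obtain i where i: "\<forall>m\<ge>i. \<forall>n\<ge>i. dist (x m) (x n) < e / 3"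
      using x e unfolding Cauchy_def by (metis divide_pos_pos zero_less_numeral)
    obtain j where j: "\<forall>n\<ge>j. dist (of_rat (q n)) (x n) < e / 3"
      using order_tendstoD(2)[OF q0, of "e / 3"] e unfolding eventually_sequentially by auto
    have "rat_pnorm CARD('a) (q m - q n) < e" if mn: "m \<ge> max i j" "n \<ge> max i j" for m n
    proof -
      have "rat_pnorm CARD('a) (q m - q n) = dist (of_rat (q m) :: 'a padic) (of_rat (q n))"
        unfolding dist_padic_def by (simp flip: of_rat_diff add: pnorm_of_rat)
      also have "\<dots> \<le> dist (of_rat (q m)) (x m) + dist (x m) (x n) + dist (of_rat (q n)) (x n)"
        by metric
      also have "\<dots> < e / 3 + e / 3 + e / 3"
        using i j mn by (intro add_strict_mono) auto
      finally show ?thesis by simp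
    qed
    thus "\<exists>k. \<forall>m\<ge>k. \<forall>n\<ge>k. rat_pnorm CARD('a) (q m - q n) < e" by blast
  qed
  hence "(\<lambda>n. of_rat (q n)) \<longlonglongrightarrow> (Padic q :: 'a padic)" by (rule Padic_tendsto)
  hence "(\<lambda>n. dist (of_rat (q n)) (Padic q :: 'a padic)) \<longlonglongrightarrow> 0"
    by (rule tendsto_dist_iff[THEN iffD1])
  from tendsto_add[OF q0 this]
  have lim: "(\<lambda>n. dist (of_rat (q n)) (x n) + dist (of_rat (q n)) (Padic q :: 'a padic)) \<longlonglongrightarrow> 0" by simp
  have "(\<lambda>n. dist (x n) (Padic q)) \<longlonglongrightarrow> 0"
    by (rule tendsto_sandwich[OF _ _ tendsto_const lim])
       (auto intro!: always_eventually dist_triangle3)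
  hence "x \<longlonglongrightarrow> Padic q" by (rule tendsto_dist_iff[THEN iffD2])
  thus "convergent x" by (auto simp: convergent_def)
qed

section \<open>Hausdorff dimension\<close>

text \<open>
  The distance is a parameter: the library metric on products is the Euclidean combination of the
  metrics of the factors, not their maximum.
\<close>

definition diam :: "('a \<Rightarrow> 'a \<Rightarrow> real) \<Rightarrow> 'a set \<Rightarrow> real" where
  "diam d U = (if U = {} then 0 else SUP (x, y)\<in>U \<times> U. d x y)"

text \<open>
  Since \<open>0 powr 0 = 0\<close>, exponent 0 is treated separately, so that the zero-dimensional Hausdorff
  measure is the counting measure.
\<close>

definition diam_power :: "('a \<Rightarrow> 'a \<Rightarrow> real) \<Rightarrow> real \<Rightarrow> 'a set \<Rightarrow> real" where
  "diam_power d r U = (if U = {} then 0 else if r = 0 then 1 else diam d U powr r)"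

definition delta_cover :: "('a \<Rightarrow> 'a \<Rightarrow> real) \<Rightarrow> real \<Rightarrow> 'a set \<Rightarrow> (nat \<Rightarrow> 'a set) \<Rightarrow> bool" where
  "delta_cover d \<delta> A U \<longleftrightarrow> A \<subseteq> (\<Union>i. U i) \<and> (\<forall>i. \<forall>x\<in>U i. \<forall>y\<in>U i. d x y \<le> \<delta>)"

definition hausdorff_pre :: "('a \<Rightarrow> 'a \<Rightarrow> real) \<Rightarrow> real \<Rightarrow> real \<Rightarrow> 'a set \<Rightarrow> ennreal" where
  "hausdorff_pre d r \<delta> A = (INF U\<in>{U. delta_cover d \<delta> A U}. \<Sum>i. ennreal (diam_power d r (U i)))"

definition hausdorff_measure :: "('a \<Rightarrow> 'a \<Rightarrow> real) \<Rightarrow> real \<Rightarrow> 'a set \<Rightarrow> ennreal" where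
  "hausdorff_measure d r A = (SUP \<delta>\<in>{0<..}. hausdorff_pre d r \<delta> A)"

definition hausdorff_dim :: "('a \<Rightarrow> 'a \<Rightarrow> real) \<Rightarrow> 'a set \<Rightarrow> ennreal" where
  "hausdorff_dim d A = (INF r\<in>{r. 0 \<le> r \<and> hausdorff_measure d r A = 0}. ennreal r)"

section \<open>Furstenberg sets in the $p$-adic plane\<close>

definition plane_norm :: "'p::prime_card padic \<times> 'p padic \<Rightarrow> real" where
  "plane_norm v = max (pnorm (fst v)) (pnorm (snd v))"

definition plane_dist ::
  "'p::prime_card padic \<times> 'p padic \<Rightarrow> 'p padic \<times> 'p padic \<Rightarrow> real" where
  "plane_dist u v = plane_norm (u - v)"

definition is_line :: "('p::prime_card padic \<times> 'p padic) set \<Rightarrow> bool" where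
  "is_line l \<longleftrightarrow> (\<exists>a b c. (a, b) \<noteq> (0, 0) \<and> l = {(x, y). a * x + b * y = c})"

definition line_family_dim :: "('p::prime_card padic \<times> 'p padic) set set \<Rightarrow> ennreal" where
  "line_family_dim L =
     max (hausdorff_dim plane_dist {(a, b). {(x, y). y = a * x + b} \<in> L})
         (hausdorff_dim plane_dist {(a, b). {(x, y). x = a * y + b} \<in> L})"

text \<open>Used for \<open>0 < s \<le> 1\<close> and \<open>0 < t \<le> 2\<close> only.\<close>

definition furstenberg_set :: "real \<Rightarrow> real \<Rightarrow> ('p::prime_card padic \<times> 'p padic) set \<Rightarrow> bool" where
  "furstenberg_set s t E \<longleftrightarrow>
     (\<exists>L. (\<forall>l\<in>L. is_line l) \<and> line_family_dim L \<ge> ennreal t \<and>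
          (\<forall>l\<in>L. hausdorff_dim plane_dist (E \<inter> l) \<ge> ennreal s))"

end

theory Submission
  imports Defs
begin

text \<open>
  The lower bound is a second moment count. Suppose that \<open>E\<close> has \<open>r\<close>-dimensional Hausdorff measure
  zero for some \<open>r < s + t\<close>. Then \<open>E\<close> has covers by balls of radii \<open>2 ^ - k i\<close> with
  \<open>\<Sum>i. 2 ^ (- r * k i) \<le> 1\<close> and all \<open>k i\<close> large, so at most \<open>2 ^ (r * k)\<close> of the balls have radius
  \<open>\<delta> = 2 ^ - k\<close>. Lower the exponents \<open>s\<close> and \<open>t\<close> a little, so that lines and slices
  have positive content. Pigeonholing over \<open>k\<close>, first on each line and then over the lines
  (\<open>furstenberg_lines_null\<close>), gives a single scale \<open>\<delta>\<close> at which, up to a loss of \<open>\<delta> ^ \<epsilon>\<close>, a set of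
  lines of positive \<open>t\<close>-dimensional content has slices of positive \<open>s\<close>-dimensional content inside
  the \<open>\<delta>\<close>-balls of the cover.

  Give the lines a Frostman weight \<open>\<mu>\<close> of exponent \<open>t\<close>, and on each line \<open>l\<close> give the
  \<open>\<delta>\<close>-balls that it meets a Frostman weight \<open>\<nu> l\<close> of exponent \<open>s\<close>. Two lines at distance \<open>\<rho>\<close> in the
  parameter plane share \<open>\<delta>\<close>-balls only within a ball of radius about \<open>\<delta> / \<rho>\<close>
  (\<open>line_incidence\<close>), whence \<open>\<Sum>i. \<nu> l i * \<nu> l' i\<close> is at most about \<open>\<delta> ^ s * (\<delta> / \<rho>) ^ s\<close>. Averaged
  over \<open>l'\<close> this is at most about \<open>\<delta> ^ (s + t)\<close> times the number of scales, and this is where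
  \<open>t \<le> s\<close> enters: the closest pairs dominate. By Cauchy-Schwarz the number of \<open>\<delta>\<close>-balls is then at
  least about \<open>\<delta> ^ - (s + t)\<close> (\<open>incidence_count_single_scale\<close>), which exceeds \<open>2 ^ (r * k)\<close> once
  \<open>k\<close> is large.

  Neither the set nor the family of lines need be measurable, because contents are countably
  subadditive on all sets and the weights live on finite sets only. The counting is carried out in
  arbitrary ultrametric spaces; the field enters through the incidence estimate and the total
  boundedness of balls.

  For sharpness let \<open>C u\<close> consist of the \<open>p\<close>-adic integers obtained by writing the base \<open>p\<close> digits
  of a real number in \<open>[0, 1)\<close> into a set of positions of density \<open>u\<close>, with zeros at the other
  positions. Reading the digits back compares \<open>C u\<close> with Lebesgue measure, so \<open>C u\<close> has dimension
  at least \<open>u\<close>; and \<open>C s \<times> C t\<close> is covered by about \<open>p ^ (n * (s + t))\<close> balls of radius \<open>p ^ - n\<close>. The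
  horizontal lines at heights in \<open>C t\<close> make this product an \<open>(s, t)\<close>-Furstenberg set.
\<close>

section \<open>Ultrametric spaces and covers by balls\<close>

text \<open>
  Distinct points at distance zero are allowed: the weights below live on finite index sets whose
  indices are compared through possibly coinciding representatives.
\<close>

locale ultrametric =
  fixes d :: "'a \<Rightarrow> 'a \<Rightarrow> real"
  assumes nonneg: "0 \<le> d x y"
    and self [simp]: "d x x = 0"
    and commute: "d x y = d y x"
    and strong_triangle: "d x z \<le> max (d x y) (d y z)"

text \<open>
  Radius zero is admitted and costs nothing in a positive exponent, so that a finite cover can be
  continued to a sequence.
\<close>

definition ball_cover :: "('a \<Rightarrow> 'a \<Rightarrow> real) \<Rightarrow> 'a set \<Rightarrow> (nat \<Rightarrow> 'a) \<Rightarrow> (nat \<Rightarrow> real) \<Rightarrow> bool" where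
  "ball_cover d A c \<rho> \<longleftrightarrow> (\<forall>i. 0 \<le> \<rho> i) \<and> A \<subseteq> (\<Union>i. {y. d (c i) y \<le> \<rho> i})"

text \<open>
  The Hausdorff content: covers by balls of all sizes compete. In a positive
  exponent it vanishes exactly on the sets of Hausdorff measure zero, and it is bounded
  by the cost of every cover, whatever the sizes of the balls.
\<close>

definition ball_content :: "('a \<Rightarrow> 'a \<Rightarrow> real) \<Rightarrow> real \<Rightarrow> 'a set \<Rightarrow> ennreal" where
  "ball_content d s A = (INF (c, \<rho>)\<in>{(c, \<rho>). ball_cover d A c \<rho>}. \<Sum>i. ennreal (\<rho> i powr s))"

lemma ball_content_le:
  "ball_cover d A c \<rho> \<Longrightarrow> ball_content d s A \<le> (\<Sum>i. ennreal (\<rho> i powr s))"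
  unfolding ball_content_def by (rule INF_lower2[of "(c, \<rho>)"]) auto

lemma ball_content_lessE:
  assumes "ball_content d s A < x"
  obtains c \<rho> where "ball_cover d A c \<rho>" "(\<Sum>i. ennreal (\<rho> i powr s)) < x"
  using assms unfolding ball_content_def by (auto simp: INF_less_iff)

lemma ball_content_mono: "A \<subseteq> B \<Longrightarrow> ball_content d s A \<le> ball_content d s B"
  unfolding ball_content_def by (rule INF_superset_mono) (auto simp: ball_cover_def subset_iff)

lemma ball_content_le_finite:
  assumes "finite F" "\<And>x. x \<in> F \<Longrightarrow> 0 \<le> \<rho> x" "A \<subseteq> (\<Union>x\<in>F. {y. d (c x) y \<le> \<rho> x})"
  shows "ball_content d s A \<le> ennreal (\<Sum>x\<in>F. \<rho> x powr s)"
proof -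
  obtain f where f: "bij_betw f {..<card F} F"
    using ex_bij_betw_nat_finite[OF assms(1)] by (auto simp: atLeast0LessThan)
  define c' where "c' i = c (f i)" for i
  define \<rho>' where "\<rho>' i = (if i < card F then \<rho> (f i) else 0)" for i
  have fF: "f i \<in> F" if "i < card F" for i using bij_betwE[OF f] that by auto
  have "ball_cover d A c' \<rho>'"
    unfolding ball_cover_def
  proof (intro conjI allI subsetI)
    show "0 \<le> \<rho>' i" for i using fF assms(2) by (auto simp: \<rho>'_def)
    fix y assume "y \<in> A"
    then obtain x where x: "x \<in> F" "d (c x) y \<le> \<rho> x" using assms(3) by auto
    then obtain i where "i < card F" "f i = x"
      using f unfolding bij_betw_def by (metis imageE lessThan_iff)
    thus "y \<in> (\<Union>i. {y. d (c' i) y \<le> \<rho>' i})" using x by (auto simp: c'_def \<rho>'_def intro!: exI[of _ i])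
  qed
  hence "ball_content d s A \<le> (\<Sum>i. ennreal (\<rho>' i powr s))" by (rule ball_content_le)
  also have "\<dots> = (\<Sum>i<card F. ennreal (\<rho>' i powr s))"
    by (rule suminf_finite) (auto simp: \<rho>'_def)
  also have "\<dots> = (\<Sum>i<card F. ennreal (\<rho> (f i) powr s))" by (simp add: \<rho>'_def)
  also have "\<dots> = (\<Sum>x\<in>F. ennreal (\<rho> x powr s))" by (rule sum.reindex_bij_betw[OF f])
  finally show ?thesis by simp
qed

lemma ball_content_empty [simp]: "ball_content d s {} = 0"
  using ball_content_le_finite[of "{}" _ "{}" d] by simp

lemma ball_content_UN_le: "ball_content d s (\<Union>n. A n) \<le> (\<Sum>n. ball_content d s (A n))"
proof (rule ennreal_le_epsilon)
  fix e :: real assume fin: "(\<Sum>n. ball_content d s (A n)) < top_class.top" and e: "0 < e"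
  have fin': "ball_content d s (A n) < top_class.top" for n
    using sum_le_suminf[OF summableI, of "{n}" "\<lambda>n. ball_content d s (A n)"] fin
    by (auto intro: le_less_trans)
  have "ball_content d s (A n) < ball_content d s (A n) + ennreal (e * (1/2) ^ Suc n)" for n
    using fin'[of n] e by (simp add: ennreal_less_top)
  hence "\<exists>c \<rho>. ball_cover d (A n) c \<rho> \<and>
    (\<Sum>i. ennreal (\<rho> i powr s)) < ball_content d s (A n) + ennreal (e * (1/2) ^ Suc n)" for n
    by (rule ball_content_lessE) blast
  then obtain c \<rho> where cov: "\<And>n. ball_cover d (A n) (c n) (\<rho> n)"
    and cost: "\<And>n. (\<Sum>i. ennreal (\<rho> n i powr s)) < ball_content d s (A n) + ennreal (e * (1/2) ^ Suc n)"
    by metis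
  define c' where "c' i = (case prod_decode i of (n, j) \<Rightarrow> c n j)" for i
  define \<rho>' where "\<rho>' i = (case prod_decode i of (n, j) \<Rightarrow> \<rho> n j)" for i
  have "ball_cover d (\<Union>n. A n) c' \<rho>'"
    unfolding ball_cover_def
  proof (intro conjI allI subsetI)
    show "0 \<le> \<rho>' i" for i using cov by (auto simp: \<rho>'_def ball_cover_def split: prod.splits)
    fix y assume "y \<in> (\<Union>n. A n)"
    then obtain n where "y \<in> A n" by auto
    then obtain j where "d (c n j) y \<le> \<rho> n j" using cov[of n] by (auto simp: ball_cover_def)
    thus "y \<in> (\<Union>i. {y. d (c' i) y \<le> \<rho>' i})"
      by (auto simp: c'_def \<rho>'_def intro!: exI[of _ "prod_encode (n, j)"])
  qed
  hence "ball_content d s (\<Union>n. A n) \<le> (\<Sum>i. ennreal (\<rho>' i powr s))" by (rule ball_content_le)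
  also have "\<dots> = (\<Sum>i. (\<lambda>(n, j). ennreal (\<rho> n j powr s)) (prod_decode i))"
    by (simp add: \<rho>'_def case_prod_beta)
  also have "\<dots> = (\<Sum>n. \<Sum>j. ennreal (\<rho> n j powr s))"
    by (rule suminf_ennreal_2dimen) auto
  also have "\<dots> \<le> (\<Sum>n. ball_content d s (A n) + ennreal (e * (1/2) ^ Suc n))"
    using cost by (intro suminf_le less_imp_le) auto
  also have "\<dots> = (\<Sum>n. ball_content d s (A n)) + (\<Sum>n. ennreal (e * (1/2) ^ Suc n))"
    by (simp add: suminf_add)
  also have "(\<Sum>n. ennreal (e * (1/2) ^ Suc n)) = ennreal e"
  proof (rule suminf_ennreal_eq)
    show "(\<lambda>n. e * (1/2) ^ Suc n) sums e" using sums_mult[OF power_half_series, of e] by simp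
  qed (use e in auto)
  finally show "ball_content d s (\<Union>n. A n) \<le> (\<Sum>n. ball_content d s (A n)) + ennreal e" .
qed

section \<open>Frostman weights on finite sets\<close>

context ultrametric
begin

text \<open>
  Any two balls are therefore disjoint or nested, on which the construction of the weights rests.
\<close>

lemma in_ball_iff:
  assumes "d x y \<le> \<rho>"
  shows "d x z \<le> \<rho> \<longleftrightarrow> d y z \<le> \<rho>"
  using assms strong_triangle[of x z y] strong_triangle[of y z x] commute[of x y] by auto

text \<open>
  Treat the points one after the other and put on each the largest mass that no capacity forbids.
  The new point then lies in a ball whose capacity is exhausted, and such a ball remains
  exhausted, since masses are never reduced.
\<close>

lemma greedy_filling:
  fixes g :: "nat \<Rightarrow> real"
  assumes "finite X" and r: "\<And>j. 0 \<le> r j" and g: "\<And>j. 0 \<le> g j"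
  shows "\<exists>\<mu>. (\<forall>y. 0 \<le> \<mu> y)
     \<and> (\<forall>z. \<forall>j\<le>J. sum \<mu> {y\<in>X. d z y \<le> r j} \<le> g j)
     \<and> (\<forall>x\<in>X. \<exists>j\<le>J. sum \<mu> {y\<in>X. d x y \<le> r j} = g j)"
  using \<open>finite X\<close>
proof (induction X)
  case empty
  show ?case by (intro exI[of _ "\<lambda>_. 0"]) (auto simp: g)
next
  case (insert x X)
  from insert.IH obtain \<mu> where \<mu>: "(\<forall>y. 0 \<le> \<mu> y)
     \<and> (\<forall>z. \<forall>j\<le>J. sum \<mu> {y\<in>X. d z y \<le> r j} \<le> g j)
     \<and> (\<forall>x\<in>X. \<exists>j\<le>J. sum \<mu> {y\<in>X. d x y \<le> r j} = g j)" ..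
  have \<mu>0: "0 \<le> \<mu> y" for y using \<mu> by simp
  have ub: "sum \<mu> {y\<in>X. d z y \<le> r j} \<le> g j" if "j \<le> J" for z j using \<mu> that by simp
  have sat: "\<exists>j\<le>J. sum \<mu> {y\<in>X. d z y \<le> r j} = g j" if "z \<in> X" for z using \<mu> that by simp
  \<comment> \<open>the capacity left at level \<open>j\<close> around \<open>x\<close>\<close>
  define room where "room j = g j - sum \<mu> {y\<in>X. d x y \<le> r j}" for j
  define a where "a = Min (room ` {..J})"
  have a_le: "a \<le> room j" if "j \<le> J" for j unfolding a_def using that by (intro Min_le) auto
  have "a \<in> room ` {..J}" unfolding a_def by (intro Min_in) auto
  then obtain j0 where j0: "j0 \<le> J" "a = room j0" by auto
  have a0: "0 \<le> a" using ub[OF j0(1), of x] by (simp add: j0 room_def)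
  define \<mu>' where "\<mu>' = \<mu>(x := a)"
  have hit: "sum \<mu>' {y\<in>insert x X. d z y \<le> r j} = a + sum \<mu> {y\<in>X. d x y \<le> r j}"
    if "d z x \<le> r j" for z j
  proof -
    have "{y\<in>insert x X. d z y \<le> r j} = insert x {y\<in>X. d x y \<le> r j}"
      using that by (auto simp: in_ball_iff[OF that] r)
    moreover have "sum \<mu>' {y\<in>X. d x y \<le> r j} = sum \<mu> {y\<in>X. d x y \<le> r j}"
      using insert.hyps by (intro sum.cong) (auto simp: \<mu>'_def)
    ultimately show ?thesis using insert.hyps by (simp add: \<mu>'_def)
  qed
  have miss: "sum \<mu>' {y\<in>insert x X. d z y \<le> r j} = sum \<mu> {y\<in>X. d z y \<le> r j}"
    if "\<not> d z x \<le> r j" for z j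
    using that insert.hyps by (intro sum.cong) (auto simp: \<mu>'_def)
  have ub': "sum \<mu>' {y\<in>insert x X. d z y \<le> r j} \<le> g j" if j: "j \<le> J" for z j
    using hit[of z j] miss[of z j] ub[OF j, of z] a_le[OF j] by (cases "d z x \<le> r j") (auto simp: room_def)
  have sat': "\<exists>j\<le>J. sum \<mu>' {y\<in>insert x X. d z y \<le> r j} = g j" if z: "z \<in> insert x X" for z
  proof (cases "z = x")
    case True
    thus ?thesis using j0 hit[of x j0] r by (auto simp: room_def)
  next
    case False
    then obtain j where j: "j \<le> J" "sum \<mu> {y\<in>X. d z y \<le> r j} = g j" using sat z by auto
    have "sum \<mu> {y\<in>X. d z y \<le> r j} = sum \<mu>' {y\<in>X. d z y \<le> r j}"
      using insert.hyps by (intro sum.cong) (auto simp: \<mu>'_def)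
    also have "\<dots> \<le> sum \<mu>' {y\<in>insert x X. d z y \<le> r j}"
      using insert.hyps a0 \<mu>0 by (intro sum_mono2) (auto simp: \<mu>'_def)
    finally show ?thesis using ub'[OF j(1), of z] j by (intro exI[of _ j]) auto
  qed
  show ?case using a0 \<mu>0 ub' sat' by (intro exI[of _ \<mu>']) (auto simp: \<mu>'_def)
qed

text \<open>
  The balls exhausted by the greedy weight cover everything, and the largest exhausted balls around
  the points are pairwise disjoint or equal. Their capacities therefore add up to exactly the
  total mass: a cheapest cover and a heaviest admissible weight balance each other, as in the max-flow
  min-cut theorem for trees.
\<close>

lemma frostman_finite:
  fixes g :: "nat \<Rightarrow> real"
  assumes X: "finite X" and r: "\<And>j. 0 \<le> r j" "antimono r" and g: "\<And>j. 0 \<le> g j"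
  obtains \<mu> F h where "\<And>y. 0 \<le> \<mu> y"
    "\<And>z j. j \<le> J \<Longrightarrow> sum \<mu> {y\<in>X. d z y \<le> r j} \<le> g j"
    "F \<subseteq> X" "\<And>x. x \<in> F \<Longrightarrow> h x \<le> J" "X \<subseteq> (\<Union>x\<in>F. {y. d x y \<le> r (h x)})"
    "(\<Sum>x\<in>F. g (h x)) = sum \<mu> X"
proof -
  obtain \<mu> where \<mu>: "(\<forall>y. 0 \<le> \<mu> y)
     \<and> (\<forall>z. \<forall>j\<le>J. sum \<mu> {y\<in>X. d z y \<le> r j} \<le> g j)
     \<and> (\<forall>x\<in>X. \<exists>j\<le>J. sum \<mu> {y\<in>X. d x y \<le> r j} = g j)"
    using greedy_filling[OF X r(1) g, where J = J] ..
  have \<mu>0: "0 \<le> \<mu> y" for y using \<mu> by simp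
  have ub: "sum \<mu> {y\<in>X. d z y \<le> r j} \<le> g j" if "j \<le> J" for z j using \<mu> that by simp
  have sat: "\<exists>j. j \<le> J \<and> sum \<mu> {y\<in>X. d z y \<le> r j} = g j" if "z \<in> X" for z using \<mu> that by simp
  \<comment> \<open>radii decrease with the level, so the least exhausted level gives the largest exhausted ball\<close>
  define h where "h x = (LEAST j. j \<le> J \<and> sum \<mu> {y\<in>X. d x y \<le> r j} = g j)" for x
  define B where "B x = {y\<in>X. d x y \<le> r (h x)}" for x
  have h: "h x \<le> J" "sum \<mu> (B x) = g (h x)" if "x \<in> X" for x
    using LeastI_ex[OF sat[OF that]] by (auto simp: h_def B_def)
  have self_in: "x \<in> B x" if "x \<in> X" for x using that r by (simp add: B_def)
  have disj: "B x = B y" if "x \<in> X" "y \<in> X" "z \<in> B x" "z \<in> B y" "h x \<le> h y" for x y z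
  proof -
    have "r (h y) \<le> r (h x)" using r(2) that by (auto dest: antimonoD)
    hence dyz: "d y z \<le> r (h x)" using that by (auto simp: B_def)
    have dxz: "d x z \<le> r (h x)" using that by (auto simp: B_def)
    have xy: "d x y \<le> r (h x)"
      using in_ball_iff[OF dyz, of x] dxz commute by metis
    have "{w\<in>X. d y w \<le> r (h x)} = B x" using in_ball_iff[OF xy] by (auto simp: B_def)
    hence "h y \<le> h x" unfolding h_def[of y] using h[OF that(1)] by (intro Least_le) auto
    hence "h x = h y" using that by auto
    thus ?thesis using in_ball_iff[OF xy] by (auto simp: B_def)
  qed
  have disj': "B x = B y" if "x \<in> X" "y \<in> X" "B x \<inter> B y \<noteq> {}" for x y
    using disj[of x y] disj[of y x] that by (metis Int_emptyI nle_le)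
  \<comment> \<open>one centre for each of the distinct balls\<close>
  obtain F where F: "F \<subseteq> X" "inj_on B F" "B ` X = B ` F"
    using subset_image_inj[of "B ` X" B X] by auto
  have un: "\<Union> (B ` F) = X"
  proof -
    have "\<Union> (B ` X) = X" using self_in by (auto simp: B_def)
    thus ?thesis using F by simp
  qed
  have "sum \<mu> X = sum \<mu> (\<Union> (B ` F))" using un by simp
  also have "\<dots> = (\<Sum>x\<in>F. sum \<mu> (B x))"
  proof (rule sum.UNION_disjoint)
    show "finite F" using F X finite_subset by auto
    show "\<forall>i\<in>F. finite (B i)" using X by (auto simp: B_def)
    show "\<forall>i\<in>F. \<forall>j\<in>F. i \<noteq> j \<longrightarrow> B i \<inter> B j = {}"
      using disj' F by (meson inj_onD subsetD)
  qed
  also have "\<dots> = (\<Sum>x\<in>F. g (h x))" using h F by (intro sum.cong) auto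
  finally have "(\<Sum>x\<in>F. g (h x)) = sum \<mu> X" by simp
  moreover have "X \<subseteq> (\<Union>x\<in>F. {y. d x y \<le> r (h x)})"
    using un by (auto simp: B_def)
  ultimately show ?thesis using that[of \<mu> F h] \<mu>0 ub h F by blast
qed

text \<open>
  Frostman's lemma at a finite resolution, the capacity of a ball being the power of its radius: the balls
  that balance the weight cover \<open>A\<close> as well. The points are indexed, since for the slices
  the indices have to be the balls of a cover that is common to all lines.
\<close>

lemma frostman_content:
  fixes r :: "nat \<Rightarrow> real" and q :: "'i \<Rightarrow> 'a"
  assumes X: "finite X" and r: "\<And>j. 0 \<le> r j" "antimono r"
    and A: "A \<subseteq> (\<Union>x\<in>X. {y. d (q x) y \<le> r J})"
  shows "\<exists>\<mu>. (\<forall>x. 0 \<le> \<mu> x)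
    \<and> (\<forall>z. \<forall>j\<le>J. sum \<mu> {x\<in>X. d (q z) (q x) \<le> r j} \<le> r j powr s)
    \<and> ball_content d s A \<le> ennreal (sum \<mu> X)"
proof -
  interpret Q: ultrametric "\<lambda>x y. d (q x) (q y)"
    by unfold_locales (simp_all add: nonneg strong_triangle, rule commute)
  show ?thesis
  proof (rule Q.frostman_finite[where J = J and g = "\<lambda>j. r j powr s", OF X r])
    fix \<mu> F h
    assume \<mu>: "\<And>x. 0 \<le> \<mu> x"
        "\<And>z j. j \<le> J \<Longrightarrow> sum \<mu> {x\<in>X. d (q z) (q x) \<le> r j} \<le> r j powr s"
      and F: "F \<subseteq> X" "\<And>x. x \<in> F \<Longrightarrow> h x \<le> J" "X \<subseteq> (\<Union>x\<in>F. {y. d (q x) (q y) \<le> r (h x)})"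
        "(\<Sum>x\<in>F. r (h x) powr s) = sum \<mu> X"
    have "A \<subseteq> (\<Union>x\<in>F. {y. d (q x) y \<le> r (h x)})"
    proof
      fix y assume "y \<in> A"
      then obtain x where x: "x \<in> X" "d (q x) y \<le> r J" using A by auto
      then obtain z where z: "z \<in> F" "d (q z) (q x) \<le> r (h z)" using F by auto
      have "r J \<le> r (h z)" using r(2) F(2)[OF z(1)] by (auto dest: antimonoD)
      hence "d (q z) y \<le> r (h z)" using x z strong_triangle[of "q z" y "q x"] by auto
      thus "y \<in> (\<Union>x\<in>F. {y. d (q x) y \<le> r (h x)})" using z by auto
    qed
    hence "ball_content d s A \<le> ennreal (\<Sum>x\<in>F. r (h x) powr s)"
      using finite_subset[OF F(1) X] r(1) by (intro ball_content_le_finite) auto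
    thus ?thesis using \<mu> F(4) by (intro exI[of _ \<mu>]) simp
  qed simp
qed

end

section \<open>Counting incidences at a single scale\<close>

text \<open>
  Rounding a radius up to a dyadic scale, at the cost of a factor 2. A radius above all scales is
  rounded to the scale 0.
\<close>

lemma dyadic_scale_above:
  fixes R \<tau> :: real
  assumes "0 < R" "R / 2 ^ J \<le> \<tau>"
  obtains n where "n \<le> J" "n = 0 \<or> \<tau> \<le> R / 2 ^ n" "R / 2 ^ n \<le> 2 * \<tau>"
proof -
  define n where "n = (LEAST n. R / 2 ^ n \<le> 2 * \<tau>)"
  have "0 < R / 2 ^ J" using assms by simp
  hence J: "R / 2 ^ J \<le> 2 * \<tau>" using assms(2) by linarith
  have n: "R / 2 ^ n \<le> 2 * \<tau>" unfolding n_def by (rule LeastI[of _ J]) (rule J)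
  have "n \<le> J" unfolding n_def by (rule Least_le) (rule J)
  moreover have "n = 0 \<or> \<tau> \<le> R / 2 ^ n"
  proof (cases n)
    case (Suc m)
    have "\<not> R / 2 ^ m \<le> 2 * \<tau>" using Suc not_less_Least[of m "\<lambda>n. R / 2 ^ n \<le> 2 * \<tau>"] by (simp add: n_def)
    thus ?thesis using Suc by (simp add: field_simps)
  qed simp
  ultimately show ?thesis using that n by blast
qed

text \<open>
  Rounding a distance up to a dyadic scale. Distances below the finest scale are not resolved.
\<close>

lemma dyadic_scale_of:
  fixes R \<rho> :: real
  assumes "\<rho> \<le> R"
  obtains j where "j \<le> J" "\<rho> \<le> R / 2 ^ j" "j = J \<or> R / 2 ^ j \<le> 2 * \<rho>"
proof -
  define M where "M = {j. j \<le> J \<and> \<rho> \<le> R / 2 ^ j}"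
  have fin: "finite M" unfolding M_def by (rule finite_subset[of _ "{..J}"]) auto
  have "0 \<in> M" using assms by (simp add: M_def)
  hence m: "Max M \<in> M" using fin by (intro Max_in) auto
  have "Max M = J \<or> R / 2 ^ Max M \<le> 2 * \<rho>"
  proof (rule ccontr)
    assume H: "\<not> ?thesis"
    hence "Suc (Max M) \<in> M" using m by (auto simp: M_def field_simps)
    thus False using Max_ge[OF fin] by fastforce
  qed
  thus ?thesis using that m by (auto simp: M_def)
qed

text \<open>
  The core estimate. Here \<open>X\<close> is a finite set of lines, \<open>P\<close> indexes balls of radius
  \<open>\<delta> = R / 2 ^ J\<close>, \<open>I l\<close> are the balls met by \<open>l\<close>, and \<open>q l i\<close> is a point of \<open>l\<close> in the ball \<open>i\<close>. The
  double sum \<open>\<Sum>l\<in>X. \<Sum>i\<in>I l. \<mu> l * \<nu> l i\<close> is at least \<open>sum \<mu> X * c\<close>. Interchanging the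
  sums and applying Cauchy-Schwarz over \<open>P\<close> bounds its square by \<open>card P\<close> times the \<open>\<mu>\<close>-average
  over pairs of lines of their correlation \<open>\<Sum>i. \<nu> l i * \<nu> l' i\<close>. That correlation is small, since
  two lines at distance \<open>\<rho>\<close> meet the same balls only inside a ball of radius \<open>C * \<delta> / \<rho>\<close>.
\<close>

lemma incidence_count_single_scale:
  fixes d :: "'a \<Rightarrow> 'a \<Rightarrow> real" and e :: "'b \<Rightarrow> 'b \<Rightarrow> real"
    and \<mu> :: "'b \<Rightarrow> real" and \<nu> :: "'b \<Rightarrow> 'i \<Rightarrow> real" and R C c s t :: real and q :: "'b \<Rightarrow> 'i \<Rightarrow> 'a"
  assumes d: "ultrametric d"
    and fin: "finite X" "finite P" and pos: "0 < R" "0 \<le> C" "0 \<le> c" and st: "0 < t" "t \<le> s"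
    and \<mu>0: "\<And>l. 0 \<le> \<mu> l" and \<nu>0: "\<And>l i. 0 \<le> \<nu> l i"
    and \<mu>: "\<And>z j. j \<le> J \<Longrightarrow> sum \<mu> {l\<in>X. e z l \<le> R / 2 ^ j} \<le> (R / 2 ^ j) powr t"
    and \<nu>: "\<And>l z j. l \<in> X \<Longrightarrow> j \<le> J \<Longrightarrow> sum (\<nu> l) {i\<in>I l. d (q l z) (q l i) \<le> R / 2 ^ j} \<le> (R / 2 ^ j) powr s"
    and I: "\<And>l. l \<in> X \<Longrightarrow> I l \<subseteq> P"
    and eR: "\<And>l l'. l \<in> X \<Longrightarrow> l' \<in> X \<Longrightarrow> e l l' \<le> R"
    and dR: "\<And>l i j. l \<in> X \<Longrightarrow> i \<in> I l \<Longrightarrow> j \<in> I l \<Longrightarrow> d (q l i) (q l j) \<le> R"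
    and inc: "\<And>l l' i j. l \<in> X \<Longrightarrow> l' \<in> X \<Longrightarrow> i \<in> I l \<Longrightarrow> i \<in> I l' \<Longrightarrow> j \<in> I l \<Longrightarrow> j \<in> I l' \<Longrightarrow>
       e l l' * d (q l i) (q l j) \<le> C * (R / 2 ^ J)"
    and mass: "\<And>l. l \<in> X \<Longrightarrow> c \<le> sum (\<nu> l) (I l)"
  shows "(sum \<mu> X * c)\<^sup>2
      \<le> card P * (R powr t * ((2 * max (2 * C) R) powr s * (real J + 1) * (R / 2 ^ J) powr (s + t)))"
proof -
  define r :: "real \<Rightarrow> nat \<Rightarrow> real" where "r = (\<lambda>R j. R / 2 ^ j)"
  have \<mu>r: "sum \<mu> {l\<in>X. e z l \<le> r R j} \<le> r R j powr t" if "j \<le> J" for z j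
    unfolding r_def by (rule \<mu>[OF that])
  have \<nu>r: "sum (\<nu> l) {i\<in>I l. d (q l z) (q l i) \<le> r R j} \<le> r R j powr s" if "l \<in> X" "j \<le> J" for l z j
    unfolding r_def by (rule \<nu>[OF that])
  interpret D: ultrametric d by (rule d)
  define \<delta> where "\<delta> = R / 2 ^ J"
  define C2 where "C2 = max (2 * C) R"
  \<comment> \<open>bound for the correlation of two lines whose distance has the dyadic size \<open>r R j\<close>\<close>
  define K where "K j = \<delta> powr s * (2 * (C2 * \<delta> / r R j)) powr s" for j
  define v where "v l i = (if i \<in> I l then \<nu> l i else 0)" for l i
  have \<delta>: "0 < \<delta>" using pos by (simp add: \<delta>_def)
  have rpos: "0 < r R j" for j using pos by (simp add: r_def)
  have rle: "r R j \<le> R" for j using pos by (simp add: r_def field_simps)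
  have \<delta>r: "\<delta> \<le> r R j" if "j \<le> J" for j
    using that pos by (auto simp: r_def \<delta>_def intro!: divide_left_mono power_increasing)
  have finI: "finite (I l)" if "l \<in> X" for l using I[OF that] fin finite_subset by auto
  have C2: "R \<le> C2" "2 * C \<le> C2" "0 < C2" using pos by (auto simp: C2_def)
  have K0: "0 \<le> K j" for j by (simp add: K_def)

  have pair: "\<exists>j\<le>J. e l l' \<le> r R j \<and> (\<Sum>i\<in>P. v l i * v l' i) \<le> K j" if l: "l \<in> X" "l' \<in> X" for l l'
  proof -
    obtain j where j: "j \<le> J" "e l l' \<le> r R j" "j = J \<or> r R j \<le> 2 * e l l'"
      unfolding r_def by (rule dyadic_scale_of[OF eR[OF l], of J])
    define \<tau> where "\<tau> = C2 * \<delta> / r R j"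
    have \<tau>: "\<delta> \<le> \<tau>"
    proof -
      have "r R j \<le> C2" using rle[of j] C2 by linarith
      thus ?thesis using \<delta> rpos[of j] by (simp add: \<tau>_def field_simps)
    qed
    \<comment> \<open>If the lines are closer than \<open>\<delta>\<close>, the incidence bound says nothing; but then
      \<open>\<tau> \<ge> R\<close>, so all points qualify.\<close>
    have close: "d (q l z) (q l i) \<le> \<tau>" if "z \<in> I l \<inter> I l'" "i \<in> I l \<inter> I l'" for z i
      using j(3)
    proof
      assume "j = J"
      hence "\<tau> = C2" using pos by (simp add: \<tau>_def \<delta>_def r_def)
      thus ?thesis using dR[OF l(1), of z i] that C2 by auto
    next
      assume "r R j \<le> 2 * e l l'"
      hence "r R j * d (q l z) (q l i) \<le> 2 * e l l' * d (q l z) (q l i)"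
        using D.nonneg by (intro mult_right_mono) auto
      also have "\<dots> \<le> 2 * (C * \<delta>)" using inc[OF l, of z i] that by (simp add: r_def \<delta>_def)
      also have "\<dots> \<le> C2 * \<delta>" using C2 \<delta> by (simp add: mult.assoc[symmetric])
      finally show ?thesis using rpos[of j] by (simp add: \<tau>_def field_simps)
    qed
    \<comment> \<open>a single ball carries at most \<open>\<delta> powr s\<close>, by the power bound at the finest level\<close>
    have small: "v l' i \<le> \<delta> powr s" for i
    proof (cases "i \<in> I l'")
      case True
      have "\<nu> l' i = sum (\<nu> l') {i}" by simp
      also have "\<dots> \<le> sum (\<nu> l') {k\<in>I l'. d (q l' i) (q l' k) \<le> r R J}"
        using True finI[OF l(2)] \<nu>0 rpos[of J] by (intro sum_mono2) auto
      also have "\<dots> \<le> \<delta> powr s" using \<nu>r[OF l(2), of J i] by (simp add: r_def \<delta>_def)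
      finally show ?thesis using True by (simp add: v_def)
    qed (simp add: v_def)
    have inter: "(\<Sum>i\<in>I l \<inter> I l'. \<nu> l i) \<le> (2 * \<tau>) powr s"
    proof (cases "I l \<inter> I l' = {}")
      case False
      then obtain z where z: "z \<in> I l \<inter> I l'" by auto
      obtain n where n: "n \<le> J" "n = 0 \<or> \<tau> \<le> r R n" "r R n \<le> 2 * \<tau>"
        unfolding r_def by (rule dyadic_scale_above[OF pos(1) \<tau>[unfolded \<delta>_def]])
      have "d (q l z) (q l i) \<le> r R n" if "i \<in> I l \<inter> I l'" for i
        using n(2) close[OF z that] dR[OF l(1), of z i] z that by (auto simp: r_def)
      hence "(\<Sum>i\<in>I l \<inter> I l'. \<nu> l i) \<le> sum (\<nu> l) {i\<in>I l. d (q l z) (q l i) \<le> r R n}"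
        using finI[OF l(1)] \<nu>0 by (intro sum_mono2) auto
      also have "\<dots> \<le> r R n powr s" using \<nu>r[OF l(1) n(1)] .
      also have "\<dots> \<le> (2 * \<tau>) powr s" using n(3) rpos[of n] st by (intro powr_mono2) auto
      finally show ?thesis .
    qed simp
    have "(\<Sum>i\<in>P. v l i * v l' i) = (\<Sum>i\<in>I l \<inter> I l'. v l i * v l' i)"
      using fin I[OF l(1)] by (intro sum.mono_neutral_right) (auto simp: v_def)
    also have "\<dots> = (\<Sum>i\<in>I l \<inter> I l'. \<nu> l i * v l' i)"
      by (intro sum.cong) (auto simp: v_def)
    also have "\<dots> \<le> (\<Sum>i\<in>I l \<inter> I l'. \<nu> l i * \<delta> powr s)"
      by (intro sum_mono mult_left_mono small \<nu>0)
    also have "\<dots> = (\<Sum>i\<in>I l \<inter> I l'. \<nu> l i) * \<delta> powr s" by (simp add: sum_distrib_right)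
    also have "\<dots> \<le> (2 * \<tau>) powr s * \<delta> powr s" using inter by (intro mult_right_mono) auto
    finally show ?thesis using j by (auto simp: K_def \<tau>_def mult.commute)
  qed

  have Kr: "K j * r R j powr t \<le> (2 * C2) powr s * \<delta> powr (s + t)" if j: "j \<le> J" for j
  proof -
    have "K j = \<delta> powr s * ((2 * C2) powr s * \<delta> powr s * r R j powr (- s))"
      using C2 \<delta> rpos[of j] unfolding K_def
      by (simp add: powr_mult powr_divide powr_minus divide_inverse inverse_powr)
    hence "K j * r R j powr t = (2 * C2) powr s * (\<delta> powr s * \<delta> powr s) * r R j powr (t - s)"
      by (simp add: powr_diff powr_minus divide_inverse mult_ac)
    also have "\<dots> \<le> (2 * C2) powr s * (\<delta> powr s * \<delta> powr s) * \<delta> powr (t - s)"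
      \<comment> \<open>\<open>t - s \<le> 0\<close>: among the scales the finest is the worst\<close>
      using \<delta>r[OF j] \<delta> st by (intro mult_left_mono powr_mono2') auto
    also have "\<dots> = (2 * C2) powr s * \<delta> powr (s + t)"
      using \<delta> by (simp add: powr_add powr_diff)
    finally show ?thesis .
  qed

  have row: "(\<Sum>l'\<in>X. \<mu> l' * (\<Sum>i\<in>P. v l i * v l' i)) \<le> (real J + 1) * ((2 * C2) powr s * \<delta> powr (s + t))"
    if l: "l \<in> X" for l
  proof -
    \<comment> \<open>bounding by the sum over all scales \<open>j\<close> with \<open>e l l' \<le> r R j\<close> instead of the right one loses only
      a factor \<open>J + 1\<close> and leads to the masses of balls around \<open>l\<close>\<close>
    have "(\<Sum>l'\<in>X. \<mu> l' * (\<Sum>i\<in>P. v l i * v l' i))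
        \<le> (\<Sum>l'\<in>X. \<mu> l' * (\<Sum>j\<le>J. if e l l' \<le> r R j then K j else 0))"
    proof (intro sum_mono mult_left_mono \<mu>0)
      fix l' assume l': "l' \<in> X"
      obtain j where j: "j \<le> J" "e l l' \<le> r R j" "(\<Sum>i\<in>P. v l i * v l' i) \<le> K j"
        using pair[OF l l'] by auto
      have "K j \<le> (\<Sum>j\<in>{..J}. if e l l' \<le> r R j then K j else 0)"
        using j K0 member_le_sum[of j "{..J}" "\<lambda>j. if e l l' \<le> r R j then K j else 0"] by auto
      thus "(\<Sum>i\<in>P. v l i * v l' i) \<le> (\<Sum>j\<le>J. if e l l' \<le> r R j then K j else 0)" using j by linarith
    qed
    also have "\<dots> = (\<Sum>j\<le>J. \<Sum>l'\<in>X. \<mu> l' * (if e l l' \<le> r R j then K j else 0))"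
      unfolding sum_distrib_left by (rule sum.swap)
    also have "\<dots> = (\<Sum>j\<le>J. K j * sum \<mu> {l'\<in>X. e l l' \<le> r R j})"
    proof (rule sum.cong[OF refl])
      fix j
      have "(\<Sum>l'\<in>X. \<mu> l' * (if e l l' \<le> r R j then K j else 0))
          = (\<Sum>l'\<in>X. if e l l' \<le> r R j then K j * \<mu> l' else 0)"
        by (intro sum.cong) auto
      thus "(\<Sum>l'\<in>X. \<mu> l' * (if e l l' \<le> r R j then K j else 0)) = K j * sum \<mu> {l'\<in>X. e l l' \<le> r R j}"
        using fin by (simp add: sum_distrib_left sum.inter_filter[symmetric])
    qed
    also have "\<dots> \<le> (\<Sum>j\<le>J. K j * r R j powr t)"
      using \<mu>r K0 by (intro sum_mono mult_left_mono) auto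
    also have "\<dots> \<le> (\<Sum>j\<le>J. (2 * C2) powr s * \<delta> powr (s + t))"
      using Kr by (intro sum_mono) auto
    finally show ?thesis by (simp add: add.commute)
  qed

  have total: "sum \<mu> X \<le> R powr t"
  proof (cases "X = {}")
    case False
    then obtain z where z: "z \<in> X" by auto
    have "{l\<in>X. e z l \<le> r R 0} = X" using eR[OF z] by (auto simp: r_def)
    thus ?thesis using \<mu>r[of 0 z] by (simp add: r_def)
  qed simp

  define a where "a i = (\<Sum>l\<in>X. \<mu> l * v l i)" for i
  have "sum \<mu> X * c \<le> (\<Sum>l\<in>X. \<mu> l * (\<Sum>i\<in>P. v l i))"
    unfolding sum_distrib_right
  proof (intro sum_mono mult_left_mono \<mu>0)
    fix l assume l: "l \<in> X"
    have "(\<Sum>i\<in>P. v l i) = sum (\<nu> l) (I l)"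
      using fin I[OF l] by (simp add: v_def sum.inter_restrict[symmetric] Int_absorb1)
    thus "c \<le> (\<Sum>i\<in>P. v l i)" using mass[OF l] by simp
  qed
  also have "\<dots> = (\<Sum>i\<in>P. a i)" unfolding a_def sum_distrib_left by (rule sum.swap)
  finally have T: "sum \<mu> X * c \<le> (\<Sum>i\<in>P. a i * 1)" by simp
  have "(sum \<mu> X * c)\<^sup>2 \<le> (\<Sum>i\<in>P. a i * 1)\<^sup>2"
    using T \<mu>0 pos by (intro power_mono mult_nonneg_nonneg sum_nonneg) auto
  also have "\<dots> \<le> (\<Sum>i\<in>P. (a i)\<^sup>2) * (\<Sum>i\<in>P. 1\<^sup>2)" by (rule Cauchy_Schwarz_ineq_sum)
  also have "\<dots> = card P * (\<Sum>i\<in>P. (a i)\<^sup>2)" by simp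
  also have "(\<Sum>i\<in>P. (a i)\<^sup>2) = (\<Sum>i\<in>P. \<Sum>l\<in>X. \<Sum>l'\<in>X. \<mu> l * (\<mu> l' * (v l i * v l' i)))"
    unfolding a_def power2_eq_square sum_product by (simp add: mult_ac)
  also have "\<dots> = (\<Sum>l\<in>X. \<mu> l * (\<Sum>l'\<in>X. \<mu> l' * (\<Sum>i\<in>P. v l i * v l' i)))"
    unfolding sum_distrib_left
    by (subst sum.swap, rule sum.cong[OF refl], rule sum.swap)
  also have "\<dots> \<le> (\<Sum>l\<in>X. \<mu> l * ((real J + 1) * ((2 * C2) powr s * \<delta> powr (s + t))))"
    using row by (intro sum_mono mult_left_mono \<mu>0) auto
  also have "\<dots> = sum \<mu> X * ((real J + 1) * ((2 * C2) powr s * \<delta> powr (s + t)))"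
    by (simp add: sum_distrib_right)
  also have "\<dots> \<le> R powr t * ((real J + 1) * ((2 * C2) powr s * \<delta> powr (s + t)))"
    using total by (intro mult_right_mono) auto
  also have "\<dots> = R powr t * ((2 * max (2 * C) R) powr s * (real J + 1) * (R / 2 ^ J) powr (s + t))"
    by (simp add: C2_def \<delta>_def mult_ac)
  finally show ?thesis by (simp add: mult_left_mono add.commute)
qed

text \<open>
  The same estimate with contents in place of weights. The set \<open>G\<close> is the part of the Furstenberg set
  that is covered by the finitely many balls of one radius. The lines are discretised by a net inside
  \<open>\<Lambda>\<close>, since the slices are rich only along lines of \<open>\<Lambda>\<close>.
\<close>

lemma furstenberg_single_scale:
  fixes d :: "'a \<Rightarrow> 'a \<Rightarrow> real" and e :: "'b \<Rightarrow> 'b \<Rightarrow> real" and Line :: "'b \<Rightarrow> 'a set"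
  assumes d: "ultrametric d" and e: "ultrametric e"
    and P: "finite P" and pos: "0 < R" "0 \<le> C" "0 \<le> c" "0 \<le> \<eta>" and st: "0 < t" "t \<le> s"
    and \<Lambda>: "\<And>l. l \<in> \<Lambda> \<Longrightarrow> e o' l \<le> R" "ennreal \<eta> \<le> ball_content e t \<Lambda>"
    and net: "finite Y" "\<Lambda> \<subseteq> (\<Union>y\<in>Y. {l. e y l \<le> R / 2 ^ J})"
    and G: "G \<subseteq> (\<Union>i\<in>P. {u. d (b i) u \<le> R / 2 ^ J})" "\<And>u. u \<in> G \<Longrightarrow> d p0 u \<le> R"
    and rich: "\<And>l. l \<in> \<Lambda> \<Longrightarrow> ennreal c \<le> ball_content d s (G \<inter> Line l)"
    and inc: "\<And>l l' u v u' v'. l \<in> \<Lambda> \<Longrightarrow> l' \<in> \<Lambda> \<Longrightarrow> u \<in> G \<inter> Line l \<Longrightarrow> v \<in> G \<inter> Line l \<Longrightarrow>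
       u' \<in> G \<inter> Line l' \<Longrightarrow> v' \<in> G \<inter> Line l' \<Longrightarrow> d u u' \<le> R / 2 ^ J \<Longrightarrow> d v v' \<le> R / 2 ^ J \<Longrightarrow>
       e l l' * d u v \<le> C * (R / 2 ^ J)"
  shows "(\<eta> * c)\<^sup>2
      \<le> card P * (R powr t * ((2 * max (2 * C) R) powr s * (real J + 1) * (R / 2 ^ J) powr (s + t)))"
proof -
  interpret D: ultrametric d by (rule d)
  interpret E: ultrametric e by (rule e)
  define r where "r j = R / 2 ^ j" for j :: nat
  have r: "0 \<le> r j" "antimono r" for j
    using pos by (auto simp: r_def antimono_def intro!: divide_left_mono power_increasing)
  define Y' where "Y' = {y\<in>Y. \<exists>l\<in>\<Lambda>. e y l \<le> r J}"
  have "\<forall>y\<in>Y'. \<exists>l. l \<in> \<Lambda> \<and> e y l \<le> r J" by (auto simp: Y'_def)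
  then obtain f where f: "\<And>y. y \<in> Y' \<Longrightarrow> f y \<in> \<Lambda> \<and> e y (f y) \<le> r J" by metis
  define X where "X = f ` Y'"
  have finX: "finite X" using net by (simp add: X_def Y'_def)
  have X\<Lambda>: "X \<subseteq> \<Lambda>" using f by (auto simp: X_def)
  have netX: "\<Lambda> \<subseteq> (\<Union>x\<in>X. {l. e x l \<le> r J})"
  proof
    fix l assume l: "l \<in> \<Lambda>"
    then obtain y where y: "y \<in> Y" "e y l \<le> r J" using net by (auto simp: r_def)
    hence "y \<in> Y'" using l by (auto simp: Y'_def)
    hence "e (f y) l \<le> r J"
      using f[of y] E.in_ball_iff[of y "f y" "r J" l] y by simp
    thus "l \<in> (\<Union>x\<in>X. {l. e x l \<le> r J})" using \<open>y \<in> Y'\<close> by (auto simp: X_def)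
  qed
  obtain \<mu> where \<mu>: "(\<forall>l. 0 \<le> \<mu> l)
      \<and> (\<forall>z. \<forall>j\<le>J. sum \<mu> {l\<in>X. e z l \<le> r j} \<le> r j powr t)
      \<and> ball_content e t \<Lambda> \<le> ennreal (sum \<mu> X)"
    using E.frostman_content[where s = t and q = "\<lambda>l. l", OF finX r netX] ..

  define I where "I l = {i\<in>P. \<exists>u\<in>G \<inter> Line l. d (b i) u \<le> r J}" for l
  define q where "q l i = (SOME u. u \<in> G \<inter> Line l \<and> d (b i) u \<le> r J)" for l i
  have q: "q l i \<in> G \<inter> Line l" "d (b i) (q l i) \<le> r J" if "i \<in> I l" for l i
    using someI_ex[of "\<lambda>u. u \<in> G \<inter> Line l \<and> d (b i) u \<le> r J"] that unfolding I_def q_def by blast+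
  have finI: "finite (I l)" for l using P by (simp add: I_def)
  have "\<forall>l. \<exists>\<nu>. (\<forall>i. 0 \<le> \<nu> i) \<and> (\<forall>z. \<forall>j\<le>J. sum \<nu> {i\<in>I l. d (q l z) (q l i) \<le> r j} \<le> r j powr s)
      \<and> ball_content d s (G \<inter> Line l) \<le> ennreal (sum \<nu> (I l))"
  proof
    fix l
    have "G \<inter> Line l \<subseteq> (\<Union>i\<in>I l. {u. d (q l i) u \<le> r J})"
    proof
      fix u assume u: "u \<in> G \<inter> Line l"
      then obtain i where i: "i \<in> P" "d (b i) u \<le> r J" using G by (auto simp: r_def)
      hence iI: "i \<in> I l" using u by (auto simp: I_def)
      hence "d (q l i) u \<le> r J" using D.in_ball_iff[OF q(2)[OF iI], of u] i by simp
      thus "u \<in> (\<Union>i\<in>I l. {u. d (q l i) u \<le> r J})" using iI by auto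
    qed
    thus "\<exists>\<nu>. (\<forall>i. 0 \<le> \<nu> i) \<and> (\<forall>z. \<forall>j\<le>J. sum \<nu> {i\<in>I l. d (q l z) (q l i) \<le> r j} \<le> r j powr s)
        \<and> ball_content d s (G \<inter> Line l) \<le> ennreal (sum \<nu> (I l))"
      by (rule D.frostman_content[OF finI r])
  qed
  from choice[OF this] obtain \<nu> where \<nu>: "\<forall>l. (\<forall>i. 0 \<le> \<nu> l i) \<and> (\<forall>z. \<forall>j\<le>J. sum (\<nu> l) {i\<in>I l. d (q l z) (q l i) \<le> r j} \<le> r j powr s)
      \<and> ball_content d s (G \<inter> Line l) \<le> ennreal (sum (\<nu> l) (I l))"
    ..
  have "(sum \<mu> X * c)\<^sup>2
      \<le> card P * (R powr t * ((2 * max (2 * C) R) powr s * (real J + 1) * (R / 2 ^ J) powr (s + t)))"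
  proof (rule incidence_count_single_scale[OF d finX P pos(1-3) st, where e = e and I = I and q = q and \<nu> = \<nu>])
    fix l l' assume l: "l \<in> X" "l' \<in> X"
    have "l \<in> \<Lambda>" "l' \<in> \<Lambda>" using l X\<Lambda> by auto
    thus "e l l' \<le> R" using \<Lambda>(1)[of l] \<Lambda>(1)[of l'] E.strong_triangle[of l l' o'] E.commute[of l o'] by auto
    fix i j
    assume ij: "i \<in> I l" "i \<in> I l'" "j \<in> I l" "j \<in> I l'"
    have near: "d (q l k) (q l' k) \<le> R / 2 ^ J" if "k \<in> I l" "k \<in> I l'" for k
      using q(2)[OF that(1)] q(2)[OF that(2)] D.strong_triangle[of "q l k" "q l' k" "b k"]
        D.commute[of "q l k" "b k"] by (auto simp: r_def)
    show "e l l' * d (q l i) (q l j) \<le> C * (R / 2 ^ J)"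
      using l X\<Lambda> ij q(1) near by (intro inc[of l l' _ _ "q l' i" "q l' j"]) auto
  next
    fix l i j assume "l \<in> X" "i \<in> I l" "j \<in> I l"
    hence "d p0 (q l i) \<le> R" "d p0 (q l j) \<le> R" using q(1) G(2) by auto
    thus "d (q l i) (q l j) \<le> R"
      using D.strong_triangle[of "q l i" "q l j" p0] D.commute[of "q l i" p0] by auto
  next
    fix l assume "l \<in> X"
    hence "ennreal c \<le> ennreal (sum (\<nu> l) (I l))"
      using rich[of l] \<nu> X\<Lambda> by (blast intro: order_trans)
    thus "c \<le> sum (\<nu> l) (I l)" using \<nu> by (subst (asm) ennreal_le_iff) (auto intro: sum_nonneg)
  qed (use \<mu> \<nu> in \<open>auto simp: I_def r_def\<close>)
  moreover have "ennreal \<eta> \<le> ennreal (sum \<mu> X)" using \<Lambda>(2) \<mu> order_trans by blast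
  hence "\<eta> \<le> sum \<mu> X" using \<mu> by (simp add: ennreal_le_iff sum_nonneg)
  hence "(\<eta> * c)\<^sup>2 \<le> (sum \<mu> X * c)\<^sup>2"
    using pos by (intro power_mono mult_right_mono) auto
  ultimately show ?thesis by linarith
qed

section \<open>From a single scale to all scales\<close>

lemma eventually_linear_times_geometric_less:
  fixes A B y D :: real
  assumes "0 < y" "y < 1" "0 < D"
  shows "\<exists>K. \<forall>k\<ge>K. A * (real k + B) * y ^ k < D"
proof -
  have "(\<lambda>k. real k * y ^ k) \<longlonglongrightarrow> 0" using assms by (intro powser_times_n_limit_0) simp
  moreover have "(\<lambda>k. y ^ k) \<longlonglongrightarrow> 0" using assms by (intro LIMSEQ_power_zero) simp
  ultimately have "(\<lambda>k. A * (real k * y ^ k) + A * B * y ^ k) \<longlonglongrightarrow> A * 0 + A * B * 0"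
    by (intro tendsto_add tendsto_mult_left)
  hence "eventually (\<lambda>k. A * (real k * y ^ k) + A * B * y ^ k < D) sequentially"
    using assms by (intro order_tendstoD(2)) auto
  thus ?thesis by (simp add: eventually_sequentially algebra_simps)
qed

lemma ennreal_positive_real_below:
  assumes "0 < (x :: ennreal)"
  obtains y :: real where "0 < y" "ennreal y < x"
proof -
  obtain z where z: "0 < z" "z < x" using dense[OF assms] by blast
  then obtain y where "z = ennreal y" by (cases z) auto
  thus thesis using that[of y] z by simp
qed

lemma ball_content_pigeonhole:
  assumes "A \<subseteq> (\<Union>k. B k)" "ennreal c < ball_content d s A" "0 \<le> c" "w sums 1" "\<And>k. 0 \<le> w k"
  obtains k where "ennreal (c * w k) < ball_content d s (B k)"
proof (rule ccontr)
  assume "\<not> thesis"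
  hence le: "ball_content d s (B k) \<le> ennreal (c * w k)" for k using that not_less by blast
  have "ball_content d s A \<le> (\<Sum>k. ball_content d s (B k))"
    using ball_content_mono[OF assms(1)] ball_content_UN_le order_trans by blast
  also have "\<dots> \<le> (\<Sum>k. ennreal (c * w k))" by (intro suminf_le le) auto
  also have "\<dots> = ennreal c"
    using sums_mult[OF assms(4), of c] assms by (intro suminf_ennreal_eq) auto
  finally show False using assms(2) by simp
qed

lemma card_dyadic_pieces:
  assumes sum: "(\<Sum>i. ennreal (((1/2) ^ k i) powr r)) \<le> 1"
  shows "finite {i. k i = n}" and "real (card {i. k i = n}) \<le> 2 powr (real n * r)"
proof -
  have eq: "((1/2::real) ^ n) powr r = 2 powr (- (real n * r))"
    by (simp add: power_one_over powr_realpow[symmetric] powr_powr powr_minus_divide powr_divide)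
  have bound: "real (card F) \<le> 2 powr (real n * r)" if F: "finite F" "F \<subseteq> {i. k i = n}" for F
  proof -
    have "ennreal (real (card F) * 2 powr (- (real n * r))) = (\<Sum>i\<in>F. ennreal (((1/2) ^ n) powr r))"
      unfolding eq by (simp add: ennreal_mult' ennreal_of_nat_eq_real_of_nat)
    also have "\<dots> = (\<Sum>i\<in>F. ennreal (((1/2) ^ k i) powr r))"
      using F by (intro sum.cong) auto
    also have "\<dots> \<le> (\<Sum>i. ennreal (((1/2) ^ k i) powr r))"
      by (intro sum_le_suminf summableI F) auto
    also have "\<dots> \<le> ennreal 1" using sum by simp
    finally have "real (card F) * 2 powr (- (real n * r)) \<le> 1"
      by (subst (asm) ennreal_le_iff) auto
    thus ?thesis by (simp add: powr_minus field_simps)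
  qed
  show fin: "finite {i. k i = n}"
  proof (rule ccontr)
    assume "infinite {i. k i = n}"
    then obtain F where "F \<subseteq> {i. k i = n}" "finite F" "card F = Suc (nat \<lceil>2 powr (real n * r)\<rceil>)"
      using infinite_arbitrarily_large by blast
    with bound[of F] have "real (Suc (nat \<lceil>2 powr (real n * r)\<rceil>)) \<le> 2 powr (real n * r)" by simp
    thus False by linarith
  qed
  show "real (card {i. k i = n}) \<le> 2 powr (real n * r)" by (rule bound[OF fin order_refl])
qed

text \<open>
  The only geometric input. Lines \<open>l\<close>, \<open>l'\<close> of the bounded region that come within \<open>\<delta>\<close> of each other
  near \<open>u\<close> and near \<open>v\<close> satisfy the transversality estimate: the distance of the lines times the
  distance of \<open>u\<close> and \<open>v\<close> is of order \<open>\<delta>\<close>.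
\<close>

definition incidence_bound ::
  "('a \<Rightarrow> 'a \<Rightarrow> real) \<Rightarrow> ('b \<Rightarrow> 'b \<Rightarrow> real) \<Rightarrow> ('b \<Rightarrow> 'a set) \<Rightarrow> 'a \<Rightarrow> 'b \<Rightarrow> real \<Rightarrow> real \<Rightarrow> bool" where
  "incidence_bound d e Line p0 l0 R C \<longleftrightarrow>
     (\<forall>\<delta> l l' u v u' v'. e l0 l \<le> R \<longrightarrow> e l0 l' \<le> R \<longrightarrow>
        u \<in> Line l \<longrightarrow> v \<in> Line l \<longrightarrow> u' \<in> Line l' \<longrightarrow> v' \<in> Line l' \<longrightarrow>
        d p0 u \<le> R \<longrightarrow> d p0 v \<le> R \<longrightarrow> d p0 u' \<le> R \<longrightarrow> d p0 v' \<le> R \<longrightarrow>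
        d u u' \<le> \<delta> \<longrightarrow> d v v' \<le> \<delta> \<longrightarrow> e l l' * d u v \<le> C * \<delta>)"

lemma incidence_boundD:
  assumes "incidence_bound d e Line p0 l0 R C" "e l0 l \<le> R" "e l0 l' \<le> R"
    "u \<in> Line l" "v \<in> Line l" "u' \<in> Line l'" "v' \<in> Line l'"
    "d p0 u \<le> R" "d p0 v \<le> R" "d p0 u' \<le> R" "d p0 v' \<le> R" "d u u' \<le> \<delta>" "d v v' \<le> \<delta>"
  shows "e l l' * d u v \<le> C * \<delta>"
  by (rule assms(1)[unfolded incidence_bound_def, rule_format]) fact+

text \<open>
  Countable subadditivity reduces the claim to lines and points in a ball of radius
  \<open>R\<close> and to slices of content at least a fixed constant. Two pigeonholings, with shares
  decaying like \<open>2 powr (- \<epsilon> * k)\<close>, then select a scale, and the single scale estimate is violated there.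
\<close>

theorem furstenberg_lines_null:
  fixes d :: "'a \<Rightarrow> 'a \<Rightarrow> real" and e :: "'b \<Rightarrow> 'b \<Rightarrow> real" and Line :: "'b \<Rightarrow> 'a set"
  assumes d: "ultrametric d" and e: "ultrametric e"
    and st: "0 < t" "t \<le> s" "r < s + t"
    and net: "\<And>\<rho> \<delta>. 0 < \<delta> \<Longrightarrow> \<exists>Y. finite Y \<and> {l. e l0 l \<le> \<rho>} \<subseteq> (\<Union>y\<in>Y. {l. e y l \<le> \<delta>})"
    and inc: "\<And>R. 1 \<le> R \<Longrightarrow> \<exists>C\<ge>0. incidence_bound d e Line p0 l0 R C"
    and cov: "\<And>K. \<exists>b k. (\<forall>i::nat. K \<le> k i) \<and> E \<subseteq> (\<Union>i. {u. d (b i) u \<le> (1/2) ^ k i})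
        \<and> (\<Sum>i. ennreal (((1/2) ^ k i) powr r)) \<le> 1"
    and rich: "\<And>l. l \<in> \<Lambda> \<Longrightarrow> ball_content d s (E \<inter> Line l) \<noteq> 0"
  shows "ball_content e t \<Lambda> = 0"
proof -
  define disc where "disc m = {u. d p0 u \<le> 2 ^ m}" for m :: nat
  define \<Lambda>m where "\<Lambda>m m = {l\<in>\<Lambda>. e l0 l \<le> 2 ^ m \<and> ennreal ((1/2) ^ m) \<le> ball_content d s (E \<inter> disc m \<inter> Line l)}" for m
  have exh: "\<Lambda> \<subseteq> (\<Union>m. \<Lambda>m m)"
  proof
    fix l assume l: "l \<in> \<Lambda>"
    have "E \<inter> Line l \<subseteq> (\<Union>m. E \<inter> disc m \<inter> Line l)"
    proof
      fix u assume u: "u \<in> E \<inter> Line l"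
      obtain m where "d p0 u < 2 ^ m" using real_arch_pow[of 2 "d p0 u"] by auto
      thus "u \<in> (\<Union>m. E \<inter> disc m \<inter> Line l)" using u by (auto simp: disc_def intro!: exI[of _ m])
    qed
    hence "ball_content d s (E \<inter> Line l) \<le> (\<Sum>m. ball_content d s (E \<inter> disc m \<inter> Line l))"
      using ball_content_mono ball_content_UN_le order_trans by blast
    hence "\<exists>m. ball_content d s (E \<inter> disc m \<inter> Line l) \<noteq> 0" using rich[OF l] by (cases "\<forall>m. ball_content d s (E \<inter> disc m \<inter> Line l) = 0") auto
    then obtain m1 where m1: "ball_content d s (E \<inter> disc m1 \<inter> Line l) \<noteq> 0" ..
    obtain m2 where m2: "ennreal ((1/2) ^ m2) \<le> ball_content d s (E \<inter> disc m1 \<inter> Line l)"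
    proof -
      have "0 < ball_content d s (E \<inter> disc m1 \<inter> Line l)" using m1 by (simp add: zero_less_iff_neq_zero)
      then obtain x where x: "0 < x" "ennreal x < ball_content d s (E \<inter> disc m1 \<inter> Line l)"
        by (rule ennreal_positive_real_below)
      obtain m2 where "(1/2) ^ m2 < x" using real_arch_pow_inv[OF x(1), of "1/2"] by auto
      hence "ennreal ((1/2) ^ m2) \<le> ennreal x" by (intro ennreal_leI) simp
      thus thesis using that[of m2] x(2) by (meson less_imp_le order_trans)
    qed
    obtain m3 where m3: "e l0 l < 2 ^ m3" using real_arch_pow[of 2 "e l0 l"] by auto
    define m where "m = m1 + m2 + m3"
    have pw: "(2::real) ^ m1 \<le> 2 ^ m" "(2::real) ^ m3 \<le> 2 ^ m" "(1/2::real) ^ m \<le> (1/2) ^ m2"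
      unfolding m_def by (rule power_increasing power_decreasing; simp)+
    have "disc m1 \<subseteq> disc m" unfolding disc_def by (auto intro: order_trans[OF _ pw(1)])
    hence "E \<inter> disc m1 \<inter> Line l \<subseteq> E \<inter> disc m \<inter> Line l" by blast
    hence "ball_content d s (E \<inter> disc m1 \<inter> Line l) \<le> ball_content d s (E \<inter> disc m \<inter> Line l)"
      by (rule ball_content_mono)
    moreover have "ennreal ((1/2) ^ m) \<le> ennreal ((1/2) ^ m2)" using pw by (intro ennreal_leI)
    ultimately have "ennreal ((1/2) ^ m) \<le> ball_content d s (E \<inter> disc m \<inter> Line l)"
      using m2 by (meson order_trans)
    moreover have "e l0 l \<le> 2 ^ m" using m3 pw(2) by linarith
    ultimately have "l \<in> \<Lambda>m m" using l by (simp add: \<Lambda>m_def)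
    thus "l \<in> (\<Union>m. \<Lambda>m m)" by auto
  qed
  have null: "ball_content e t (\<Lambda>m m) = 0" for m
  proof (rule ccontr)
    assume "ball_content e t (\<Lambda>m m) \<noteq> 0"
    hence "0 < ball_content e t (\<Lambda>m m)" by (simp add: zero_less_iff_neq_zero)
    then obtain \<eta> where \<eta>: "0 < \<eta>" "ennreal \<eta> < ball_content e t (\<Lambda>m m)"
      by (rule ennreal_positive_real_below)
    define R :: real where "R = 2 ^ m"
    have R: "1 \<le> R" "0 < R" by (simp_all add: R_def)
    define c :: real where "c = (1/2) ^ m / 2"
    have c: "0 < c" "c < (1/2) ^ m" by (simp_all add: c_def)
    obtain C where C: "0 \<le> C" "incidence_bound d e Line p0 l0 R C"
      using inc[OF R(1)] by blast
    \<comment> \<open>The shares enter the estimate to the fourth power, so they cost \<open>4 * \<epsilon>\<close> out of the gain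
      \<open>s + t - r = 8 * \<epsilon>\<close>; the remainder beats the linear factor counting the scales.\<close>
    define \<epsilon> where "\<epsilon> = (s + t - r) / 8"
    define x :: real where "x = 2 powr (- \<epsilon>)"
    have \<epsilon>: "0 < \<epsilon>" using st by (simp add: \<epsilon>_def)
    have x: "0 < x" "x < 1" using \<epsilon> powr_less_mono[of "-\<epsilon>" 0 2] by (simp_all add: x_def)
    define w where "w k = (1 - x) * x ^ k" for k
    have w0: "0 \<le> w k" for k using x by (simp add: w_def)
    have w1: "w sums 1"
      using sums_mult[OF geometric_sums[of x], of "1 - x"] x by (simp add: w_def[abs_def])
    define A where "A = R powr t * (2 * max (2 * C) R) powr s"
    define D where "D = (\<eta> * c)\<^sup>2 * (1 - x) ^ 4"
    have D: "0 < D" using \<eta> c x by (simp add: D_def)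
    have A: "0 \<le> A" by (simp add: A_def)
    obtain K where K: "\<And>k. K \<le> k \<Longrightarrow> A * (real k + (real m + 1)) * (x ^ 4) ^ k < D"
      using eventually_linear_times_geometric_less[of "x ^ 4" D A "real m + 1"] x D
      by (auto simp: power_less_one_iff)
    \<comment> \<open>all radii of the cover are so small that the estimate fails at each of them\<close>
    obtain b k where k: "\<And>i::nat. K \<le> k i" and E: "E \<subseteq> (\<Union>i. {u. d (b i) u \<le> (1/2) ^ k i})"
      and cost: "(\<Sum>i. ennreal (((1/2) ^ k i) powr r)) \<le> 1"
      using cov[of K] by blast
    define P where "P n = {i. k i = n}" for n
    \<comment> \<open>the part of \<open>E\<close> covered by the balls of radius \<open>(1/2) ^ n\<close>\<close>
    define G where "G n = E \<inter> disc m \<inter> (\<Union>i\<in>P n. {u. d (b i) u \<le> (1/2) ^ n})" for n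
    define \<Lambda>k where "\<Lambda>k n = {l\<in>\<Lambda>m m. ennreal (c * w n) < ball_content d s (G n \<inter> Line l)}" for n
    have "\<Lambda>m m \<subseteq> (\<Union>n. \<Lambda>k n)"
    proof
      fix l assume l: "l \<in> \<Lambda>m m"
      have "E \<inter> disc m \<inter> Line l \<subseteq> (\<Union>n. G n \<inter> Line l)"
        using E by (fastforce simp: G_def P_def)
      moreover have "ennreal c < ennreal ((1/2) ^ m)" using c by (intro ennreal_lessI) auto
      hence "ennreal c < ball_content d s (E \<inter> disc m \<inter> Line l)"
        using l less_le_trans by (auto simp: \<Lambda>m_def)
      ultimately obtain n where "ennreal (c * w n) < ball_content d s (G n \<inter> Line l)"
        by (rule ball_content_pigeonhole[OF _ _ less_imp_le[OF c(1)] w1 w0])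
      thus "l \<in> (\<Union>n. \<Lambda>k n)" using l by (auto simp: \<Lambda>k_def)
    qed
    then obtain n where n: "ennreal (\<eta> * w n) < ball_content e t (\<Lambda>k n)"
      by (rule ball_content_pigeonhole[OF _ \<eta>(2) less_imp_le[OF \<eta>(1)] w1 w0])
    \<comment> \<open>some ball of the cover has radius \<open>(1/2) ^ n\<close>, so \<open>n\<close> is one of the scales ruled out by \<open>K\<close>\<close>
    have "\<Lambda>k n \<noteq> {}" using n by auto
    then obtain l where "ennreal (c * w n) < ball_content d s (G n \<inter> Line l)" by (auto simp: \<Lambda>k_def)
    hence "G n \<inter> Line l \<noteq> {}" by auto
    then obtain i where "i \<in> P n" by (auto simp: G_def)
    hence "K \<le> n" using k by (auto simp: P_def)
    have scale: "R / 2 ^ (n + m) = (1/2) ^ n" by (simp add: R_def power_add field_simps)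
    obtain Y where Y: "finite Y" "{l. e l0 l \<le> R} \<subseteq> (\<Union>y\<in>Y. {l. e y l \<le> (1/2) ^ n})"
      using net[of "(1/2) ^ n" R] by auto
    have lR: "e l0 l \<le> R" if "l \<in> \<Lambda>k n" for l using that by (simp add: \<Lambda>k_def \<Lambda>m_def R_def)
    have GR: "d p0 u \<le> R" if "u \<in> G n" for u using that by (simp add: G_def disc_def R_def)
    have "(\<eta> * w n * (c * w n))\<^sup>2 \<le> card (P n) *
        (R powr t * ((2 * max (2 * C) R) powr s * (real (n + m) + 1) * (R / 2 ^ (n + m)) powr (s + t)))"
    proof (rule furstenberg_single_scale[OF d e, where \<Lambda> = "\<Lambda>k n" and Line = Line and G = "G n" and Y = Y
          and C = C and b = b and ?o' = l0 and ?p0.0 = p0])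
      show "finite (P n)" unfolding P_def by (rule card_dyadic_pieces[OF cost])
      show "\<Lambda>k n \<subseteq> (\<Union>y\<in>Y. {l. e y l \<le> R / 2 ^ (n + m)})"
        unfolding scale using Y(2) by (auto simp: \<Lambda>k_def \<Lambda>m_def R_def)
      show "G n \<subseteq> (\<Union>i\<in>P n. {u. d (b i) u \<le> R / 2 ^ (n + m)})" unfolding scale by (auto simp: G_def)
      show "e l l' * d u v \<le> C * (R / 2 ^ (n + m))"
        if "l \<in> \<Lambda>k n" "l' \<in> \<Lambda>k n" "u \<in> G n \<inter> Line l" "v \<in> G n \<inter> Line l" "u' \<in> G n \<inter> Line l'"
          "v' \<in> G n \<inter> Line l'" "d u u' \<le> R / 2 ^ (n + m)" "d v v' \<le> R / 2 ^ (n + m)" for l l' u v u' v'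
        using that by (intro incidence_boundD[OF C(2), of l l' u v u' v']) (simp_all add: lR GR)
      show "e l0 l \<le> R" if "l \<in> \<Lambda>k n" for l using lR[OF that] .
      show "d p0 u \<le> R" if "u \<in> G n" for u using GR[OF that] .
      show "ennreal (c * w n) \<le> ball_content d s (G n \<inter> Line l)" if "l \<in> \<Lambda>k n" for l
        using that by (simp add: \<Lambda>k_def less_imp_le)
      show "ennreal (\<eta> * w n) \<le> ball_content e t (\<Lambda>k n)" using n by simp
      show "0 \<le> c * w n" "0 \<le> \<eta> * w n" using c \<eta> w0[of n] by simp_all
    qed (fact R C(1) st Y)+
    also have "\<dots> \<le> 2 powr (real n * r) *
        (R powr t * ((2 * max (2 * C) R) powr s * (real (n + m) + 1) * (R / 2 ^ (n + m)) powr (s + t)))"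
      unfolding P_def using card_dyadic_pieces(2)[OF cost, of n] by (intro mult_right_mono) auto
    also have "\<dots> = A * (real n + (real m + 1)) * (2 powr (real n * r) * ((1/2) ^ n) powr (s + t))"
      unfolding scale A_def by (simp add: mult_ac add_ac)
    also have "2 powr (real n * r) * ((1/2) ^ n) powr (s + t) = x ^ (8 * n)"
    proof -
      have "((1/2::real) ^ n) powr (s + t) = 2 powr (- (real n * (s + t)))"
        by (simp add: power_one_over powr_realpow[symmetric] powr_powr powr_minus_divide powr_divide)
      moreover have "x ^ (8 * n) = 2 powr (- \<epsilon> * (8 * real n))"
        unfolding x_def by (simp add: powr_power mult_ac)
      moreover have "- \<epsilon> * (8 * real n) = real n * r + - (real n * (s + t))"
        by (simp add: \<epsilon>_def field_simps)
      ultimately show ?thesis by (simp only: powr_add)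
    qed
    finally have main: "(\<eta> * w n * (c * w n))\<^sup>2 \<le> A * (real n + (real m + 1)) * x ^ (8 * n)" .
    have "(\<eta> * w n * (c * w n))\<^sup>2 = D * x ^ (4 * n)"
    proof -
      have "\<eta> * w n * (c * w n) = (\<eta> * c) * (w n)\<^sup>2" by (simp add: power2_eq_square)
      hence "(\<eta> * w n * (c * w n))\<^sup>2 = (\<eta> * c)\<^sup>2 * (w n) ^ 4"
        by (simp add: power_mult_distrib flip: power_mult)
      also have "(w n) ^ 4 = (1 - x) ^ 4 * x ^ (4 * n)"
        by (simp add: w_def power_mult_distrib mult.commute flip: power_mult)
      finally show ?thesis by (simp add: D_def)
    qed
    also have "x ^ (8 * n) = (x ^ 4) ^ n * x ^ (4 * n)"
      by (simp add: power_mult[symmetric] power_add[symmetric])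
    ultimately have "D * x ^ (4 * n) \<le> A * (real n + (real m + 1)) * (x ^ 4) ^ n * x ^ (4 * n)"
      using main by (simp add: mult_ac)
    hence "D \<le> A * (real n + (real m + 1)) * (x ^ 4) ^ n" using x by simp
    thus False using K[OF \<open>K \<le> n\<close>] by simp
  qed
  have "ball_content e t \<Lambda> \<le> (\<Sum>m. ball_content e t (\<Lambda>m m))"
    using ball_content_mono[OF exh] ball_content_UN_le order_trans by blast
  thus ?thesis by (simp add: null)
qed

section \<open>Hausdorff measure and ball ball_content\<close>

lemma hausdorff_pre_le_measure: "0 < \<delta> \<Longrightarrow> hausdorff_pre d r \<delta> A \<le> hausdorff_measure d r A"
  unfolding hausdorff_measure_def by (rule SUP_upper) simp

lemma hausdorff_pre_le: "delta_cover d \<delta> A U \<Longrightarrow> hausdorff_pre d r \<delta> A \<le> (\<Sum>i. ennreal (diam_power d r (U i)))"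
  unfolding hausdorff_pre_def by (rule INF_lower) simp

lemma hausdorff_pre_mono: "A \<subseteq> B \<Longrightarrow> hausdorff_pre d r \<delta> A \<le> hausdorff_pre d r \<delta> B"
  unfolding hausdorff_pre_def
  by (rule INF_superset_mono) (auto simp: delta_cover_def subset_iff)

lemma hausdorff_measure_mono: "A \<subseteq> B \<Longrightarrow> hausdorff_measure d r A \<le> hausdorff_measure d r B"
  unfolding hausdorff_measure_def by (rule SUP_mono') (rule hausdorff_pre_mono)

lemma hausdorff_dim_mono:
  assumes "A \<subseteq> B"
  shows "hausdorff_dim d A \<le> hausdorff_dim d B"
  unfolding hausdorff_dim_def
proof (rule INF_superset_mono)
  show "{r. 0 \<le> r \<and> hausdorff_measure d r B = 0} \<subseteq> {r. 0 \<le> r \<and> hausdorff_measure d r A = 0}"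
  proof safe
    fix r assume "hausdorff_measure d r B = 0"
    thus "hausdorff_measure d r A = 0" using hausdorff_measure_mono[OF assms, of d r] by simp
  qed
qed simp

lemma hausdorff_measure_empty [simp]: "hausdorff_measure d r {} = 0"
proof -
  have "hausdorff_pre d r \<delta> {} \<le> (\<Sum>i::nat. ennreal (diam_power d r {}))" for \<delta>
    by (rule hausdorff_pre_le) (simp add: delta_cover_def)
  thus ?thesis by (simp add: hausdorff_measure_def diam_power_def)
qed

lemma hausdorff_dim_geI:
  assumes "\<And>r. 0 \<le> r \<Longrightarrow> r < s \<Longrightarrow> hausdorff_measure d r A \<noteq> 0"
  shows "ennreal s \<le> hausdorff_dim d A"
  unfolding hausdorff_dim_def using assms by (intro INF_greatest ennreal_leI) force

lemma hausdorff_dim_leI: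
  assumes "0 \<le> s" "\<And>r. s < r \<Longrightarrow> hausdorff_measure d r A = 0"
  shows "hausdorff_dim d A \<le> ennreal s"
proof (rule ennreal_le_epsilon)
  fix e :: real assume e: "0 < e"
  have "hausdorff_dim d A \<le> ennreal (s + e)"
    unfolding hausdorff_dim_def using assms e by (intro INF_lower) auto
  thus "hausdorff_dim d A \<le> ennreal s + ennreal e" using assms e by simp
qed

text \<open>
  In exponent 0 each nonempty covering set costs 1.
\<close>

lemma hausdorff_measure_0_exponent_0_empty:
  assumes "hausdorff_measure d 0 A = 0"
  shows "A = {}"
proof -
  have "hausdorff_pre d 0 1 A < 1" using hausdorff_pre_le_measure[of 1 d 0 A] assms by simp
  then obtain U where U: "delta_cover d 1 A U" "(\<Sum>i. ennreal (diam_power d 0 (U i))) < 1"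
    unfolding hausdorff_pre_def by (auto simp: INF_less_iff)
  have "U i = {}" for i
  proof (rule ccontr)
    assume "U i \<noteq> {}"
    hence "1 = (\<Sum>i\<in>{i}. ennreal (diam_power d 0 (U i)))" by (simp add: diam_power_def)
    also have "\<dots> \<le> (\<Sum>i. ennreal (diam_power d 0 (U i)))" by (intro sum_le_suminf summableI) auto
    finally show False using U(2) by simp
  qed
  thus ?thesis using U(1) by (auto simp: delta_cover_def)
qed

context ultrametric
begin

lemma dist_le_diam:
  assumes "\<And>x y. x \<in> U \<Longrightarrow> y \<in> U \<Longrightarrow> d x y \<le> \<delta>" "x \<in> U" "y \<in> U"
  shows "d x y \<le> diam d U"
proof -
  have "d x y \<le> (SUP (x, y)\<in>U \<times> U. d x y)"
    using assms by (intro cSUP_upper2[where x = "(x, y)"] bdd_aboveI2[where M = \<delta>]) auto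
  thus ?thesis using assms by (auto simp: diam_def)
qed

lemma diam_le:
  assumes "\<And>x y. x \<in> U \<Longrightarrow> y \<in> U \<Longrightarrow> d x y \<le> \<rho>" "0 \<le> \<rho>"
  shows "diam d U \<le> \<rho>"
  using assms by (auto simp: diam_def intro!: cSUP_least)

lemma diam_nonneg:
  assumes "\<And>x y. x \<in> U \<Longrightarrow> y \<in> U \<Longrightarrow> d x y \<le> \<delta>"
  shows "0 \<le> diam d U"
proof (cases "U = {}")
  case False
  then obtain x where "x \<in> U" by auto
  thus ?thesis using dist_le_diam[where x = x and y = x, OF assms] by simp
qed (simp add: diam_def)

lemma ball_diam:
  assumes "x \<in> {y. d c y \<le> \<rho>}" "y \<in> {y. d c y \<le> \<rho>}"
  shows "d x y \<le> \<rho>"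
  using assms strong_triangle[of x y c] commute[of x c] by auto

lemma diam_power_ball_le:
  assumes "0 < s" "0 \<le> \<rho>"
  shows "diam_power d s {y. d c y \<le> \<rho>} \<le> \<rho> powr s"
proof -
  have "diam d {y. d c y \<le> \<rho>} \<le> \<rho>" "0 \<le> diam d {y. d c y \<le> \<rho>}"
    using ball_diam assms(2) by (blast intro: diam_le diam_nonneg)+
  thus ?thesis using assms by (auto simp: diam_power_def intro: powr_mono2)
qed

text \<open>
  A cheap cover automatically consists of small balls, because a large ball alone costs more than
  the whole cover.
\<close>

lemma hausdorff_measure_0_if_content_0:
  assumes s: "0 < s" and A: "ball_content d s A = 0"
  shows "hausdorff_measure d s A = 0"
proof -
  have "hausdorff_pre d s \<delta> A \<le> 0 + ennreal \<epsilon>" if \<delta>: "0 < \<delta>" and \<epsilon>: "0 < \<epsilon>" for \<delta> \<epsilon> :: real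
  proof -
    define m where "m = min \<epsilon> (\<delta> powr s)"
    have m: "0 < m" "m \<le> \<epsilon>" "m \<le> \<delta> powr s" using \<delta> \<epsilon> by (auto simp: m_def)
    have "ball_content d s A < ennreal m" using A m by simp
    then obtain c \<rho> where cov: "ball_cover d A c \<rho>" and cost: "(\<Sum>i. ennreal (\<rho> i powr s)) < ennreal m"
      by (rule ball_content_lessE)
    have \<rho>0: "0 \<le> \<rho> i" for i using cov by (simp add: ball_cover_def)
    have \<rho>\<delta>: "\<rho> i \<le> \<delta>" for i
    proof (rule ccontr)
      assume "\<not> \<rho> i \<le> \<delta>"
      hence "\<delta> powr s \<le> \<rho> i powr s" using \<delta> s by (intro powr_mono2) auto
      hence "ennreal m \<le> (\<Sum>i\<in>{i}. ennreal (\<rho> i powr s))" using m by (simp add: ennreal_leI)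
      also have "\<dots> \<le> (\<Sum>i. ennreal (\<rho> i powr s))" by (intro sum_le_suminf summableI) auto
      finally show False using cost by simp
    qed
    have "delta_cover d \<delta> A (\<lambda>i. {y. d (c i) y \<le> \<rho> i})"
      using cov ball_diam order_trans[OF _ \<rho>\<delta>] unfolding delta_cover_def ball_cover_def by blast
    hence "hausdorff_pre d s \<delta> A \<le> (\<Sum>i. ennreal (diam_power d s {y. d (c i) y \<le> \<rho> i}))"
      by (rule hausdorff_pre_le)
    also have "\<dots> \<le> (\<Sum>i. ennreal (\<rho> i powr s))"
      using diam_power_ball_le[OF s \<rho>0] by (intro suminf_le ennreal_leI) auto
    also have "\<dots> \<le> ennreal \<epsilon>" using cost m by (meson ennreal_leI less_imp_le order_trans)
    finally show ?thesis by simp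
  qed
  hence "hausdorff_pre d s \<delta> A \<le> 0" if "0 < \<delta>" for \<delta>
    by (rule ennreal_le_epsilon[OF _]) (rule that)
  thus ?thesis by (simp add: hausdorff_measure_def)
qed

lemma ball_content_nonzero_below_dim:
  assumes "ennreal s \<le> hausdorff_dim d A" "0 < s'" "s' < s"
  shows "ball_content d s' A \<noteq> 0"
proof
  assume "ball_content d s' A = 0"
  hence "hausdorff_measure d s' A = 0" using assms hausdorff_measure_0_if_content_0 by blast
  hence "hausdorff_dim d A \<le> ennreal s'"
    unfolding hausdorff_dim_def using assms by (intro INF_lower) auto
  hence "ennreal s \<le> ennreal s'" using assms(1) by (rule order_trans[rotated])
  thus False using assms by simp
qed

text \<open>
  The summand \<open>\<eta>\<close> pays for sets of diameter zero, which need a ball of positive radius all the same.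
\<close>

lemma dyadic_ball_around:
  assumes U: "\<And>x y. x \<in> U \<Longrightarrow> y \<in> U \<Longrightarrow> d x y \<le> (1/2) ^ K" and r: "0 < r" and \<eta>: "0 < \<eta>"
  shows "\<exists>b k. K \<le> k \<and> U \<subseteq> {u. d b u \<le> (1/2) ^ k} \<and> ((1/2) ^ k) powr r \<le> 2 powr r * diam_power d r U + \<eta>"
proof -
  define D where "D = diam d U"
  \<comment> \<open>an arbitrary point if \<open>U\<close> is empty; then there is nothing to cover\<close>
  define b where "b = (SOME x. x \<in> U)"
  have D0: "0 \<le> D" unfolding D_def by (rule diam_nonneg[OF U])
  have bD: "d b u \<le> D" if "u \<in> U" for u
    unfolding D_def using that by (intro dist_le_diam[OF U]) (auto simp: b_def intro: someI)
  have DK: "D \<le> (1/2) ^ K" unfolding D_def by (rule diam_le[OF U]) auto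
  show ?thesis
  proof (cases "D = 0")
    case True
    have "(\<lambda>k. ((1/2::real) powr r) ^ k) \<longlonglongrightarrow> 0"
      using r powr_less_mono2[of r "1/2" 1] by (intro LIMSEQ_power_zero) simp
    hence "eventually (\<lambda>k. ((1/2::real) powr r) ^ k < \<eta>) sequentially"
      using \<eta> by (intro order_tendstoD(2)) auto
    hence "eventually (\<lambda>k. ((1/2::real) powr r) ^ k < \<eta> \<and> K \<le> k) sequentially"
      using eventually_ge_at_top by (rule eventually_conj)
    then obtain k where k: "((1/2::real) powr r) ^ k < \<eta>" "K \<le> k"
      by (auto simp: eventually_sequentially)
    have "((1/2::real) ^ k) powr r = ((1/2) powr r) ^ k"
      by (simp add: powr_powr powr_realpow[symmetric] mult.commute del: powr_realpow)
    moreover have "0 \<le> diam_power d r U" by (simp add: diam_power_def)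
    ultimately have "((1/2) ^ k) powr r \<le> 2 powr r * diam_power d r U + \<eta>"
      using k by (simp add: add_increasing)
    moreover have "D \<le> (1/2) ^ k" using True by simp
    hence "U \<subseteq> {u. d b u \<le> (1/2) ^ k}" using order_trans[OF bD] by blast
    ultimately show ?thesis using k by blast
  next
    case False
    hence Dp: "0 < D" using D0 by simp
    obtain J where J: "(1/2) ^ J < D" using real_arch_pow_inv[OF Dp, of "1/2"] by auto
    obtain j where j: "j \<le> J" "D \<le> (1/2) ^ K / 2 ^ j" "j = J \<or> (1/2) ^ K / 2 ^ j \<le> 2 * D"
      by (rule dyadic_scale_of[OF DK])
    have eq: "(1/2::real) ^ K / 2 ^ j = (1/2) ^ (K + j)" by (simp add: power_add power_one_over)
    have le: "(1/2) ^ (K + J) \<le> (1/2::real) ^ J" by (intro power_decreasing) auto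
    have "(1/2) ^ (K + j) \<le> 2 * D"
      using j(3) unfolding eq
    proof
      assume "j = J"
      hence "(1/2) ^ (K + j) \<le> (1/2::real) ^ J" using le by simp
      thus ?thesis using J Dp by linarith
    qed
    hence "((1/2) ^ (K + j)) powr r \<le> (2 * D) powr r" using r by (intro powr_mono2) auto
    also have "\<dots> = 2 powr r * D powr r" using Dp by (simp add: powr_mult)
    also have "D powr r = diam_power d r U"
      using False r by (auto simp: diam_power_def D_def diam_def)
    finally have "((1/2) ^ (K + j)) powr r \<le> 2 powr r * diam_power d r U + \<eta>" using \<eta> by simp
    moreover have "U \<subseteq> {u. d b u \<le> (1/2) ^ (K + j)}" using order_trans[OF bD j(2)[unfolded eq]] by blast
    ultimately show ?thesis by (intro exI[of _ b] exI[of _ "K + j"]) auto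
  qed
qed

text \<open>
  Rounding to dyadic radii multiplies the cost by at most \<open>2 powr r\<close>; half of the budget of 1 is left
  for the covering sets of diameter zero.
\<close>

lemma dyadic_cover_if_hausdorff_measure_0:
  assumes r: "0 < r" and E: "hausdorff_measure d r E = 0"
  shows "\<exists>b k. (\<forall>i::nat. K \<le> k i) \<and> E \<subseteq> (\<Union>i. {u. d (b i) u \<le> (1/2) ^ k i})
    \<and> (\<Sum>i. ennreal (((1/2) ^ k i) powr r)) \<le> 1"
proof -
  define \<epsilon> :: real where "\<epsilon> = (1/2) / 2 powr r"
  have \<epsilon>: "0 < \<epsilon>" "2 powr r * \<epsilon> = 1/2" by (simp_all add: \<epsilon>_def)
  have "hausdorff_pre d r ((1/2) ^ K) E < ennreal \<epsilon>"
    using hausdorff_pre_le_measure[of "(1/2) ^ K" d r E] E \<epsilon> by simp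
  then obtain U where U: "delta_cover d ((1/2) ^ K) E U" "(\<Sum>i. ennreal (diam_power d r (U i))) < ennreal \<epsilon>"
    unfolding hausdorff_pre_def by (auto simp: INF_less_iff)
  have "\<forall>i. \<exists>b k. K \<le> k \<and> U i \<subseteq> {u. d b u \<le> (1/2) ^ k}
      \<and> ((1/2) ^ k) powr r \<le> 2 powr r * diam_power d r (U i) + (1/2) * (1/2) ^ Suc i"
    using U(1) r by (intro allI dyadic_ball_around) (auto simp: delta_cover_def)
  then obtain b k where bk: "\<And>i. K \<le> k i" "\<And>i. U i \<subseteq> {u. d (b i) u \<le> (1/2) ^ k i}"
    "\<And>i. ((1/2) ^ k i) powr r \<le> 2 powr r * diam_power d r (U i) + (1/2) * (1/2) ^ Suc i"
    by metis
  have dp0: "0 \<le> diam_power d r (U i)" for i by (simp add: diam_power_def)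
  have "(\<Sum>i. ennreal (((1/2) ^ k i) powr r))
      \<le> (\<Sum>i. ennreal (2 powr r) * ennreal (diam_power d r (U i)) + ennreal ((1/2) * (1/2) ^ Suc i))"
  proof (intro suminf_le summableI)
    fix i
    have "ennreal (((1/2) ^ k i) powr r) \<le> ennreal (2 powr r * diam_power d r (U i) + (1/2) * (1/2) ^ Suc i)"
      using bk(3) by (intro ennreal_leI)
    also have "\<dots> = ennreal (2 powr r) * ennreal (diam_power d r (U i)) + ennreal ((1/2) * (1/2) ^ Suc i)"
      using dp0[of i] by (subst ennreal_plus) (auto simp: ennreal_mult)
    finally show "ennreal (((1/2) ^ k i) powr r)
      \<le> ennreal (2 powr r) * ennreal (diam_power d r (U i)) + ennreal ((1/2) * (1/2) ^ Suc i)" .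
  qed
  also have "\<dots> = ennreal (2 powr r) * (\<Sum>i. ennreal (diam_power d r (U i))) + (\<Sum>i. ennreal ((1/2) * (1/2) ^ Suc i))"
    by (subst suminf_add[symmetric]) auto
  also have "\<dots> \<le> ennreal (1/2) + ennreal (1/2)"
  proof (rule add_mono)
    have "ennreal (2 powr r) * (\<Sum>i. ennreal (diam_power d r (U i))) \<le> ennreal (2 powr r) * ennreal \<epsilon>"
      using U(2) by (intro mult_left_mono) auto
    also have "\<dots> = ennreal (1/2)"
      unfolding \<epsilon>(2)[symmetric] using \<epsilon>(1) by (simp add: ennreal_mult)
    finally show "ennreal (2 powr r) * (\<Sum>i. ennreal (diam_power d r (U i))) \<le> ennreal (1/2)" .
    have "(\<Sum>i. ennreal ((1/2) * (1/2) ^ Suc i)) = ennreal (1/2)"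
      using sums_mult[OF power_half_series, of "1/2"] by (intro suminf_ennreal_eq) auto
    thus "(\<Sum>i. ennreal ((1/2) * (1/2) ^ Suc i)) \<le> ennreal (1/2)" by (rule eq_refl)
  qed
  also have "\<dots> = ennreal (1/2 + 1/2)" by (rule ennreal_plus[symmetric]) auto
  also have "\<dots> = 1" by simp
  finally have "(\<Sum>i. ennreal (((1/2) ^ k i) powr r)) \<le> 1" .
  moreover have "E \<subseteq> (\<Union>i. {u. d (b i) u \<le> (1/2) ^ k i})"
    using U(1) bk(2) by (fastforce simp: delta_cover_def)
  ultimately show ?thesis using bk(1) by blast
qed

end

section \<open>Lines in the $p$-adic plane\<close>

lemma pnorm_diff_commute: "pnorm (x - y :: 'p::prime_card padic) = pnorm (y - x)"
  using pnorm_minus[of "x - y"] by simp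

lemma pnorm_diff_le: "pnorm (x - y :: 'p::prime_card padic) \<le> max (pnorm x) (pnorm y)"
  using pnorm_add[of x "- y"] by simp

lemma pnorm_add_le:
  "pnorm x \<le> c \<Longrightarrow> pnorm y \<le> c \<Longrightarrow> pnorm (x + y :: 'p::prime_card padic) \<le> c"
  using pnorm_add[of x y] by simp

lemma pnorm_sub_le:
  "pnorm x \<le> c \<Longrightarrow> pnorm y \<le> c \<Longrightarrow> pnorm (x - y :: 'p::prime_card padic) \<le> c"
  using pnorm_diff_le[of x y] by simp

lemma pnorm_ultra: "pnorm (x - z :: 'p::prime_card padic) \<le> max (pnorm (x - y)) (pnorm (y - z))"
  using pnorm_add[of "x - y" "y - z"] by simp

lemma ultrametric_plane_dist:
  "ultrametric (plane_dist :: 'p::prime_card padic \<times> 'p padic \<Rightarrow> _)"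
proof
  fix u v w :: "'p padic \<times> 'p padic"
  show "plane_dist u w \<le> max (plane_dist u v) (plane_dist v w)"
    using pnorm_ultra[of "fst u" "fst w" "fst v"] pnorm_ultra[of "snd u" "snd w" "snd v"]
    by (auto simp: plane_dist_def plane_norm_def le_max_iff_disj)
  show "plane_dist u v = plane_dist v u"
    by (simp add: plane_dist_def plane_norm_def pnorm_diff_commute)
qed (auto simp: plane_dist_def plane_norm_def le_max_iff_disj)

lemma plane_dist_Pair:
  "plane_dist (a, b) (a', b') = max (pnorm (a - a')) (pnorm (b - b'))"
  by (simp add: plane_dist_def plane_norm_def)

lemma plane_dist_0: "plane_dist 0 (a, b) = max (pnorm a) (pnorm b)"
  by (simp add: plane_dist_def plane_norm_def)

text \<open>
  The denominator of a \<open>p\<close>-integral fraction \<open>a / b\<close> is invertible modulo \<open>p ^ M\<close>, so the fraction is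
  congruent to \<open>a * c\<close>, where \<open>c\<close> inverts \<open>b\<close>.
\<close>

lemma rat_pnorm_le_1_approx_int:
  assumes p: "prime p" and x: "rat_pnorm p x \<le> 1"
  shows "\<exists>z\<in>{0..<int p ^ M}. rat_pnorm p (x - of_int z) \<le> (1 / real p) ^ M"
proof -
  have p1: "1 < real p" using prime_gt_1_nat[OF p] by simp
  obtain a b where ab: "quotient_of x = (a, b)" by (cases "quotient_of x")
  have b: "0 < b" "x = of_int a / of_int b" "coprime a b"
    using quotient_of_denom_pos[OF ab] quotient_of_div[OF ab] quotient_of_coprime[OF ab] by auto
  have unit: "\<not> is_unit (int p)" using p1 by simp
  have "\<not> int p dvd b"
  proof
    assume pb: "int p dvd b"
    hence pa: "\<not> int p dvd a" using b(3) unit by (meson coprime_common_divisor)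
    hence a0: "a \<noteq> 0" by auto
    have "multiplicity (int p) a = 0" using pa by (rule not_dvd_imp_multiplicity_0)
    moreover have "0 < multiplicity (int p) b" using pb b(1) unit by (simp add: multiplicity_gt_zero_iff)
    ultimately have "rat_pval p x < 0" by (simp add: rat_pval_def ab)
    hence "1 < real p powi (- rat_pval p x)" using p1 by (simp add: power_int_strict_increasing[of 0 _ "real p", simplified])
    thus False using x a0 b by (simp add: rat_pnorm_def)
  qed
  hence mb: "multiplicity (int p) b = 0" and "coprime b (int p)"
    using p prime_imp_coprime[of "int p" b] by (auto simp: not_dvd_imp_multiplicity_0 coprime_commute)
  hence "coprime b (int p ^ M)" by simp
  then obtain c where c: "[b * c = 1] (mod int p ^ M)" using cong_solve_coprime_int by blast
  define z where "z = (a * c) mod (int p ^ M)"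
  have z: "z \<in> {0..<int p ^ M}" using p1 by (simp add: z_def)
  have "[z = a * c] (mod int p ^ M)" by (simp add: z_def cong_def)
  hence "[z * b = a * c * b] (mod int p ^ M)" by (rule cong_scalar_right)
  also have "a * c * b = a * (b * c)" by simp
  also have "[a * (b * c) = a * 1] (mod int p ^ M)" using c by (rule cong_scalar_left)
  finally have dvd: "int p ^ M dvd a - z * b" by (simp add: cong_iff_dvd_diff dvd_diff_commute)
  have "rat_pnorm p (x - of_int z) \<le> (1 / real p) ^ M"
  proof (cases "a - z * b = 0")
    case True
    hence "a = z * b" by simp
    hence "x = of_int z" using b by simp
    thus ?thesis by simp
  next
    case False
    have eq: "x - of_int z = of_int (a - z * b) / of_int b" using b by (simp add: field_simps)
    have nz: "x - of_int z \<noteq> 0" unfolding eq using False b(1) by (simp del: of_int_diff of_int_mult)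
    have "M \<le> multiplicity (int p) (a - z * b)" using dvd False unit by (intro multiplicity_geI) auto
    hence "int M \<le> rat_pval p (x - of_int z)"
      unfolding eq using rat_pval_of_int_divide[OF p False, of b] b(1) mb by simp
    hence "real p powi (- rat_pval p (x - of_int z)) \<le> real p powi (- int M)"
      using p1 by (intro power_int_increasing) auto
    also have "\<dots> = (1 / real p) ^ M" by (simp add: power_int_minus power_one_over inverse_eq_divide)
    finally show ?thesis using nz by (simp add: rat_pnorm_def)
  qed
  thus ?thesis using z by blast
qed

lemma prime_card_gt_1: "1 < real CARD('p::prime_card)"
  using prime_gt_1_nat[OF prime_card[where 'a = 'p]] by simp

lemma rat_pnorm_prime_power:
  assumes p: "prime p"
  shows "rat_pnorm p (of_nat p ^ m) = (1 / real p) ^ m"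
proof -
  have "rat_pnorm p (of_nat p) = 1 / real p"
  proof -
    have "multiplicity (int p) (int p) = 1"
      using p by (intro multiplicity_self) (auto simp: prime_gt_0_nat)
    moreover have "quotient_of (of_nat p) = (int p, 1)"
      using quotient_of_int[of "int p"] by simp
    ultimately have "rat_pval p (of_nat p) = 1" by (simp add: rat_pval_def)
    thus ?thesis using prime_gt_0_nat[OF p] by (simp add: rat_pnorm_def power_int_minus inverse_eq_divide)
  qed
  thus ?thesis by (induction m) (simp_all add: rat_pnorm_mult[OF p] rat_pnorm_1[OF p])
qed

text \<open>
  Approximate by a rational number, clear the \<open>p\<close>-part of its denominator, and reduce the resulting
  \<open>p\<close>-integral fraction to a residue: the fractions \<open>z / p ^ m\<close> with \<open>0 \<le> z < p ^ (N + m)\<close> form a net.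
\<close>

lemma padic_balls_totally_bounded:
  fixes \<rho> \<delta> :: real
  assumes "0 < \<delta>"
  shows "\<exists>Z :: 'p::prime_card padic set. finite Z \<and> (\<forall>x. pnorm x \<le> \<rho> \<longrightarrow> (\<exists>z\<in>Z. pnorm (z - x) \<le> \<delta>))"
proof -
  let ?p = "CARD('p)"
  note p = prime_card[where 'a = 'p]
  note p1 = prime_card_gt_1[where 'p = 'p]
  obtain m where m: "\<rho> < real ?p ^ m" using real_arch_pow[OF p1] by blast
  obtain N where N: "(1 / real ?p) ^ N < \<delta>" using real_arch_pow_inv[OF assms, of "1 / real ?p"] p1 by auto
  define f :: "int \<Rightarrow> rat" where "f z = of_int z / of_nat ?p ^ m" for z
  define Z :: "'p padic set" where "Z = (\<lambda>z. of_rat (f z)) ` {0..<int ?p ^ (N + m)}"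
  have "\<exists>z\<in>Z. pnorm (z - x) \<le> \<delta>" if x: "pnorm x \<le> \<rho>" for x
  proof -
    have "x \<in> closure (range of_rat)" using of_rat_padic_dense[where 'p = 'p] by simp
    then obtain q where q: "dist (of_rat q) x < min \<delta> 1"
      using assms unfolding closure_approachable by (auto dest: spec[of _ "min \<delta> 1"])
    hence qx: "pnorm (of_rat q - x) < \<delta>" "pnorm (of_rat q - x) < 1" by (simp_all add: dist_padic_def)
    have "1 \<le> real ?p ^ m" by (rule one_le_power) (use p1 in linarith)
    hence "pnorm ((of_rat q - x) + x) \<le> real ?p ^ m"
      using qx x m by (intro pnorm_add_le) linarith+
    hence "rat_pnorm ?p q \<le> real ?p ^ m" by (simp add: pnorm_of_rat)
    hence "rat_pnorm ?p (q * of_nat ?p ^ m) \<le> real ?p ^ m * (1 / real ?p) ^ m"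
      unfolding rat_pnorm_mult[OF p] rat_pnorm_prime_power[OF p] by (intro mult_right_mono) auto
    also have "\<dots> = 1" using p1 by (simp add: power_one_over)
    finally obtain z where z: "z \<in> {0..<int ?p ^ (N + m)}"
      "rat_pnorm ?p (q * of_nat ?p ^ m - of_int z) \<le> (1 / real ?p) ^ (N + m)"
      using rat_pnorm_le_1_approx_int[OF p] by blast
    have "q * of_nat ?p ^ m - of_int z = (q - f z) * of_nat ?p ^ m"
      using p1 by (simp add: f_def field_simps)
    hence "rat_pnorm ?p (q - f z) * (1 / real ?p) ^ m \<le> (1 / real ?p) ^ N * (1 / real ?p) ^ m"
      using z(2) by (simp add: rat_pnorm_mult[OF p] rat_pnorm_prime_power[OF p] power_add)
    hence "rat_pnorm ?p (q - f z) \<le> (1 / real ?p) ^ N" using p1 by (simp add: mult_le_cancel_right)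
    hence "pnorm (of_rat (f z - q) :: 'p padic) \<le> \<delta>"
      using N rat_pnorm_commute[OF p, of q "f z"] by (simp add: pnorm_of_rat del: of_rat_diff)
    hence "pnorm ((of_rat (f z) - of_rat q) + (of_rat q - x)) \<le> \<delta>"
      using qx by (intro pnorm_add_le) (auto simp: of_rat_diff)
    thus ?thesis using z(1) by (auto simp: Z_def)
  qed
  thus ?thesis by (intro exI[of _ Z]) (auto simp: Z_def)
qed

lemma plane_balls_totally_bounded:
  fixes \<rho> \<delta> :: real
  assumes "0 < \<delta>"
  shows "\<exists>Y :: ('p::prime_card padic \<times> 'p padic) set. finite Y \<and>
     {l. plane_dist 0 l \<le> \<rho>} \<subseteq> (\<Union>y\<in>Y. {l. plane_dist y l \<le> \<delta>})"
proof -
  obtain Z :: "'p padic set" where Z: "finite Z" "\<And>x. pnorm x \<le> \<rho> \<Longrightarrow> \<exists>z\<in>Z. pnorm (z - x) \<le> \<delta>"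
    using padic_balls_totally_bounded[OF assms] by blast
  have "{l. plane_dist 0 l \<le> \<rho>} \<subseteq> (\<Union>y\<in>Z \<times> Z. {l. plane_dist y l \<le> \<delta>})"
  proof safe
    fix a b :: "'p padic" assume "plane_dist 0 (a, b) \<le> \<rho>"
    hence "pnorm a \<le> \<rho>" "pnorm b \<le> \<rho>" by (simp_all add: plane_dist_0)
    then obtain z w where "z \<in> Z" "w \<in> Z" "pnorm (z - a) \<le> \<delta>" "pnorm (w - b) \<le> \<delta>"
      using Z(2) by meson
    thus "(a, b) \<in> (\<Union>y\<in>Z \<times> Z. {l. plane_dist y l \<le> \<delta>})"
      by (intro UN_I[of "(z, w)"]) (auto simp: plane_dist_Pair)
  qed
  thus ?thesis by (intro exI[of _ "Z \<times> Z"] conjI finite_cartesian_product Z(1))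
qed

text \<open>
  The affine function \<open>h x = (a - a') * x + (b - b')\<close>, the vertical distance of the two lines, is of
  size at most \<open>R * \<delta>\<close> at \<open>x1\<close> and at \<open>x2\<close>. Its difference \<open>(a - a') * (x1 - x2)\<close> is as small, and
  so is \<open>(b - b') * (x1 - x2)\<close> up to another factor \<open>R\<close>; a last factor \<open>R\<close>, for the slope of \<open>l\<close>,
  passes from \<open>x1 - x2\<close> to the distance of the points.
\<close>

lemma line_incidence:
  fixes a b a' b' x1 x2 y1 y2 :: "'p::prime_card padic"
  assumes R: "1 \<le> R"
    and le: "pnorm a \<le> R" "pnorm a' \<le> R" "pnorm x1 \<le> R" "pnorm x2 \<le> R"
    and on: "y1 = a * x1 + b" "y2 = a * x2 + b" "y1' = a' * x1' + b'" "y2' = a' * x2' + b'"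
    and near: "pnorm (x1 - x1') \<le> \<delta>" "pnorm (y1 - y1') \<le> \<delta>" "pnorm (x2 - x2') \<le> \<delta>" "pnorm (y2 - y2') \<le> \<delta>"
  shows "max (pnorm (a - a')) (pnorm (b - b')) * max (pnorm (x1 - x2)) (pnorm (y1 - y2)) \<le> R ^ 3 * \<delta>"
proof -
  have \<delta>: "0 \<le> \<delta>" using near(1) pnorm_nonneg[of "x1 - x1'"] by linarith
  have R0: "0 \<le> R" using R by simp
  have small: "pnorm ((a - a') * x + (b - b')) \<le> R * \<delta>"
    if "pnorm (x - x') \<le> \<delta>" "pnorm (y - y') \<le> \<delta>" "y = a * x + b" "y' = a' * x' + b'" for x x' y y'
  proof -
    have "(a - a') * x + (b - b') = (y - y') - a' * (x - x')"
      unfolding that(3,4) by (simp add: algebra_simps)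
    moreover have "pnorm (a' * (x - x')) \<le> R * \<delta>"
      unfolding pnorm_mult using le that R0 by (intro mult_mono) auto
    moreover have "pnorm (y - y') \<le> R * \<delta>" using that(2) R \<delta> mult_right_mono[of 1 R \<delta>] by linarith
    ultimately show ?thesis using pnorm_sub_le[of "y - y'" "R * \<delta>" "a' * (x - x')"] by simp
  qed
  define h1 where "h1 = (a - a') * x1 + (b - b')"
  define h2 where "h2 = (a - a') * x2 + (b - b')"
  have h: "pnorm h1 \<le> R * \<delta>" "pnorm h2 \<le> R * \<delta>"
    unfolding h1_def h2_def by (rule small[OF near(1,2) on(1,3)], rule small[OF near(3,4) on(2,4)])
  have xR: "pnorm (x1 - x2) \<le> R" using le by (intro pnorm_sub_le)
  have "(a - a') * (x1 - x2) = h1 - h2" by (simp add: h1_def h2_def algebra_simps)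
  hence slope: "pnorm ((a - a') * (x1 - x2)) \<le> R * \<delta>"
    using pnorm_sub_le[OF h] by simp
  have "(b - b') * (x1 - x2) = h1 * (x1 - x2) - x1 * ((a - a') * (x1 - x2))"
    by (simp add: h1_def algebra_simps)
  moreover have "pnorm (h1 * (x1 - x2)) \<le> R * \<delta> * R"
    unfolding pnorm_mult using h xR R0 \<delta> by (intro mult_mono) auto
  moreover have "pnorm (x1 * ((a - a') * (x1 - x2))) \<le> R * (R * \<delta>)"
    unfolding pnorm_mult[of x1] by (rule mult_mono[OF le(3) slope R0 pnorm_nonneg])
  ultimately have shift: "pnorm (b - b') * pnorm (x1 - x2) \<le> R * (R * \<delta>)"
    using pnorm_sub_le[of "h1 * (x1 - x2)" "R * (R * \<delta>)" "x1 * ((a - a') * (x1 - x2))"]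
    by (simp add: mult_ac flip: pnorm_mult)
  define m where "m = max (pnorm (a - a')) (pnorm (b - b'))"
  have m0: "0 \<le> m" by (simp add: m_def le_max_iff_disj)
  have "R * \<delta> \<le> R * (R * \<delta>)" using R \<delta> mult_right_mono[of 1 R "R * \<delta>"] by simp
  hence mx: "m * pnorm (x1 - x2) \<le> R * (R * \<delta>)"
    using slope shift by (auto simp: m_def max_def pnorm_mult)
  have "y1 - y2 = a * (x1 - x2)" unfolding on by (simp add: algebra_simps)
  hence "pnorm (y1 - y2) \<le> R * pnorm (x1 - x2)"
    using le(1) by (simp add: pnorm_mult mult_right_mono)
  moreover have "pnorm (x1 - x2) \<le> R * pnorm (x1 - x2)"
    using R mult_right_mono[of 1 R "pnorm (x1 - x2)"] by simp
  ultimately have "max (pnorm (x1 - x2)) (pnorm (y1 - y2)) \<le> R * pnorm (x1 - x2)" by simp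
  hence "m * max (pnorm (x1 - x2)) (pnorm (y1 - y2)) \<le> m * (R * pnorm (x1 - x2))"
    using m0 by (rule mult_left_mono)
  also have "\<dots> = R * (m * pnorm (x1 - x2))" by simp
  also have "\<dots> \<le> R * (R * (R * \<delta>))" using mx R0 by (rule mult_left_mono)
  finally show ?thesis by (simp add: m_def power3_eq_cube mult_ac)
qed

lemma incidence_bound_graphs:
  assumes "1 \<le> R"
  shows "incidence_bound plane_dist plane_dist (\<lambda>(a, b). {(x, y). y = a * x + b})
    (0 :: 'p::prime_card padic \<times> 'p padic) 0 R (R ^ 3)"
  unfolding incidence_bound_def
proof (intro allI impI, goal_cases)
  case (1 \<delta> l l' u v u' v')
  obtain a b a' b' x1 y1 x2 y2 x1' y1' x2' y2' where eq: "l = (a, b)" "l' = (a', b')"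
    "u = (x1, y1)" "v = (x2, y2)" "u' = (x1', y1')" "v' = (x2', y2')"
    by (cases l, cases l', cases u, cases v, cases u', cases v')
  note h = 1[unfolded eq plane_dist_0 plane_dist_Pair mem_Collect_eq case_prod_conv max.bounded_iff]
  show ?case
    unfolding eq plane_dist_Pair
    by (rule line_incidence[OF assms, where ?x1' = x1' and ?x2' = x2' and ?y1' = y1' and ?y2' = y2'])
      (use h in blast)+
qed

lemma incidence_bound_cographs:
  assumes "1 \<le> R"
  shows "incidence_bound plane_dist plane_dist (\<lambda>(a, b). {(x, y). x = a * y + b})
    (0 :: 'p::prime_card padic \<times> 'p padic) 0 R (R ^ 3)"
  unfolding incidence_bound_def
proof (intro allI impI, goal_cases)
  case (1 \<delta> l l' u v u' v')
  obtain a b a' b' x1 y1 x2 y2 x1' y1' x2' y2' where eq: "l = (a, b)" "l' = (a', b')"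
    "u = (y1, x1)" "v = (y2, x2)" "u' = (y1', x1')" "v' = (y2', x2')"
    by (cases l, cases l', cases u, cases v, cases u', cases v')
  note h = 1[unfolded eq plane_dist_0 plane_dist_Pair mem_Collect_eq case_prod_conv max.bounded_iff]
  show ?case
    unfolding eq plane_dist_Pair max.commute[of "pnorm (y1 - y2)"]
    by (rule line_incidence[OF assms, where ?x1' = x1' and ?x2' = x2' and ?y1' = y1' and ?y2' = y2'])
      (use h in blast)+
qed

text \<open>
  If the dimension of \<open>E\<close> were less than \<open>s + t\<close>, there would be room for the slightly smaller exponents
  \<open>s - \<epsilon>\<close> and \<open>t - \<epsilon>\<close>, in which the slices and one of the two parameter sets have
  positive content; this contradicts \<open>furstenberg_lines_null\<close>.
\<close>

theorem furstenberg_dim_ge: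
  fixes E :: "('p::prime_card padic \<times> 'p padic) set"
  assumes st: "0 < t" "t \<le> s" and E: "furstenberg_set s t E"
  shows "ennreal (s + t) \<le> hausdorff_dim plane_dist E"
proof (rule hausdorff_dim_geI)
  interpret P: ultrametric "plane_dist :: 'p padic \<times> 'p padic \<Rightarrow> _" by (rule ultrametric_plane_dist)
  fix r0 :: real assume r0: "0 \<le> r0" "r0 < s + t"
  show "hausdorff_measure plane_dist r0 E \<noteq> 0"
  proof
    assume null0: "hausdorff_measure plane_dist r0 E = 0"
    \<comment> \<open>in exponent 0 only the empty set is null, and it is null in every exponent\<close>
    obtain r where r: "0 < r" "r < s + t" "hausdorff_measure plane_dist r E = 0"
    proof (cases "r0 = 0")
      case True
      hence "E = {}" using null0 hausdorff_measure_0_exponent_0_empty by auto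
      thus thesis using that[of "(s + t) / 2"] st by simp
    next
      case False
      thus thesis using that[of r0] r0 null0 by simp
    qed
    define \<epsilon> where "\<epsilon> = min (t / 2) ((s + t - r) / 4)"
    have \<epsilon>: "0 < \<epsilon>" "\<epsilon> < t" "2 * \<epsilon> < s + t - r" using r st by (auto simp: \<epsilon>_def min_def field_simps)
    obtain L where L: "ennreal t \<le> line_family_dim L" "\<And>l. l \<in> L \<Longrightarrow> ennreal s \<le> hausdorff_dim plane_dist (E \<inter> l)"
      using E by (auto simp: furstenberg_set_def)
    have null: "ball_content plane_dist (t - \<epsilon>) {l. Line l \<in> L} = 0"
      if inc: "\<And>R. 1 \<le> R \<Longrightarrow> incidence_bound plane_dist plane_dist Line (0 :: 'p padic \<times> 'p padic) 0 R (R ^ 3)"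
      for Line :: "'p padic \<times> 'p padic \<Rightarrow> _"
    proof (rule furstenberg_lines_null[OF ultrametric_plane_dist ultrametric_plane_dist, where s = "s - \<epsilon>" and r = r
          and E = E and Line = Line and ?p0.0 = 0 and ?l0.0 = 0])
      show "\<exists>C\<ge>0. incidence_bound plane_dist plane_dist Line 0 0 R C" if "1 \<le> R" for R
        using inc[OF that] that by (intro exI[of _ "R ^ 3"]) auto
      show "ball_content plane_dist (s - \<epsilon>) (E \<inter> Line l) \<noteq> 0" if "l \<in> {l. Line l \<in> L}" for l
        using that \<epsilon> st by (intro P.ball_content_nonzero_below_dim[OF L(2)]) auto
      show "\<exists>b k. (\<forall>i::nat. K \<le> k i) \<and> E \<subseteq> (\<Union>i. {u. plane_dist (b i) u \<le> (1/2) ^ k i})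
        \<and> (\<Sum>i. ennreal (((1/2) ^ k i) powr r)) \<le> 1" for K
        by (rule P.dyadic_cover_if_hausdorff_measure_0[OF r(1,3)])
      show "0 < t - \<epsilon>" "t - \<epsilon> \<le> s - \<epsilon>" "r < s - \<epsilon> + (t - \<epsilon>)" using \<epsilon> st by auto
    qed (rule plane_balls_totally_bounded)
    have "{(a, b). {(x, y). y = a * x + b} \<in> L} = {l. (\<lambda>(a, b). {(x, y). y = a * x + b}) l \<in> L}"
      "{(a, b). {(x, y). x = a * y + b} \<in> L} = {l. (\<lambda>(a, b). {(x, y). x = a * y + b}) l \<in> L}" by auto
    hence "ball_content plane_dist (t - \<epsilon>) {(a, b). {(x, y). y = a * x + b} \<in> L} = 0"
      "ball_content plane_dist (t - \<epsilon>) {(a, b). {(x, y). x = a * y + b} \<in> L} = 0"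
      using null[OF incidence_bound_graphs] null[OF incidence_bound_cographs] by simp_all
    thus False
      using L(1) \<epsilon> P.ball_content_nonzero_below_dim[of t _ "t - \<epsilon>"]
      by (auto simp: line_family_dim_def le_max_iff_disj)
  qed
qed

section \<open>A product of Cantor sets\<close>

text \<open>
  The mass distribution principle for the image of Lebesgue measure under \<open>h\<close>: the preimage of a set
  \<open>U\<close> lies in an interval of length comparable to \<open>diam U powr u\<close>, and the preimages of the sets of a
  cover have to fill an interval of length 1. Passing to intervals makes this work for arbitrary
  \<open>h\<close>.
\<close>

lemma mass_distribution:
  fixes h :: "real \<Rightarrow> 'a"
  assumes d: "ultrametric d" and u: "0 < u" and C: "0 < C"
    and hoelder: "\<And>x y. x \<in> {0..<1} \<Longrightarrow> y \<in> {0..<1} \<Longrightarrow> \<bar>x - y\<bar> \<le> C * d (h x) (h y) powr u"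
  shows "ennreal u \<le> hausdorff_dim d (h ` {0..<1})"
proof (rule hausdorff_dim_geI)
  interpret ultrametric d by (rule d)
  fix r :: real assume r: "0 \<le> r" "r < u"
  show "hausdorff_measure d r (h ` {0..<1}) \<noteq> 0"
  proof
    assume "hausdorff_measure d r (h ` {0..<1}) = 0"
    hence "hausdorff_pre d r 1 (h ` {0..<1}) < ennreal (1 / (2 * C))"
      using hausdorff_pre_le_measure[of 1 d r "h ` {0..<1}"] C by simp
    then obtain U where U: "delta_cover d 1 (h ` {0..<1}) U"
      and cost: "(\<Sum>i. ennreal (diam_power d r (U i))) < ennreal (1 / (2 * C))"
      unfolding hausdorff_pre_def by (auto simp: INF_less_iff)
    have U1: "d x y \<le> 1" if "x \<in> U i" "y \<in> U i" for x y i
      using U that by (simp add: delta_cover_def)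
    \<comment> \<open>centred at a point of the preimage, hence the factor 2\<close>
    have "\<exists>I. I \<in> sets lborel \<and> {x\<in>{0..<1}. h x \<in> U i} \<subseteq> I
        \<and> emeasure lborel I \<le> ennreal (2 * C) * ennreal (diam_power d r (U i))" for i
    proof (cases "{x\<in>{0..<1}. h x \<in> U i} = {}")
      case True
      thus ?thesis by (intro exI[of _ "{}"]) auto
    next
      case False
      then obtain x0 where x0: "x0 \<in> {0..<1}" "h x0 \<in> U i" by auto
      define D where "D = diam d (U i)"
      define l where "l = C * diam_power d r (U i)"
      have D: "0 \<le> D" "D \<le> 1"
        unfolding D_def by (rule diam_nonneg[OF U1], assumption+, rule diam_le[OF U1], auto)
      have Dr: "D powr u \<le> diam_power d r (U i)"
      proof (cases "r = 0")
        case True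
        thus ?thesis using x0 D u by (auto simp: diam_power_def intro: powr_le1)
      next
        case False
        thus ?thesis using x0 D r by (auto simp: diam_power_def D_def[symmetric] intro: powr_mono')
      qed
      have "x0 - l \<le> x \<and> x \<le> x0 + l" if x: "x \<in> {0..<1}" "h x \<in> U i" for x
      proof -
        have "d (h x0) (h x) \<le> D" unfolding D_def using x0 x by (intro dist_le_diam[where U = "U i" and \<delta> = 1] U1)
        hence "d (h x0) (h x) powr u \<le> D powr u" using u nonneg by (intro powr_mono2) auto
        hence "C * d (h x0) (h x) powr u \<le> l" using Dr C by (simp add: l_def)
        thus ?thesis using hoelder[OF x0(1) x(1)] by linarith
      qed
      hence "{x\<in>{0..<1}. h x \<in> U i} \<subseteq> {x0 - l..x0 + l}" by auto
      moreover have "0 \<le> diam_power d r (U i)" by (simp add: diam_power_def)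
      hence "emeasure lborel {x0 - l..x0 + l} = ennreal (2 * C) * ennreal (diam_power d r (U i))"
        using C by (simp add: l_def ennreal_mult[symmetric] mult_ac)
      ultimately show ?thesis by (intro exI[of _ "{x0 - l..x0 + l}"]) auto
    qed
    hence "\<forall>i. \<exists>I. I \<in> sets lborel \<and> {x\<in>{0..<1}. h x \<in> U i} \<subseteq> I
        \<and> emeasure lborel I \<le> ennreal (2 * C) * ennreal (diam_power d r (U i))" ..
    from choice[OF this] obtain I where I: "\<And>i. I i \<in> sets lborel"
        "\<And>i. {x\<in>{0..<1}. h x \<in> U i} \<subseteq> I i"
        "\<And>i. emeasure lborel (I i) \<le> ennreal (2 * C) * ennreal (diam_power d r (U i))"
      by blast
    have "{0..<1} \<subseteq> (\<Union>i. I i)"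
    proof
      fix x :: real assume x: "x \<in> {0..<1}"
      hence "h x \<in> (\<Union>i. U i)" using U unfolding delta_cover_def by blast
      then obtain i where "h x \<in> U i" by blast
      thus "x \<in> (\<Union>i. I i)" using I(2)[of i] x by blast
    qed
    hence "emeasure lborel {0..<1::real} \<le> emeasure lborel (\<Union>i. I i)"
      using I(1) by (intro emeasure_mono sets.countable_UN) auto
    also have "\<dots> \<le> (\<Sum>i. emeasure lborel (I i))"
      using I(1) by (intro emeasure_subadditive_countably) auto
    also have "\<dots> \<le> (\<Sum>i. ennreal (2 * C) * ennreal (diam_power d r (U i)))"
      using I(3) by (intro suminf_le) auto
    also have "\<dots> = ennreal (2 * C) * (\<Sum>i. ennreal (diam_power d r (U i)))" by simp
    also have "\<dots> < ennreal (2 * C) * ennreal (1 / (2 * C))"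
      using cost C by (intro ennreal_mult_strict_left_mono) auto
    also have "\<dots> = 1" using C by (subst ennreal_mult[symmetric]) auto
    finally show False by simp
  qed
qed

text \<open>
  How many of the first \<open>n\<close> digits of a point of the Cantor set are free.
\<close>

definition free_digits :: "real \<Rightarrow> nat \<Rightarrow> nat" where
  "free_digits u n = nat \<lfloor>real n * u\<rfloor>"

text \<open>
  The first \<open>free_digits u n\<close> digits of \<open>x \<in> [0, 1)\<close> to the base \<open>p\<close>, read as one integer.
\<close>

definition cell :: "nat \<Rightarrow> real \<Rightarrow> nat \<Rightarrow> real \<Rightarrow> int" where
  "cell p u n x = \<lfloor>real p ^ free_digits u n * x\<rfloor>"

text \<open>
  The next digit of \<open>x\<close> if the position \<open>n\<close> is free, and 0 otherwise: then \<open>free_digits\<close>, and with it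
  \<open>cell\<close>, does not change from \<open>n\<close> to \<open>Suc n\<close>.
\<close>

definition cantor_digit :: "nat \<Rightarrow> real \<Rightarrow> nat \<Rightarrow> real \<Rightarrow> int" where
  "cantor_digit p u n x = cell p u (Suc n) x - int p ^ (free_digits u (Suc n) - free_digits u n) * cell p u n x"

definition cantor_trunc :: "nat \<Rightarrow> real \<Rightarrow> nat \<Rightarrow> real \<Rightarrow> int" where
  "cantor_trunc p u N x = (\<Sum>n<N. cantor_digit p u n x * int p ^ n)"

lemma free_digits_bounds:
  assumes "0 \<le> u"
  shows "real (free_digits u n) \<le> real n * u" "real n * u < real (free_digits u n) + 1"
  using assms by (auto simp: free_digits_def of_nat_nat)

lemma free_digits_Suc:
  assumes "0 \<le> u" "u \<le> 1"
  shows "free_digits u n \<le> free_digits u (Suc n)" "free_digits u (Suc n) \<le> Suc (free_digits u n)"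
proof -
  have "real n * u \<le> real (Suc n) * u" "real (Suc n) * u \<le> real n * u + 1"
    using assms by (auto simp: algebra_simps)
  hence "\<lfloor>real n * u\<rfloor> \<le> \<lfloor>real (Suc n) * u\<rfloor>" "\<lfloor>real (Suc n) * u\<rfloor> \<le> \<lfloor>real n * u\<rfloor> + 1"
    by linarith+
  thus "free_digits u n \<le> free_digits u (Suc n)" "free_digits u (Suc n) \<le> Suc (free_digits u n)"
    unfolding free_digits_def by (auto intro: nat_mono simp: nat_le_eq_zle)
qed

lemma cantor_digit_bounds:
  fixes n :: nat
  assumes p: "0 < p" and u: "0 \<le> u" "u \<le> 1"
  defines "q \<equiv> int p ^ (free_digits u (Suc n) - free_digits u n)"
  shows "0 \<le> cantor_digit p u n x" "cantor_digit p u n x < q" "q \<le> int p"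
proof -
  define k where "k = free_digits u (Suc n) - free_digits u n"
  define y where "y = real p ^ free_digits u n * x"
  have k: "free_digits u (Suc n) = free_digits u n + k" "k \<le> 1"
    using free_digits_Suc[OF u, of n] by (auto simp: k_def)
  have q: "q = int p ^ k" by (simp add: q_def k_def)
  have q0: "0 < q" using p by (simp add: q)
  have c: "cell p u (Suc n) x = \<lfloor>real_of_int q * y\<rfloor>" "cell p u n x = \<lfloor>y\<rfloor>"
    by (simp_all add: cell_def y_def k q power_add mult_ac)
  have "real_of_int q * real_of_int \<lfloor>y\<rfloor> \<le> real_of_int q * y" using q0 by (intro mult_left_mono) auto
  hence "q * \<lfloor>y\<rfloor> \<le> \<lfloor>real_of_int q * y\<rfloor>" by (simp add: le_floor_iff)
  thus "0 \<le> cantor_digit p u n x" by (simp add: cantor_digit_def c q_def)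
  have "real_of_int q * y < real_of_int q * (real_of_int \<lfloor>y\<rfloor> + 1)" using q0 by (intro mult_strict_left_mono) linarith+
  hence "\<lfloor>real_of_int q * y\<rfloor> < q * (\<lfloor>y\<rfloor> + 1)" by (simp add: floor_less_iff)
  thus "cantor_digit p u n x < q" by (simp add: cantor_digit_def c algebra_simps flip: q_def)
  have "int p ^ k \<le> int p ^ 1" using k(2) p by (intro power_increasing) auto
  thus "q \<le> int p" by (simp add: q)
qed

lemma cell_Suc:
  "cell p u (Suc n) x = int p ^ (free_digits u (Suc n) - free_digits u n) * cell p u n x + cantor_digit p u n x"
  by (simp add: cantor_digit_def)

lemma cantor_trunc_bounds:
  assumes "0 < p" "0 \<le> u" "u \<le> 1"
  shows "0 \<le> cantor_trunc p u N x \<and> cantor_trunc p u N x < int p ^ N"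
proof (induction N)
  case 0
  show ?case by (simp add: cantor_trunc_def)
next
  case (Suc N)
  have d: "0 \<le> cantor_digit p u N x" "cantor_digit p u N x \<le> int p - 1"
    using cantor_digit_bounds(1)[OF assms, of N x]
      less_le_trans[OF cantor_digit_bounds(2)[OF assms, of N x] cantor_digit_bounds(3)[OF assms, of N]] by auto
  have "cantor_digit p u N x * int p ^ N \<le> (int p - 1) * int p ^ N"
    using d by (intro mult_right_mono) auto
  moreover have "0 \<le> cantor_digit p u N x * int p ^ N" using d by simp
  ultimately show ?case using Suc by (simp add: cantor_trunc_def algebra_simps)
qed

text \<open>
  Either side determines the digits below the position \<open>N\<close>: division with remainder recovers the
  last digit and the preceding stage from the truncation and from the cell alike.
\<close>

lemma cantor_trunc_eq_iff:
  assumes p: "0 < p" and u: "0 \<le> u" "u \<le> 1" and xy: "x \<in> {0..<1}" "y \<in> {0..<1}"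
  shows "cantor_trunc p u N x = cantor_trunc p u N y \<longleftrightarrow> cell p u N x = cell p u N y"
proof (induction N)
  case 0
  have "\<lfloor>x\<rfloor> = 0" "\<lfloor>y\<rfloor> = 0" using xy by (auto simp: floor_eq_iff)
  thus ?case by (simp add: cantor_trunc_def cell_def free_digits_def)
next
  case (Suc N)
  define q where "q = int p ^ (free_digits u (Suc N) - free_digits u N)"
  have suc: "cantor_trunc p u (Suc N) z = cantor_trunc p u N z + int p ^ N * cantor_digit p u N z" for z
    by (simp add: cantor_trunc_def)
  have mod: "cantor_trunc p u (Suc N) z mod int p ^ N = cantor_trunc p u N z"
    and dv: "cantor_trunc p u (Suc N) z div int p ^ N = cantor_digit p u N z" for z
    using cantor_trunc_bounds[OF p u, of N z] p unfolding suc by (simp_all add: div_pos_pos_trivial)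
  have cs: "cell p u (Suc N) z = q * cell p u N z + cantor_digit p u N z" for z
    by (simp add: cell_Suc q_def)
  have cdiv: "cell p u (Suc N) z div q = cell p u N z" for z
    using cantor_digit_bounds(1,2)[OF p u, of N z] p unfolding cs by (simp add: q_def div_pos_pos_trivial)
  show ?case
  proof
    assume eq: "cantor_trunc p u (Suc N) x = cantor_trunc p u (Suc N) y"
    hence "cantor_trunc p u N x = cantor_trunc p u N y" "cantor_digit p u N x = cantor_digit p u N y"
      using mod dv by metis+
    thus "cell p u (Suc N) x = cell p u (Suc N) y" using Suc by (simp add: cs)
  next
    assume eq: "cell p u (Suc N) x = cell p u (Suc N) y"
    hence c: "cell p u N x = cell p u N y" using cdiv by metis
    hence "cantor_digit p u N x = cantor_digit p u N y" using eq by (simp add: cs)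
    thus "cantor_trunc p u (Suc N) x = cantor_trunc p u (Suc N) y" using Suc c by (simp add: suc)
  qed
qed

lemma rat_pnorm_of_int_le_iff:
  assumes p: "prime p"
  shows "rat_pnorm p (of_int z) \<le> (1 / real p) ^ N \<longleftrightarrow> int p ^ N dvd z"
proof (cases "z = 0")
  case False
  have p1: "1 < real p" using prime_gt_1_nat[OF p] by simp
  have v: "rat_pval p (of_int z) = int (multiplicity (int p) z)" by (simp add: rat_pval_def)
  have "rat_pnorm p (of_int z) = (1 / real p) ^ multiplicity (int p) z"
    using False by (simp add: rat_pnorm_def v power_int_minus power_one_over inverse_eq_divide)
  moreover have "(1 / real p) ^ multiplicity (int p) z \<le> (1 / real p) ^ N \<longleftrightarrow> N \<le> multiplicity (int p) z"
    using p1 by (intro power_decreasing_iff) auto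
  moreover have "N \<le> multiplicity (int p) z \<longleftrightarrow> int p ^ N dvd z"
    using False p1 by (intro power_dvd_iff_le_multiplicity[symmetric]) auto
  ultimately show ?thesis by simp
qed simp

lemma cantor_trunc_cong:
  assumes "N \<le> M"
  shows "int p ^ N dvd cantor_trunc p u M x - cantor_trunc p u N x"
  using assms
proof (induction M rule: dec_induct)
  case (step M)
  have "int p ^ N dvd cantor_digit p u M x * int p ^ M"
    using step by (intro dvd_mult le_imp_power_dvd) auto
  hence "int p ^ N dvd (cantor_trunc p u M x - cantor_trunc p u N x) + cantor_digit p u M x * int p ^ M"
    using step by (intro dvd_add) auto
  thus ?case by (simp add: cantor_trunc_def algebra_simps)
qed simp

definition cantor_point :: "real \<Rightarrow> real \<Rightarrow> 'p::prime_card padic" where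
  "cantor_point u x = Padic (\<lambda>N. of_int (cantor_trunc CARD('p) u N x))"

lemma pcauchy_cantor_trunc:
  assumes p: "prime p"
  shows "pcauchy p (\<lambda>N. of_int (cantor_trunc p u N x))"
  unfolding pcauchy_def
proof (intro allI impI)
  fix e :: real assume "0 < e"
  moreover have p1: "1 < real p" using prime_gt_1_nat[OF p] by simp
  ultimately obtain K where K: "(1 / real p) ^ K < e"
    using real_arch_pow_inv[of e "1 / real p"] by auto
  have "rat_pnorm p (of_int (cantor_trunc p u m x) - of_int (cantor_trunc p u n x)) < e"
    if "K \<le> m" "K \<le> n" for m n
  proof -
    have "int p ^ K dvd (cantor_trunc p u m x - cantor_trunc p u K x) - (cantor_trunc p u n x - cantor_trunc p u K x)"
      using that by (intro dvd_diff cantor_trunc_cong)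
    hence "int p ^ K dvd cantor_trunc p u m x - cantor_trunc p u n x" by simp
    hence "rat_pnorm p (of_int (cantor_trunc p u m x - cantor_trunc p u n x)) \<le> (1 / real p) ^ K"
      using rat_pnorm_of_int_le_iff[OF p] by blast
    thus ?thesis using K by simp
  qed
  thus "\<exists>k. \<forall>m\<ge>k. \<forall>n\<ge>k. rat_pnorm p (of_int (cantor_trunc p u m x) - of_int (cantor_trunc p u n x)) < e"
    by blast
qed

lemma cantor_point_approx:
  "pnorm (cantor_point u x - of_rat (of_int (cantor_trunc CARD('p) u N x)) :: 'p::prime_card padic)
     \<le> (1 / real CARD('p)) ^ N"
proof -
  note p = prime_card[where 'a = 'p]
  let ?X = "\<lambda>M. of_int (cantor_trunc CARD('p) u M x) :: rat"
  have c: "pcauchy CARD('p) ?X" "pcauchy CARD('p) (\<lambda>_. ?X N)"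
    using pcauchy_cantor_trunc[OF p] pcauchy_const[OF p] by auto
  have eq: "(cantor_point u x - of_rat (?X N) :: 'p padic) = Padic (\<lambda>M. ?X M - ?X N)"
    unfolding cantor_point_def of_rat_padic by (rule minus_Padic[OF c])
  have lim: "(\<lambda>M. rat_pnorm CARD('p) (?X M - ?X N)) \<longlonglongrightarrow> pnorm (Padic (\<lambda>M. ?X M - ?X N) :: 'p padic)"
    by (rule pnorm_tendsto[OF pcauchy_diff[OF p c]])
  have "rat_pnorm CARD('p) (?X M - ?X N) \<le> (1 / real CARD('p)) ^ N" if "N \<le> M" for M
    using rat_pnorm_of_int_le_iff[OF p, of "cantor_trunc CARD('p) u M x - cantor_trunc CARD('p) u N x" N]
      cantor_trunc_cong[OF that] by simp
  thus ?thesis unfolding eq by (intro LIMSEQ_le_const2[OF lim]) blast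
qed

text \<open>
  The \<open>p\<close>-adic ball of level \<open>N\<close> around a Cantor point corresponds to an interval of length
  \<open>p ^ - free_digits u N\<close> on the line. Both the dimension bound from below and the covering from above
  rest on this.
\<close>

lemma pnorm_cantor_point_le_iff:
  assumes u: "0 \<le> u" "u \<le> 1" and xy: "x \<in> {0..<1}" "y \<in> {0..<1}"
  shows "pnorm (cantor_point u x - cantor_point u y :: 'p::prime_card padic) \<le> (1 / real CARD('p)) ^ N
    \<longleftrightarrow> cell CARD('p) u N x = cell CARD('p) u N y"
proof -
  let ?p = "CARD('p)"
  note p = prime_card[where 'a = 'p]
  have p0: "0 < ?p" using prime_gt_0_nat[OF p] .
  define a where "a z = cantor_trunc ?p u N z" for z
  define b :: "real \<Rightarrow> 'p padic" where "b z = of_rat (of_int (a z))" for z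
  define \<delta> where "\<delta> = (1 / real ?p) ^ N"
  have near: "pnorm (cantor_point u z - b z) \<le> \<delta>" "pnorm (b z - cantor_point u z) \<le> \<delta>" for z
    using cantor_point_approx[of u z N, where 'p = 'p] pnorm_diff_commute[of "b z" "cantor_point u z"]
    by (simp_all add: b_def a_def \<delta>_def)
  have bb: "pnorm (b x - b y) \<le> \<delta> \<longleftrightarrow> int ?p ^ N dvd a x - a y"
  proof -
    have "b x - b y = of_rat (of_int (a x - a y))" by (simp add: b_def of_rat_diff)
    hence "pnorm (b x - b y) = rat_pnorm ?p (of_int (a x - a y))" by (simp only: pnorm_of_rat)
    thus ?thesis unfolding \<delta>_def by (simp only: rat_pnorm_of_int_le_iff[OF p])
  qed
  have "pnorm (cantor_point u x - cantor_point u y :: 'p padic) \<le> \<delta> \<longleftrightarrow> pnorm (b x - b y) \<le> \<delta>"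
  proof
    assume "pnorm (cantor_point u x - cantor_point u y :: 'p padic) \<le> \<delta>"
    hence "pnorm ((b x - cantor_point u x) + (cantor_point u x - cantor_point u y) + (cantor_point u y - b y)) \<le> \<delta>"
      using near by (intro pnorm_add_le) auto
    thus "pnorm (b x - b y) \<le> \<delta>" by simp
  next
    assume "pnorm (b x - b y) \<le> \<delta>"
    hence "pnorm ((cantor_point u x - b x) + (b x - b y) + (b y - cantor_point u y)) \<le> \<delta>"
      using near by (intro pnorm_add_le) auto
    thus "pnorm (cantor_point u x - cantor_point u y :: 'p padic) \<le> \<delta>" by simp
  qed
  also have "\<dots> \<longleftrightarrow> a x = a y"
  proof
    assume "pnorm (b x - b y) \<le> \<delta>"
    hence "int ?p ^ N dvd a x - a y" using bb by simp
    hence "a x mod int ?p ^ N = a y mod int ?p ^ N" by (simp add: mod_eq_dvd_iff)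
    thus "a x = a y" using cantor_trunc_bounds[OF p0 u, of N] by (simp add: a_def)
  qed (use bb in simp)
  also have "\<dots> \<longleftrightarrow> cell ?p u N x = cell ?p u N y"
    unfolding a_def by (rule cantor_trunc_eq_iff[OF p0 u xy])
  finally show ?thesis by (simp add: \<delta>_def)
qed

lemma same_cell_close:
  assumes p: "1 < p" and u: "0 \<le> u" and eq: "cell p u N x = cell p u N y"
  shows "\<bar>x - y\<bar> \<le> real p * ((1 / real p) ^ N) powr u"
proof -
  define q where "q = real p ^ free_digits u N"
  have q: "0 < q" using p by (simp add: q_def)
  have "\<bar>q * x - q * y\<bar> < 1" using eq unfolding cell_def q_def by linarith
  hence "q * \<bar>x - y\<bar> < 1" using q by (simp add: abs_mult flip: right_diff_distrib)
  hence "\<bar>x - y\<bar> \<le> 1 / q" using q by (simp add: field_simps)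
  also have "\<dots> = real p powr (- real (free_digits u N))"
    using p by (simp add: q_def powr_minus powr_realpow inverse_eq_divide)
  also have "\<dots> \<le> real p powr (1 - real N * u)"
    using free_digits_bounds(2)[OF u, of N] p by (intro powr_mono) auto
  also have "\<dots> = real p * ((1 / real p) ^ N) powr u"
  proof -
    have "(1 / real p) ^ N = real p powr (- real N)"
      using p by (simp add: powr_minus powr_realpow power_one_over inverse_eq_divide)
    thus ?thesis using p by (simp only: powr_powr) (simp add: powr_diff powr_minus divide_inverse)
  qed
  finally show ?thesis .
qed

text \<open>
  With \<open>D\<close> the distance of the two points and \<open>N\<close> maximal such that \<open>D \<le> p ^ - N\<close>, the cells of level
  \<open>N\<close> agree. One factor \<open>p\<close> of the constant comes from rounding \<open>N * u\<close>, the other from rounding \<open>D\<close>.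
\<close>

lemma cantor_point_hoelder:
  assumes u: "0 < u" "u \<le> 1" and xy: "x \<in> {0..<1}" "y \<in> {0..<1}"
  shows "\<bar>x - y\<bar> \<le> (real CARD('p))\<^sup>2 * pnorm (cantor_point u x - cantor_point u y :: 'p::prime_card padic) powr u"
proof -
  let ?p = "CARD('p)"
  define D where "D = pnorm (cantor_point u x - cantor_point u y :: 'p padic)"
  define z where "z = 1 / real ?p"
  have p1: "1 < ?p" using prime_gt_1_nat[OF prime_card[where 'a = 'p]] .
  have z: "0 < z" "z < 1" using p1 by (simp_all add: z_def)
  have iff: "D \<le> z ^ N \<longleftrightarrow> cell ?p u N x = cell ?p u N y" for N
    unfolding D_def z_def using u xy by (intro pnorm_cantor_point_le_iff) auto
  have close: "\<bar>x - y\<bar> \<le> real ?p * (z ^ N) powr u" if "D \<le> z ^ N" for N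
    unfolding z_def using same_cell_close[OF p1, of u N x y] u iff that by simp
  have D0: "0 \<le> D" by (simp add: D_def)
  have "\<lfloor>x\<rfloor> = 0" "\<lfloor>y\<rfloor> = 0" using xy by (auto simp: floor_eq_iff)
  hence D1: "D \<le> z ^ 0" unfolding iff by (simp add: cell_def free_digits_def)
  show ?thesis
  proof (cases "D = 0")
    case True
    have "\<bar>x - y\<bar> \<le> 0 + e" if e: "0 < e" for e
    proof -
      have "z powr u < 1" using z u powr_less_mono2[of u z 1] by simp
      moreover have "0 < e / real ?p" using e p1 by simp
      ultimately obtain N where N: "(z powr u) ^ N < e / real ?p"
        using real_arch_pow_inv by blast
      have "(z ^ N) powr u = (z powr u) ^ N"
        using z by (simp add: powr_powr mult.commute flip: powr_realpow)
      moreover have "\<bar>x - y\<bar> \<le> real ?p * (z ^ N) powr u" using True z by (intro close) simp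
      ultimately show ?thesis using N p1 by (simp add: field_simps)
    qed
    hence "\<bar>x - y\<bar> \<le> 0" by (rule field_le_epsilon)
    thus ?thesis by simp
  next
    case False
    hence Dp: "0 < D" using D0 by simp
    then obtain n0 where n0: "z ^ n0 < D" using real_arch_pow_inv z by blast
    define n where "n = (LEAST n. z ^ n < D)"
    have n: "z ^ n < D" unfolding n_def by (rule LeastI) (rule n0)
    obtain N where N: "n = Suc N" using n D1 by (cases n) auto
    have "\<not> z ^ N < D" using N not_less_Least[of N "\<lambda>n. z ^ n < D"] by (simp add: n_def)
    hence "\<bar>x - y\<bar> \<le> real ?p * (z ^ N) powr u" by (intro close) simp
    also have "(z ^ N) powr u \<le> (real ?p * D) powr u"
      using n z u p1 by (intro powr_mono2) (auto simp: N z_def field_simps)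
    also have "(real ?p * D) powr u = real ?p powr u * D powr u" using Dp by (simp add: powr_mult)
    also have "real ?p powr u \<le> real ?p" using powr_mono[of u 1 "real ?p"] u p1 by simp
    finally show ?thesis using p1 by (simp add: D_def power2_eq_square mult_left_mono mult_right_mono mult.assoc)
  qed
qed

definition cantor_set :: "real \<Rightarrow> 'p::prime_card padic set" where
  "cantor_set u = cantor_point u ` {0..<1}"

lemma dim_cantor_slices:
  fixes c :: "'p::prime_card padic"
  assumes u: "0 < u" "u \<le> 1"
  shows "ennreal u \<le> hausdorff_dim plane_dist (cantor_set u \<times> {c})"
    and "ennreal u \<le> hausdorff_dim plane_dist ({c} \<times> cantor_set u)"
proof -
  have p0: "0 < (real CARD('p))\<^sup>2" using prime_card_gt_1[where 'p = 'p] by simp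
  have eq: "cantor_set u \<times> {c} = (\<lambda>x. (cantor_point u x, c)) ` {0..<1}"
    "{c} \<times> cantor_set u = (\<lambda>x. (c, cantor_point u x)) ` {0..<1}" by (auto simp: cantor_set_def)
  have "max (pnorm z) 0 = pnorm z" "max 0 (pnorm z) = pnorm z" for z :: "'p padic"
    using pnorm_nonneg[of z] by auto
  hence d: "plane_dist (a, c) (b, c) = pnorm (a - b)" "plane_dist (c, a) (c, b) = pnorm (a - b)" for a b
    by (simp_all add: plane_dist_Pair pnorm_eq_0[THEN iffD2])
  show "ennreal u \<le> hausdorff_dim plane_dist (cantor_set u \<times> {c})"
    unfolding eq
    by (rule mass_distribution[OF ultrametric_plane_dist u(1) p0]) (unfold d, rule cantor_point_hoelder[OF u])
  show "ennreal u \<le> hausdorff_dim plane_dist ({c} \<times> cantor_set u)"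
    unfolding eq
    by (rule mass_distribution[OF ultrametric_plane_dist u(1) p0]) (unfold d, rule cantor_point_hoelder[OF u])
qed

text \<open>
  At level \<open>N\<close> the product is covered by at most \<open>p powr (N * (s + t))\<close> balls of radius \<open>p ^ - N\<close>, one
  for each pair of cells.
\<close>

lemma dim_cantor_product_le:
  assumes s: "0 < s" "s \<le> 1" and t: "0 < t" "t \<le> 1"
  shows "hausdorff_dim plane_dist (cantor_set s \<times> cantor_set t :: ('p::prime_card padic \<times> 'p padic) set) \<le> ennreal (s + t)"
proof (rule hausdorff_dim_leI)
  interpret P: ultrametric "plane_dist :: 'p padic \<times> 'p padic \<Rightarrow> _" by (rule ultrametric_plane_dist)
  let ?p = "CARD('p)"
  have p1: "1 < ?p" using prime_gt_1_nat[OF prime_card[where 'a = 'p]] .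
  define A :: "('p padic \<times> 'p padic) set" where "A = cantor_set s \<times> cantor_set t"
  fix r :: real assume r: "s + t < r"
  have "ball_content plane_dist r A \<le> 0 + ennreal e" if e: "0 < e" for e
  proof -
    define z where "z = real ?p powr (s + t - r)"
    have z: "0 < z" "z < 1" using r p1 powr_less_mono[of "s + t - r" 0 "real ?p"] by (simp_all add: z_def)
    obtain N where N: "z ^ N < e" using real_arch_pow_inv[OF e z(2)] by blast
    define \<delta> where "\<delta> = (1 / real ?p) ^ N"
    have \<delta>: "0 < \<delta>" using p1 by (simp add: \<delta>_def)
    define q where "q u = ?p ^ free_digits u N" for u
    \<comment> \<open>the left end point of the interval of the cell \<open>i\<close>\<close>
    define m where "m u i = real i / real (q u)" for u i
    have q0: "0 < q u" for u using p1 by (simp add: q_def)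
    have near: "\<exists>i<q u. pnorm (cantor_point u (m u i) - a :: 'p padic) \<le> \<delta>"
      if a: "a \<in> cantor_set u" and u: "0 < u" "u \<le> 1" for a u
    proof -
      obtain x where x: "x \<in> {0..<1}" "a = cantor_point u x" using a by (auto simp: cantor_set_def)
      define i where "i = nat \<lfloor>real (q u) * x\<rfloor>"
      have i: "real i = real_of_int \<lfloor>real (q u) * x\<rfloor>" using x by (simp add: i_def)
      have "real (q u) * x < real (q u)" using x q0[of u] by simp
      hence iq: "i < q u" using i by linarith
      have "real (q u) * m u i = real i" using q0[of u] by (simp add: m_def)
      hence "cell ?p u N (m u i) = cell ?p u N x"
        using i by (simp add: cell_def q_def)
      moreover have "m u i \<in> {0..<1}" using iq by (simp add: m_def)
      ultimately have "pnorm (cantor_point u (m u i) - a) \<le> \<delta>"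
        unfolding x(2) \<delta>_def using u x by (subst pnorm_cantor_point_le_iff) auto
      thus ?thesis using iq by blast
    qed
    define F where "F = {..<q s} \<times> {..<q t}"
    define c where "c = (\<lambda>(i, j). (cantor_point s (m s i), cantor_point t (m t j)) :: 'p padic \<times> 'p padic)"
    have "A \<subseteq> (\<Union>x\<in>F. {y. plane_dist (c x) y \<le> \<delta>})"
    proof
      fix y assume "y \<in> A"
      then obtain a b where y: "y = (a, b)" "a \<in> cantor_set s" "b \<in> cantor_set t" by (auto simp: A_def)
      obtain i where "i < q s" "pnorm (cantor_point s (m s i) - a) \<le> \<delta>" using near[OF y(2) s] by blast
      moreover obtain j where "j < q t" "pnorm (cantor_point t (m t j) - b) \<le> \<delta>" using near[OF y(3) t] by blast
      ultimately show "y \<in> (\<Union>x\<in>F. {y. plane_dist (c x) y \<le> \<delta>})"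
        by (intro UN_I[of "(i, j)"]) (auto simp: F_def c_def y(1) plane_dist_Pair)
    qed
    hence "ball_content plane_dist r A \<le> ennreal (\<Sum>x\<in>F. \<delta> powr r)"
      using \<delta> by (intro ball_content_le_finite) (auto simp: F_def)
    also have "(\<Sum>x\<in>F. \<delta> powr r) \<le> e"
    proof -
      have qle: "real (q u) \<le> real ?p powr (real N * u)" if "0 < u" for u
        using free_digits_bounds(1)[of u N] that p1 by (simp add: q_def powr_mono flip: powr_realpow)
      have "\<delta> powr r = real ?p powr (- (real N * r))"
        using p1 by (simp add: \<delta>_def power_one_over powr_minus powr_powr powr_divide divide_inverse inverse_powr flip: powr_realpow)
      hence "(\<Sum>x\<in>F. \<delta> powr r) = real (q s) * real (q t) * real ?p powr (- (real N * r))"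
        by (simp add: F_def)
      also have "\<dots> \<le> real ?p powr (real N * s) * real ?p powr (real N * t) * real ?p powr (- (real N * r))"
        using qle s t by (intro mult_mono) auto
      also have "\<dots> = z ^ N"
        unfolding z_def using p1 by (simp add: powr_power algebra_simps flip: powr_add)
      finally show ?thesis using N by simp
    qed
    finally show ?thesis by (simp add: ennreal_leI)
  qed
  hence "ball_content plane_dist r A \<le> 0" by (rule ennreal_le_epsilon)
  thus "hausdorff_measure plane_dist r (cantor_set s \<times> cantor_set t :: ('p padic \<times> 'p padic) set) = 0"
    using P.hausdorff_measure_0_if_content_0[of r A] r s t by (simp add: A_def)
qed (use s t in simp)

lemma furstenberg_cantor_product:
  assumes s: "0 < s" "s \<le> 1" and t: "0 < t" "t \<le> 1"
  shows "furstenberg_set s t (cantor_set s \<times> cantor_set t :: ('p::prime_card padic \<times> 'p padic) set)"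
proof -
  define E :: "('p padic \<times> 'p padic) set" where "E = cantor_set s \<times> cantor_set t"
  define L :: "('p padic \<times> 'p padic) set set" where "L = (\<lambda>b. {(x, y). y = b}) ` cantor_set t"
  have "is_line l" if l: "l \<in> L" for l
  proof -
    obtain b where "l = {(x, y). y = b}" using l by (auto simp: L_def)
    thus ?thesis unfolding is_line_def by (intro exI[of _ 0] exI[of _ 1] exI[of _ b]) simp
  qed
  moreover have "ennreal t \<le> line_family_dim L"
  proof -
    have "{0} \<times> cantor_set t \<subseteq> {(a, b). {(x, y). y = a * x + b} \<in> L}" by (auto simp: L_def)
    hence "ennreal t \<le> hausdorff_dim plane_dist {(a, b). {(x, y). y = a * x + b} \<in> L}"
      using dim_cantor_slices(2)[OF t] hausdorff_dim_mono order_trans by blast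
    thus ?thesis by (simp add: line_family_dim_def le_max_iff_disj)
  qed
  moreover have "ennreal s \<le> hausdorff_dim plane_dist (E \<inter> l)" if l: "l \<in> L" for l
  proof -
    obtain b where "b \<in> cantor_set t" "l = {(x, y). y = b}" using l by (auto simp: L_def)
    hence "cantor_set s \<times> {b} \<subseteq> E \<inter> l" by (auto simp: E_def)
    thus ?thesis using dim_cantor_slices(1)[OF s] hausdorff_dim_mono order_trans by blast
  qed
  ultimately show ?thesis unfolding furstenberg_set_def E_def by blast
qed

section \<open>The Furstenberg set theorem\<close>

theorem theorem1p2:
  fixes s t :: real
  assumes "0 < t" and "t \<le> s" and "s \<le> 1"
  shows "(\<forall>E :: ('p::prime_card padic \<times> 'p padic) set.
            furstenberg_set s t E \<longrightarrow> hausdorff_dim plane_dist E \<ge> ennreal (s + t))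
       \<and> (\<exists>E :: ('p padic \<times> 'p padic) set.
            furstenberg_set s t E \<and> hausdorff_dim plane_dist E = ennreal (s + t))"
proof (intro conjI allI impI)
  have st: "0 < s" "t \<le> 1" using assms by auto
  show lower: "ennreal (s + t) \<le> hausdorff_dim plane_dist E"
    if "furstenberg_set s t E" for E :: "('p padic \<times> 'p padic) set"
    using assms(1,2) that by (rule furstenberg_dim_ge)
  let ?E = "cantor_set s \<times> cantor_set t :: ('p padic \<times> 'p padic) set"
  have furst: "furstenberg_set s t ?E"
    using st assms by (intro furstenberg_cantor_product)
  moreover have "hausdorff_dim plane_dist ?E \<le> ennreal (s + t)"
    using st assms by (intro dim_cantor_product_le)
  ultimately show "\<exists>E :: ('p padic \<times> 'p padic) set.
      furstenberg_set s t E \<and> hausdorff_dim plane_dist E = ennreal (s + t)"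
    using lower[OF furst] by (intro exI[of _ ?E] conjI antisym)
qed

end
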